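(* For every integer $n\ge 5$, the number of connected components of $U^{n+1}$ equals $3\cdot 2^{n}$; equivalently, the number of orbits of the first $\mathfrak G_n$-action on $T^n(\mathbb F_2)$ equals $3\cdot 2^n$.
   Context: Let $N^{n+1}$ be the group of real unipotent upper triangular $(n+1)\times(n+1)$ matrices (with its usual topology as a real vector space of dimension $n(n+1)/2$). For $1\le i\le n$ let $D_i$ be the determinant of the submatrix formed by the first $i$ rows and the last $i$ columns. Put $U^{n+1}=N^{n+1}\setminus\bigcup_{i=1}^n\{D_i=0\}$. Let $T^n(\mathbb F_2)$ be the $\mathbb F_2$-vector space of upper triangular $n\times n$ matrices $M=(m_{ij})_{1\le i\le j\le n}$ over $\mathbb F_2$. For $1\le i\le j\le n-1$ let $g_{ij}$ be the linear map $T^n(\mathbb F_2)\to T^n(\mathbb F_2)$ that adds the element $m_{ij}+m_{i+1,j+1}$ to each of the entries $m_{ij},m_{i,j+1},m_{i+1,j},m_{i+1,j+1}$ (when $i=j$ the entry $m_{i+1,j}$ lies below the diagonal and is omitted) and leaves all other entries unchanged. $\mathfrak G_n\subset GL(T^n(\mathbb F_2))$ is the subgroup generated by all the $g_{ij}$, and its action on $T^n(\mathbb F_2)$ is the first $\mathfrak G_n$-action. *)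

theory Defs
  imports
    "HOL-Analysis.Abstract_Topological_Spaces"
    "HOL-Analysis.Function_Topology"
    "HOL-Algebra.Group_Action"
    "HOL-Algebra.Elementary_Groups"
    "HOL-Library.Z2"
    "Jordan_Normal_Form.Determinant"
    "Jordan_Normal_Form.DL_Submatrix"
begin

text \<open>
  Rows and columns are indexed from 0: the entry in row \<open>a\<close> and column \<open>b\<close> of the usual
  1-based indexing is \<open>A $$ (a - 1, b - 1)\<close>.
\<close>

section \<open>The space of unipotent matrices and its open subset\<close>

definition unipotent_mats :: "nat \<Rightarrow> real mat set" where
  "unipotent_mats m =
    {A \<in> carrier_mat m m. upper_triangular A \<and> (\<forall>i<m. A $$ (i, i) = 1)}"

text \<open>
  The usual topology on the \<open>m \<times> m\<close> real matrices, i.e. that of \<open>\<real>\<close> to the power \<open>m * m\<close>, pulled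
  back along the (bijective) map sending a matrix to its family of entries.
\<close>

definition mat_topology :: "nat \<Rightarrow> real mat topology" where
  "mat_topology m =
    pullback_topology (carrier_mat m m)
      (\<lambda>A. \<lambda>p\<in>{..<m} \<times> {..<m}. A $$ p)
      (product_topology (\<lambda>_. euclideanreal) ({..<m} \<times> {..<m}))"

definition corner_minor :: "nat \<Rightarrow> real mat \<Rightarrow> nat \<Rightarrow> real" where
  "corner_minor m A i = Determinant.det (submatrix A {..<i} {m - i..<m})"

lemma pick_atLeastLessThan: "k < u - l \<Longrightarrow> pick {l..<u} k = l + k"
proof (induction k)
  case 0
  then show ?case by (auto intro!: Least_equality)
next
  case (Suc k)
  then have "pick {l..<u} k = l + k" by simp
  with Suc.prems show ?case by (auto intro!: Least_equality)
qed

lemma corner_minor_eq: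
  assumes "A \<in> carrier_mat m m" "i \<le> m"
  shows "corner_minor m A i = Determinant.det (mat i i (\<lambda>(a, b). A $$ (a, m - i + b)))"
proof -
  have "{a. a < m \<and> a \<in> {..<i}} = {..<i}" "{b. b < m \<and> b \<in> {m - i..<m}} = {m - i..<m}"
    using assms(2) by auto
  moreover have "pick {..<i} a = a" if "a < i" for a
    using pick_atLeastLessThan[of a i 0] that by (simp add: atLeast0LessThan)
  moreover have "pick {m - i..<m} b = m - i + b" if "b < i" for b
    using pick_atLeastLessThan[of b m "m - i"] that assms(2) by simp
  ultimately have "submatrix A {..<i} {m - i..<m} = mat i i (\<lambda>(a, b). A $$ (a, m - i + b))"
    using assms by (intro eq_matI) (auto simp: submatrix_def)
  then show ?thesis by (simp add: corner_minor_def)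
qed

definition U_set :: "nat \<Rightarrow> real mat set" where
  "U_set m = unipotent_mats m - (\<Union>i\<in>{1..m - 1}. {A. corner_minor m A i = 0})"

definition U_space :: "nat \<Rightarrow> real mat topology" where
  "U_space m = subtopology (mat_topology m) (U_set m)"

lemma topspace_U_space: "topspace (U_space m) = U_set m"
  by (auto simp: U_space_def mat_topology_def topspace_pullback_topology U_set_def
      unipotent_mats_def)

section \<open>The first action on upper triangular matrices over the field with two elements\<close>

definition T_mats :: "nat \<Rightarrow> bit mat set" where
  "T_mats n = {M \<in> carrier_mat n n. upper_triangular M}"

definition GL_T :: "nat \<Rightarrow> (bit mat \<Rightarrow> bit mat) monoid" where
  "GL_T n = BijGroup (T_mats n)
    \<lparr>carrier := {f \<in> Bij (T_mats n).
       (\<forall>M\<in>T_mats n. \<forall>M'\<in>T_mats n. f (M + M') = f M + f M') \<and>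
       (\<forall>c. \<forall>M\<in>T_mats n. f (c \<cdot>\<^sub>m M) = c \<cdot>\<^sub>m f M)}\<rparr>"

text \<open>
  The condition \<open>a \<le> b\<close> drops the entry in row \<open>i + 1\<close> and column \<open>j\<close> when \<open>i = j\<close>.
\<close>

definition g_map :: "nat \<Rightarrow> nat \<Rightarrow> nat \<Rightarrow> bit mat \<Rightarrow> bit mat" where
  "g_map n i j =
    (\<lambda>M\<in>T_mats n. mat n n (\<lambda>(a, b).
      if a \<le> b \<and> (a, b) \<in> {(i, j), (i, j + 1), (i + 1, j), (i + 1, j + 1)}
      then M $$ (a, b) + (M $$ (i, j) + M $$ (i + 1, j + 1))
      else M $$ (a, b)))"

definition G_group :: "nat \<Rightarrow> (bit mat \<Rightarrow> bit mat) monoid" where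
  "G_group n = subgroup_generated (GL_T n) {g_map n i j | i j. i \<le> j \<and> j + 1 < n}"

lemma T_mats_dim: "M \<in> T_mats n \<Longrightarrow> dim_row M = n" "M \<in> T_mats n \<Longrightarrow> dim_col M = n"
  by (auto simp: T_mats_def)

lemma T_mats_add: "M \<in> T_mats n \<Longrightarrow> M' \<in> T_mats n \<Longrightarrow> M + M' \<in> T_mats n"
  by (auto simp: T_mats_def upper_triangular_def)

lemma T_mats_smult: "M \<in> T_mats n \<Longrightarrow> c \<cdot>\<^sub>m M \<in> T_mats n"
  by (auto simp: T_mats_def upper_triangular_def)

lemma g_map_dim:
  assumes "M \<in> T_mats n"
  shows "dim_row (g_map n i j M) = n" "dim_col (g_map n i j M) = n"
  using assms by (simp_all add: g_map_def)

lemma g_map_index: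
  assumes "M \<in> T_mats n" "a < n" "b < n"
  shows "g_map n i j M $$ (a, b) =
    M $$ (a, b) +
    (if a \<le> b \<and> (a, b) \<in> {(i, j), (i, j + 1), (i + 1, j), (i + 1, j + 1)} then 1 else 0)
      * (M $$ (i, j) + M $$ (i + 1, j + 1))"
proof (cases "a \<le> b \<and> (a, b) \<in> {(i, j), (i, j + 1), (i + 1, j), (i + 1, j + 1)}")
  case True
  then show ?thesis using assms unfolding g_map_def
    by (simp only: restrict_apply' index_mat prod.case if_True simp_thms mult_1)
next
  case False
  then show ?thesis using assms unfolding g_map_def
    by (simp only: restrict_apply' index_mat prod.case if_False mult_zero_left add_0_right)
qed

lemma g_map_closed: "M \<in> T_mats n \<Longrightarrow> g_map n i j M \<in> T_mats n"
  by (auto simp: g_map_def T_mats_def upper_triangular_def)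

lemma g_map_involution:
  assumes "i \<le> j" "j + 1 < n" "M \<in> T_mats n"
  shows "g_map n i j (g_map n i j M) = M"
proof -
  define N where "N = g_map n i j M"
  have N: "N \<in> T_mats n" unfolding N_def by (rule g_map_closed[OF assms(3)])
  have "M $$ (i, j) + 1 * (M $$ (i, j) + M $$ (i + 1, j + 1))
      + (M $$ (i + 1, j + 1) + 1 * (M $$ (i, j) + M $$ (i + 1, j + 1)))
      = M $$ (i, j) + M $$ (i + 1, j + 1)"
    by (cases "M $$ (i, j)"; cases "M $$ (i + 1, j + 1)") simp_all
  then have s: "N $$ (i, j) + N $$ (i + 1, j + 1) = M $$ (i, j) + M $$ (i + 1, j + 1)"
    unfolding N_def using assms by (simp add: g_map_index)
  have c: "x + y + y = x" for x y :: bit by (cases x; cases y) auto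
  have "g_map n i j N = M"
  proof (rule eq_matI)
    fix a b assume "a < dim_row M" "b < dim_col M"
    then have ab: "a < n" "b < n" using assms(3) by (simp_all add: T_mats_dim)
    show "g_map n i j N $$ (a, b) = M $$ (a, b)"
      unfolding g_map_index[OF N ab] s unfolding N_def g_map_index[OF assms(3) ab] by (rule c)
  qed (simp_all only: g_map_dim[OF N] T_mats_dim[OF assms(3)])
  then show ?thesis by (simp only: N_def)
qed

lemma g_map_in_GL:
  assumes "i \<le> j" "j + 1 < n"
  shows "g_map n i j \<in> carrier (GL_T n)"
proof -
  have idx: "i < n" "j < n" "i + 1 < n" using assms by auto
  have "bij_betw (g_map n i j) (T_mats n) (T_mats n)"
    by (rule bij_betw_byWitness[where f' = "g_map n i j"])
      (use assms g_map_involution g_map_closed in auto)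
  moreover have "g_map n i j \<in> extensional (T_mats n)" by (simp add: g_map_def)
  moreover have "g_map n i j (M + M') = g_map n i j M + g_map n i j M'"
    if M: "M \<in> T_mats n" "M' \<in> T_mats n" for M M'
  proof (rule eq_matI)
    fix a b
    assume "a < dim_row (g_map n i j M + g_map n i j M')"
      "b < dim_col (g_map n i j M + g_map n i j M')"
    then have ab: "a < n" "b < n" using M by (simp_all add: g_map_dim)
    have d: "x + x' + q * (y + y' + (z + z')) = (x + q * (y + z)) + (x' + q * (y' + z'))"
      for x x' y y' z z' q :: bit by (simp only: distrib_left ac_simps)
    have e: "(M + M') $$ (p, q) = M $$ (p, q) + M' $$ (p, q)" if "p < n" "q < n" for p q
      using that M by (simp add: T_mats_dim)
    have f: "(g_map n i j M + g_map n i j M') $$ (a, b)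
        = g_map n i j M $$ (a, b) + g_map n i j M' $$ (a, b)"
      using ab M by (simp add: g_map_dim)
    show "g_map n i j (M + M') $$ (a, b) = (g_map n i j M + g_map n i j M') $$ (a, b)"
      unfolding f g_map_index[OF T_mats_add[OF M] ab] g_map_index[OF M(1) ab]
        g_map_index[OF M(2) ab] e[OF ab] e[OF idx(1,2)] e[OF idx(3) assms(2)]
      by (rule d)
  qed (simp_all only: g_map_dim M T_mats_add index_add_mat)
  moreover have "g_map n i j (c \<cdot>\<^sub>m M) = c \<cdot>\<^sub>m g_map n i j M" if M: "M \<in> T_mats n" for c M
  proof (cases c)
    case zero
    show ?thesis
    proof (rule eq_matI)
      fix a b
      assume "a < dim_row (c \<cdot>\<^sub>m g_map n i j M)" "b < dim_col (c \<cdot>\<^sub>m g_map n i j M)"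
      then have ab: "a < n" "b < n" using M by (simp_all add: g_map_dim)
      have e: "(c \<cdot>\<^sub>m M) $$ (p, q) = 0" if "p < n" "q < n" for p q
        using that M zero by (simp add: T_mats_dim)
      have f: "(c \<cdot>\<^sub>m g_map n i j M) $$ (a, b) = 0"
        using ab M zero by (simp add: g_map_dim)
      show "g_map n i j (c \<cdot>\<^sub>m M) $$ (a, b) = (c \<cdot>\<^sub>m g_map n i j M) $$ (a, b)"
        unfolding f g_map_index[OF T_mats_smult[OF M] ab] e[OF ab] e[OF idx(1,2)]
          e[OF idx(3) assms(2)] by (simp only: add_0 mult_zero_right)
    qed (simp_all only: g_map_dim M T_mats_smult index_smult_mat)
  next
    case one
    have "c \<cdot>\<^sub>m A = A" for A :: "bit mat" by (rule eq_matI) (simp_all add: one)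
    then show ?thesis by (simp only:)
  qed
  ultimately show ?thesis by (simp add: GL_T_def Bij_def)
qed

lemma subgroup_GL_T: "subgroup (carrier (GL_T n)) (BijGroup (T_mats n))"
proof -
  let ?T = "T_mats n"
  interpret B: group "BijGroup ?T" by (rule group_BijGroup)
  note add = T_mats_add and smult = T_mats_smult
  show ?thesis
  proof (rule B.subgroupI)
    show "carrier (GL_T n) \<subseteq> carrier (BijGroup ?T)" by (auto simp: GL_T_def BijGroup_def)
    have "(\<lambda>x\<in>?T. x) \<in> carrier (GL_T n)"
      by (simp add: GL_T_def id_Bij add smult)
    then show "carrier (GL_T n) \<noteq> {}" by blast
  next
    fix f assume f: "f \<in> carrier (GL_T n)"
    then have fB: "f \<in> Bij ?T" by (simp add: GL_T_def)
    then have bij: "bij_betw f ?T ?T" by (simp add: Bij_def)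
    let ?h = "inv_into ?T f"
    have hT: "?h M \<in> ?T" "f (?h M) = M" if "M \<in> ?T" for M
      using that bij by (auto simp: bij_betw_def inv_into_into f_inv_into_f)
    have eq: "?h M = X" if "f X = M" "X \<in> ?T" for X M
      using that bij by (auto simp: bij_betw_def)
    have inv: "inv\<^bsub>BijGroup ?T\<^esub> f = (\<lambda>x\<in>?T. ?h x)"
      using inv_BijGroup[OF fB] .
    have "?h (M + M') = ?h M + ?h M'" if "M \<in> ?T" "M' \<in> ?T" for M M'
      by (rule eq) (use f that hT add in \<open>auto simp: GL_T_def\<close>)
    moreover have "?h (c \<cdot>\<^sub>m M) = c \<cdot>\<^sub>m ?h M" if "M \<in> ?T" for c M
      by (rule eq) (use f that hT smult in \<open>auto simp: GL_T_def\<close>)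
    ultimately show "inv\<^bsub>BijGroup ?T\<^esub> f \<in> carrier (GL_T n)"
      unfolding inv using fB by (simp add: GL_T_def restrict_inv_into_Bij add smult)
  next
    fix f g assume fg: "f \<in> carrier (GL_T n)" "g \<in> carrier (GL_T n)"
    then have B: "f \<in> Bij ?T" "g \<in> Bij ?T" by (simp_all add: GL_T_def)
    have gT: "g M \<in> ?T" if "M \<in> ?T" for M using B(2) that Bij_imp_funcset by blast
    show "f \<otimes>\<^bsub>BijGroup ?T\<^esub> g \<in> carrier (GL_T n)"
      using fg B gT by (simp add: GL_T_def BijGroup_def compose_Bij compose_eq add smult)
  qed
qed

lemma group_GL_T: "group (GL_T n)"
  using group.subgroup_imp_group[OF group_BijGroup subgroup_GL_T[of n]]
  by (simp add: GL_T_def)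

lemma group_action_G_group: "group_action (G_group n) (T_mats n) (\<lambda>g. g)"
proof -
  have G: "group (G_group n)"
    unfolding G_group_def by (rule group.group_subgroup_generated[OF group_GL_T])
  have "carrier (G_group n) \<subseteq> carrier (GL_T n)"
    unfolding G_group_def by (rule group.carrier_subgroup_generated_subset[OF group_GL_T])
  then have "carrier (G_group n) \<subseteq> carrier (BijGroup (T_mats n))"
    using subgroup.subset[OF subgroup_GL_T] by blast
  moreover have "monoid.mult (G_group n) = monoid.mult (BijGroup (T_mats n))"
    by (simp add: G_group_def subgroup_generated_def GL_T_def)
  ultimately have "(\<lambda>g. g) \<in> hom (G_group n) (BijGroup (T_mats n))"
    by (auto simp: hom_def)
  with G show ?thesis
    by (simp add: group_action_def group_hom_def group_hom_axioms_def group_BijGroup)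
qed

end

theory Submission
  imports Defs
begin

text \<open>
  Both numbers are the number of classes of one combinatorial game.

  Let \<open>minor x a k\<close> be the minor of a unipotent matrix in the first \<open>k\<close> rows and the \<open>k\<close> columns starting
  with column \<open>a\<close> (columns being numbered from 0). Those reaching the last column are the \<open>D\<^sub>k\<close> and do not
  vanish on the space; the others may. A point where all of them are nonzero has a state, the set of
  positions \<open>(a, k)\<close> of negative minors in a triangular grid. The Pluecker relation \<open>minor_pluecker\<close>
  shows that a wall, where just one of the minors vanishes, separates two states only if an odd number
  of the six lattice neighbours of its position lie in the state. Flipping such positions is the game.
  The bijection \<open>tmat\<close> from states to upper triangular matrices turns the moves at a position into the
  generator \<open>g\<^sub>i\<^sub>j\<close>, so that orbits correspond to classes of states (\<open>card_orbits_eq_card_cls\<close>).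

  The classes are counted as follows (\<open>card_cls\<close>). The game preserves the signs of the \<open>D\<^sub>k\<close> and a
  quadratic form modulo 2. There are \<open>2 ^ n\<close> states in which no move is possible. All other states with
  the same \<open>n\<close> signs and the same value of the quadratic form are connected, which gives \<open>2 * 2 ^ n\<close>
  further classes. Connectedness holds for every connected graph containing the Dynkin diagram of type
  E6 (\<open>arf_transitive_connected\<close>), by a finite verification for E6 and by adding one vertex at a time;
  the grid contains E6 when \<open>n \<ge> 5\<close>.

  That components of the space correspond to classes (\<open>card_components\<close>) has two halves. The set of
  points with a given state is connected (\<open>connected_cell\<close>), and two states joined by a move have points
  joined by a path in the space (\<open>adjacent_cells\<close>), so there are at most as many components as classes.
  Conversely the class must be shown to be locally constant even near points where several minors vanish.
  Adding \<open>s\<close> times a column to the next one changes only the minors starting at the latter, each of them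
  affinely in \<open>s\<close>, and for a generic starting point they vanish at different values of \<open>s\<close>. Each such
  zero is a legal move (\<open>crossing\<close>). Since the generic points are dense and the operations between
  neighbouring columns generate, through commutators, all column operations, any two nearby points are
  compared in this way (\<open>region_closed\<close>).
\<close>

section \<open>Flip games\<close>

text \<open>
  A state is a set of vertices. A move flips the membership of a vertex that is \<open>lit\<close>, i.e. has an odd
  number of neighbours in the state; this is a symplectic transvection over the field with two elements.
  Vertices outside the set \<open>B\<close> of playable vertices serve as fixed boundary data, which is why \<open>reach\<close>
  carries \<open>B\<close> as a parameter while states live on the whole graph.
\<close>

locale flip_game =
  fixes adj :: "'v \<Rightarrow> 'v \<Rightarrow> bool"
  assumes adj_sym: "adj u v \<Longrightarrow> adj v u" and adj_irrefl: "\<not> adj v v"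
begin

definition lit :: "'v set \<Rightarrow> 'v \<Rightarrow> bool" where
  "lit c v \<longleftrightarrow> odd (card {u \<in> c. adj v u})"

definition flip :: "'v \<Rightarrow> 'v set \<Rightarrow> 'v set" where
  "flip v c = (if v \<in> c then c - {v} else insert v c)"

definition edges :: "'v set \<Rightarrow> 'v set set" where
  "edges c = {e. \<exists>u\<in>c. \<exists>v\<in>c. adj u v \<and> e = {u, v}}"

text \<open>
  Modulo 2 this is the quadratic form with value 1 at every vertex whose polarization is the adjacency
  form. Edges to vertices outside \<open>B\<close> are counted as well, so one function is invariant for every \<open>B\<close>.
\<close>

definition arf :: "'v set \<Rightarrow> bool" where
  "arf c \<longleftrightarrow> odd (card c + card (edges c))"

definition step :: "'v set \<Rightarrow> 'v set \<Rightarrow> 'v set \<Rightarrow> bool" where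
  "step B c c' \<longleftrightarrow> (\<exists>v\<in>B. lit c v \<and> c' = flip v c)"

abbreviation reach :: "'v set \<Rightarrow> 'v set \<Rightarrow> 'v set \<Rightarrow> bool" where
  "reach B \<equiv> (step B)\<^sup>*\<^sup>*"

text \<open>
  The inactive states are the fixed points of the game.
\<close>

definition active :: "'v set \<Rightarrow> 'v set \<Rightarrow> bool" where
  "active B c \<longleftrightarrow> (\<exists>v\<in>B. lit c v)"

text \<open>
  The strongest transitivity that the invariants permit: the boundary data \<open>c - B\<close> and \<open>arf\<close> separate
  the nontrivial classes.
\<close>

definition arf_transitive :: "'v set \<Rightarrow> bool" where
  "arf_transitive B \<longleftrightarrow> (\<forall>c c'. finite c \<longrightarrow> finite c' \<longrightarrow> c - B = c' - B \<longrightarrow>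
     active B c \<longrightarrow> active B c' \<longrightarrow> arf c = arf c' \<longrightarrow> reach B c c')"

lemma adj_commute: "adj u v \<longleftrightarrow> adj v u"
  using adj_sym by blast

lemma finite_flip [simp]: "finite (flip v c) \<longleftrightarrow> finite c"
  by (simp add: flip_def)

lemma mem_flip: "u \<in> flip v c \<longleftrightarrow> (u \<in> c) \<noteq> (u = v)"
  by (auto simp: flip_def)

lemma flip_flip [simp]: "flip v (flip v c) = c"
  by (auto simp: flip_def)

lemma flip_Diff: "v \<in> B \<Longrightarrow> flip v c - B = c - B"
  by (auto simp: flip_def)

lemma lit_insert:
  assumes "finite c" "v \<notin> c"
  shows "lit (insert v c) u \<longleftrightarrow> lit c u \<noteq> adj u v"
proof -
  have "{w \<in> insert v c. adj u w} = (if adj u v then insert v {w \<in> c. adj u w} else {w \<in> c. adj u w})"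
    by auto
  then show ?thesis using assms by (simp add: lit_def)
qed

lemma lit_flip:
  assumes "finite c"
  shows "lit (flip v c) u \<longleftrightarrow> lit c u \<noteq> adj u v"
proof (cases "v \<in> c")
  case True
  have "lit (insert v (c - {v})) u \<longleftrightarrow> lit (c - {v}) u \<noteq> adj u v"
    by (rule lit_insert) (use assms in auto)
  with True show ?thesis by (auto simp: flip_def insert_absorb)
qed (simp add: flip_def lit_insert[OF assms])

text \<open>
  The new vertex contributes itself and one edge for each of its neighbours in \<open>c\<close>.
\<close>

lemma arf_insert:
  assumes "finite c" "v \<notin> c"
  shows "arf (insert v c) \<longleftrightarrow> arf c = lit c v"
proof -
  let ?N = "{u \<in> c. adj v u}"
  have e: "edges (insert v c) = edges c \<union> (\<lambda>u. {v, u}) ` ?N"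
  proof (intro equalityI subsetI)
    fix e assume "e \<in> edges (insert v c)"
    then obtain a b where ab: "a \<in> insert v c" "b \<in> insert v c" "adj a b" "e = {a, b}"
      by (auto simp: edges_def)
    consider "a = v" | "b = v" | "a \<noteq> v" "b \<noteq> v" by blast
    then show "e \<in> edges c \<union> (\<lambda>u. {v, u}) ` ?N"
    proof cases
      case 1
      with ab adj_irrefl have "b \<in> ?N" by auto
      with 1 ab(4) show ?thesis by blast
    next
      case 2
      with ab adj_irrefl adj_sym have "a \<in> ?N" by blast
      with 2 ab(4) show ?thesis by blast
    qed (use ab in \<open>auto simp: edges_def\<close>)
  qed (auto simp: edges_def)
  have "edges c \<subseteq> Pow c" by (auto simp: edges_def)
  then have fin: "finite (edges c)" using assms(1) by (meson finite_Pow_iff finite_subset)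
  have "edges c \<inter> (\<lambda>u. {v, u}) ` ?N = {}"
    using assms(2) by (auto simp: edges_def doubleton_eq_iff)
  then have "card (edges (insert v c)) = card (edges c) + card ((\<lambda>u. {v, u}) ` ?N)"
    unfolding e using fin assms(1) by (intro card_Un_disjoint) auto
  moreover have "card ((\<lambda>u. {v, u}) ` ?N) = card ?N"
    using assms(2) by (intro card_image) (auto simp: inj_on_def doubleton_eq_iff)
  ultimately show ?thesis using assms by (auto simp: arf_def lit_def)
qed

lemma arf_flip:
  assumes "finite c"
  shows "arf (flip v c) \<longleftrightarrow> arf c = lit c v"
proof (cases "v \<in> c")
  case True
  have "arf (insert v (c - {v})) \<longleftrightarrow> arf (c - {v}) = lit (c - {v}) v"
    by (rule arf_insert) (use assms in auto)
  moreover have "lit (c - {v}) v = lit c v"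
    using lit_flip[OF assms, of v v] True adj_irrefl by (simp add: flip_def)
  ultimately show ?thesis using True by (auto simp: flip_def insert_absorb)
qed (simp add: flip_def arf_insert[OF assms])

lemma step_sym: "finite c \<Longrightarrow> step B c c' \<Longrightarrow> step B c' c"
  unfolding step_def by (metis adj_irrefl flip_flip lit_flip)

lemma step_invariants:
  assumes "step B c c'" "finite c"
  shows "finite c'" "c' - B = c - B" "arf c' = arf c" "active B c" "active B c'"
proof -
  obtain v where v: "v \<in> B" "lit c v" "c' = flip v c" using assms(1) by (auto simp: step_def)
  show "finite c'" "c' - B = c - B" "arf c' = arf c" "active B c" "active B c'"
    using v assms(2) adj_irrefl by (auto simp: arf_flip flip_Diff active_def lit_flip)
qed

lemma reach_invariants:
  assumes "reach B c c'" "finite c"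
  shows "finite c'" "c' - B = c - B" "arf c' = arf c" "c' = c \<or> active B c \<and> active B c'"
  using assms(1)
proof (induction rule: rtranclp_induct)
  case (step y z)
  { case 1 show ?case using step_invariants[OF step.hyps(2) step.IH(1)] by simp }
  { case 2 show ?case using step_invariants[OF step.hyps(2) step.IH(1)] step.IH by simp }
  { case 3 show ?case using step_invariants[OF step.hyps(2) step.IH(1)] step.IH by simp }
  { case 4 show ?case using step_invariants[OF step.hyps(2) step.IH(1)] step.IH by auto }
qed (use assms in auto)

lemma reach_sym:
  assumes "reach B c c'" "finite c" shows "reach B c' c"
  using assms(1)
proof (induction rule: rtranclp_induct)
  case (step y z)
  have "step B z y" using step reach_invariants(1)[OF step(1) assms(2)] step_sym by blast
  then show ?case using step.IH by (rule converse_rtranclp_into_rtranclp)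
qed simp

lemma reach_mono: "reach B c c' \<Longrightarrow> B \<subseteq> B' \<Longrightarrow> reach B' c c'"
  by (erule rtranclp_mono[THEN predicate2D, rotated]) (unfold step_def, blast)

text \<open>
  States that agree off \<open>H\<close> differ by flips, legal or not, at vertices of \<open>H\<close>. Hence any quantity that
  every flip preserves depends on the state only through its part off \<open>H\<close>.
\<close>

lemma flip_invariant_agree:
  assumes "finite H" "finite c" "finite c'" "c - H = c' - H"
    and inv: "\<And>d v. finite d \<Longrightarrow> v \<in> H \<Longrightarrow> P (flip v d) = P d"
  shows "P c = P c'"
  using assms(1,2,4) inv
proof (induction H arbitrary: c rule: finite_induct)
  case (insert v H)
  define d where "d = (if v \<in> c \<longleftrightarrow> v \<in> c' then c else flip v c)"
  have "d - H = c' - H"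
    using insert.prems(2) insert.hyps unfolding d_def by (auto simp: mem_flip set_eq_iff)
  then have "P d = P c'" using insert by (simp add: d_def)
  then show ?case using insert.prems by (auto simp: d_def split: if_splits)
qed auto

end


section \<open>The game on the Dynkin diagram of type E6\<close>


text \<open>
  The diagram is the path 0-1-2-3-4 with 5 joined to 2. Its adjacency matrix is invertible modulo 2, so
  the vector of lit vertices is a coordinate system for the states on it. In these coordinates a move
  at \<open>i\<close> adds the \<open>i\<close>-th row of the adjacency matrix and needs entry \<open>i\<close> to be true. Nothing refers to
  the rest of the graph, so a single finite check covers every possible boundary condition.
\<close>

definition e6 :: "nat \<Rightarrow> nat \<Rightarrow> bool" where
  "e6 i j \<longleftrightarrow> (i, j) \<in> set [(0,1),(1,0),(1,2),(2,1),(2,3),(3,2),(3,4),(4,3),(2,5),(5,2)]"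

definition e6_row :: "nat \<Rightarrow> bool list" where
  "e6_row i = map (e6 i) [0, 1, 2, 3, 4, 5]"

definition e6_move :: "bool list \<Rightarrow> nat \<Rightarrow> bool list" where
  "e6_move v i = map2 (\<noteq>) v (e6_row i)"

text \<open>
  The inverse of the adjacency matrix modulo 2: from the lit vertices back to the vertices of the state.
\<close>

definition e6_inv :: "bool list \<Rightarrow> bool list" where
  "e6_inv v = [v!1 \<noteq> v!5, v!0, v!5, v!4, v!3 \<noteq> v!5, (v!0 \<noteq> v!2) \<noteq> v!4]"

definition xor_list :: "bool list \<Rightarrow> bool" where
  "xor_list xs = foldr (\<noteq>) xs False"

text \<open>
  The quadratic form \<open>arf\<close> in lit coordinates. The first six summands count vertices, the other five
  count edges.
\<close>

definition e6_arf :: "bool list \<Rightarrow> bool" where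
  "e6_arf v = (let y = e6_inv v in
     xor_list (y @ [y!0 \<and> y!1, y!1 \<and> y!2, y!2 \<and> y!3, y!3 \<and> y!4, y!2 \<and> y!5]))"

definition e6_dot :: "bool list \<Rightarrow> bool list \<Rightarrow> bool" where
  "e6_dot u y = xor_list (map2 (\<and>) u y)"

text \<open>
  The value \<open>[]\<close> marks an illegal move; it differs from every vector of length six.
\<close>

fun e6_run :: "bool list \<Rightarrow> nat list \<Rightarrow> bool list" where
  "e6_run v [] = v"
| "e6_run v (i # is) = (if v ! i then e6_run (e6_move v i) is else [])"

abbreviation bits6 :: "bool list list" where
  "bits6 \<equiv> List.n_lists 6 [False, True]"

abbreviation zero6 :: "bool list" where
  "zero6 \<equiv> [False, False, False, False, False, False]"

text \<open>
  Representatives of the two nonzero orbits, of 36 and 27 elements: the Weyl group of type E6 acting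
  on the root lattice modulo 2.
\<close>

definition e6_root :: "bool \<Rightarrow> bool list" where
  "e6_root q = (if q then [True, False, True, False, True, True] else [False, True, False, True, False, False])"

text \<open>
  Certificates, in the order of \<open>bits6\<close>: a shortest sequence of moves from each nonzero vector to the
  representative with the same quadratic form, found by breadth-first search.
\<close>

definition e6_words :: "nat list list" where
  "e6_words = [
    [], [0,1,2,5,3,4,2,3], [1,2,5,3,4], [1,2,5,3,4,2,3], [2,3,4,1,0], [2,5,3,4,0], [2,5,3,4,2,3],
    [2,5,3,4], [3,2,5,1,0], [3,2,0], [], [3,2], [2,5,1,2,0,1], [0,1], [3,1,2], [1],
    [4,3,2,5,1,2,0,1], [4,3,0,1], [4,1,2], [4,3,1], [2,5,4,1,0], [4,2,0], [4,3], [4,2],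
    [3,2,5,1,2,0,1], [3,0,1], [1,2], [3,1], [2,5,1,0], [2,0], [3], [2], [5,2,3,1,2], [5,2,1],
    [1,2,0,1], [5,2,0,1], [2,3,1,2], [2,1], [5,1,2,0,1], [2,0,1], [3,4,2,3], [3,4], [5,3,4,1,0],
    [3,4,0], [5,3,4,2,3], [5,3,4], [3,4,1,0], [5,3,4,0], [5,2,3], [5], [1,0], [5,0], [2,3], [],
    [5,1,0], [0], [5,4,2,3], [5,4], [4,1,0], [5,4,0], [4,2,3], [4], [5,4,1,0], [4,0]]"

definition e6_word_ok :: "bool list \<times> nat list \<Rightarrow> bool" where
  "e6_word_ok p \<longleftrightarrow> fst p = zero6 \<or> e6_run (fst p) (snd p) = e6_root (e6_arf (fst p)) \<and> list_all (\<lambda>i. i < 6) (snd p)"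

lemma e6_check_words: "list_all e6_word_ok (zip bits6 e6_words)"
  by code_simp

lemma length_e6_words: "length e6_words = length bits6"
  by code_simp

definition e6_move_ok :: "bool list \<Rightarrow> nat \<Rightarrow> bool" where
  "e6_move_ok v i \<longleftrightarrow> e6_arf (e6_move v i) = (e6_arf v = v ! i)
      \<and> e6_inv (e6_move v i) = (e6_inv v)[i := \<not> e6_inv v ! i]"

definition e6_moves_ok :: "bool list \<Rightarrow> bool" where
  "e6_moves_ok v \<longleftrightarrow> list_all (e6_move_ok v) [0, 1, 2, 3, 4, 5]"

lemma e6_check_moves: "list_all e6_moves_ok bits6"
  by code_simp

text \<open>
  Vectors with prescribed quadratic form on an affine hyperplane, avoiding two given points. They are
  what is needed to attach a further vertex with adjacency vector \<open>u\<close> to the diagram: \<open>e6_dot u\<close> of the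
  state decides whether the new vertex is lit, and the two points \<open>zero6\<close> and \<open>u\<close> are the inactive
  states before and after it is flipped.
\<close>

definition e6_witness :: "bool list \<Rightarrow> bool \<Rightarrow> bool \<Rightarrow> bool list \<Rightarrow> bool" where
  "e6_witness u b q v \<longleftrightarrow> v \<noteq> zero6 \<and> v \<noteq> u \<and> e6_dot u (e6_inv v) = b \<and> e6_arf v = q"

definition e6_witnesses :: "bool list \<Rightarrow> bool" where
  "e6_witnesses u \<longleftrightarrow> u = zero6 \<or>
     list_ex (e6_witness u False False) bits6 \<and> list_ex (e6_witness u False True) bits6 \<and>
     list_ex (e6_witness u True False) bits6 \<and> list_ex (e6_witness u True True) bits6"

lemma e6_check_hyperplane: "list_all e6_witnesses bits6"
  by code_simp

definition e6_fwd :: "bool list \<Rightarrow> bool list" where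
  "e6_fwd y = [y!1, y!0 \<noteq> y!2, (y!1 \<noteq> y!3) \<noteq> y!5, y!2 \<noteq> y!4, y!3, y!2]"

lemma e6_check_inv:
  "list_all (\<lambda>v. e6_fwd (e6_inv v) = v) bits6"
  by code_simp

lemma e6_check_root: "list_all (\<lambda>q. e6_arf (e6_root q) = q \<and> e6_root q \<noteq> zero6) [False, True]"
  by code_simp

lemma bits6_iff: "v \<in> set bits6 \<longleftrightarrow> length v = 6"
  by (auto simp: set_n_lists)

lemma list_all_bits6: "list_all P bits6 \<Longrightarrow> length v = 6 \<Longrightarrow> P v"
  by (metis bits6_iff list_all_iff)

lemma e6_root [simp]: "e6_arf (e6_root q) = q" "e6_root q \<noteq> zero6" "length (e6_root q) = 6"
proof -
  show "e6_arf (e6_root q) = q" "e6_root q \<noteq> zero6" using e6_check_root by (cases q; auto)+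
  show "length (e6_root q) = 6" by (simp add: e6_root_def)
qed

lemma e6_transitive:
  assumes "length v = 6" "v \<noteq> zero6"
  obtains w where "e6_run v w = e6_root (e6_arf v)" "\<forall>i\<in>set w. i < 6"
proof -
  have "v \<in> set bits6" using assms(1) by (simp only: bits6_iff)
  then obtain k where k: "k < length bits6" "v = bits6 ! k" by (metis in_set_conv_nth)
  then have "(v, e6_words ! k) \<in> set (zip bits6 e6_words)"
    using length_e6_words by (metis in_set_zip fst_conv snd_conv)
  then have "e6_word_ok (v, e6_words ! k)"
    using e6_check_words unfolding list_all_iff by blast
  then have "e6_run v (e6_words ! k) = e6_root (e6_arf v)" "\<forall>i\<in>set (e6_words ! k). i < 6"
    using assms(2) by (simp_all add: e6_word_ok_def list_all_iff)
  then show ?thesis by (rule that)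
qed

lemma zero6_nth: "i < 6 \<Longrightarrow> zero6 ! i = False"
proof -
  assume "i < 6"
  then consider "i = 0" | "i = 1" | "i = 2" | "i = 3" | "i = 4" | "i = 5" by linarith
  then show ?thesis by cases simp_all
qed

lemma less_6_mem: "i < 6 \<Longrightarrow> i \<in> set [0, 1, 2, 3, 4, 5 :: nat]"
  by auto

lemma e6_moves:
  assumes "length v = 6" "i < 6"
  shows "e6_arf (e6_move v i) \<longleftrightarrow> e6_arf v = v ! i"
    "e6_inv (e6_move v i) = (e6_inv v)[i := \<not> e6_inv v ! i]"
proof -
  have "list_all (e6_move_ok v) [0, 1, 2, 3, 4, 5]"
    using list_all_bits6[OF e6_check_moves assms(1)] by (simp only: e6_moves_ok_def)
  then have "e6_move_ok v i" using less_6_mem[OF assms(2)] by (simp only: list_all_iff)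
  then show "e6_arf (e6_move v i) \<longleftrightarrow> e6_arf v = v ! i"
    "e6_inv (e6_move v i) = (e6_inv v)[i := \<not> e6_inv v ! i]" by (simp_all only: e6_move_ok_def)
qed

lemma e6_inv_inject:
  assumes "length v = 6" "length w = 6" "e6_inv v = e6_inv w"
  shows "v = w"
  using list_all_bits6[OF e6_check_inv assms(1)] list_all_bits6[OF e6_check_inv assms(2)] assms(3)
  by metis

lemma length_e6_inv [simp]: "length (e6_inv v) = 6"
  by (simp add: e6_inv_def)

lemma e6_dot_update:
  assumes "length u = 6" "length y = 6" "i < 6"
  shows "e6_dot u (y[i := \<not> y ! i]) \<longleftrightarrow> e6_dot u y \<noteq> u ! i"
proof -
  obtain u0 u1 u2 u3 u4 u5 where u: "u = [u0, u1, u2, u3, u4, u5]"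
    using assms(1) by (auto simp: numeral_eq_Suc length_Suc_conv)
  obtain y0 y1 y2 y3 y4 y5 where y: "y = [y0, y1, y2, y3, y4, y5]"
    using assms(2) by (auto simp: numeral_eq_Suc length_Suc_conv)
  consider "i = 0" | "i = 1" | "i = 2" | "i = 3" | "i = 4" | "i = 5" using assms(3) by linarith
  then show ?thesis unfolding u y e6_dot_def xor_list_def by cases (simp_all add: numeral_eq_Suc; argo)+
qed

lemma e6_hyperplane:
  assumes "length u = 6" "u \<noteq> zero6"
  obtains v where "length v = 6" "v \<noteq> zero6" "v \<noteq> u" "e6_dot u (e6_inv v) = b" "e6_arf v = q"
proof -
  have "list_ex (e6_witness u b q) bits6"
    using list_all_bits6[OF e6_check_hyperplane assms(1)] assms(2)
    unfolding e6_witnesses_def by (cases b; cases q) (simp_all only: simp_thms)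
  then obtain v where "v \<in> set bits6" "e6_witness u b q v" by (auto simp only: list_ex_iff)
  then show ?thesis using that unfolding bits6_iff e6_witness_def by blast
qed

section \<open>Graphs grown from an E6 subgraph\<close>

text \<open>
  An induced copy of the diagram inside an arbitrary graph.
\<close>

locale e6_flip_game = flip_game adj for adj :: "'v \<Rightarrow> 'v \<Rightarrow> bool" +
  fixes h :: "nat \<Rightarrow> 'v"
  assumes inj_h: "inj_on h {..<6}"
    and adj_h: "i < 6 \<Longrightarrow> j < 6 \<Longrightarrow> adj (h i) (h j) \<longleftrightarrow> e6 i j"
begin

definition H :: "'v set" where "H = h ` {..<6}"

text \<open>
  The coordinates of a state on the copy, given its part off the copy.
\<close>

definition lits :: "'v set \<Rightarrow> bool list" where
  "lits c = map (\<lambda>i. lit c (h i)) [0, 1, 2, 3, 4, 5]"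

definition nbrs :: "'v \<Rightarrow> bool list" where
  "nbrs b = map (\<lambda>i. adj b (h i)) [0, 1, 2, 3, 4, 5]"

lemma h_in_H: "i < 6 \<Longrightarrow> h i \<in> H"
  by (simp add: H_def)

lemma finite_H: "finite H"
  by (simp add: H_def)

lemma length_lits [simp]: "length (lits c) = 6" "length (nbrs b) = 6"
  by (simp_all add: lits_def nbrs_def)

lemma map6_nth: "i < 6 \<Longrightarrow> map f [0, 1, 2, 3, 4, 5 :: nat] ! i = f i"
proof -
  assume "i < 6"
  then consider "i = 0" | "i = 1" | "i = 2" | "i = 3" | "i = 4" | "i = 5" by linarith
  then show ?thesis by cases simp_all
qed

lemma lits_nth: "i < 6 \<Longrightarrow> lits c ! i = lit c (h i)" "i < 6 \<Longrightarrow> nbrs b ! i = adj b (h i)"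
  by (simp_all only: lits_def nbrs_def map6_nth)

lemma lits_flip:
  assumes "finite c" "i < 6"
  shows "lits (flip (h i) c) = e6_move (lits c) i"
proof (rule nth_equalityI)
  fix j assume "j < length (lits (flip (h i) c))"
  then have j: "j < 6" by simp
  have len: "length (e6_row i) = 6" by (simp add: e6_row_def)
  have "e6_row i ! j = e6 i j" unfolding e6_row_def using j by (rule map6_nth)
  then have "e6_move (lits c) i ! j \<longleftrightarrow> lits c ! j \<noteq> e6 i j"
    using j len by (simp add: e6_move_def)
  moreover have "adj (h j) (h i) = e6 i j"
    using adj_h[OF assms(2) j] adj_commute by metis
  ultimately show "lits (flip (h i) c) ! j = e6_move (lits c) i ! j"
    using j assms(1) by (simp add: lits_nth lit_flip)
qed (simp add: e6_move_def e6_row_def)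

lemma active_lits: "active H c \<longleftrightarrow> lits c \<noteq> zero6"
proof -
  have "active H c \<longleftrightarrow> (\<exists>i<6. lits c ! i)"
    by (auto simp: active_def H_def lits_nth)
  also have "\<dots> \<longleftrightarrow> lits c \<noteq> zero6"
  proof
    assume "\<exists>i<6. lits c ! i"
    then show "lits c \<noteq> zero6" using zero6_nth by auto
  next
    assume "lits c \<noteq> zero6"
    then show "\<exists>i<6. lits c ! i"
      using nth_equalityI[of "lits c" zero6] zero6_nth by auto
  qed
  finally show ?thesis .
qed

text \<open>
  Both sides change in the same way under every flip inside the copy; likewise in the next two lemmas.
\<close>

lemma arf_agree:
  assumes "finite c" "finite c'" "c - H = c' - H"
  shows "(arf c = e6_arf (lits c)) = (arf c' = e6_arf (lits c'))"
  by (rule flip_invariant_agree[OF finite_H assms, where P = "\<lambda>c. arf c = e6_arf (lits c)"])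
    (auto simp: H_def lits_flip arf_flip e6_moves lits_nth)

lemma member_agree:
  assumes "finite c" "finite c'" "c - H = c' - H" "i < 6"
  shows "(h i \<in> c \<longleftrightarrow> e6_inv (lits c) ! i) = (h i \<in> c' \<longleftrightarrow> e6_inv (lits c') ! i)"
proof (rule flip_invariant_agree[OF finite_H assms(1-3), where P = "\<lambda>c. h i \<in> c \<longleftrightarrow> e6_inv (lits c) ! i"])
  fix d :: "'v set" and v assume d: "finite d" "v \<in> H"
  then obtain j where j: "v = h j" "j < 6" by (auto simp: H_def)
  have "h i = h j \<longleftrightarrow> i = j" using inj_h assms(4) j(2) by (auto simp: inj_on_def)
  then show "(h i \<in> flip v d \<longleftrightarrow> e6_inv (lits (flip v d)) ! i) = (h i \<in> d \<longleftrightarrow> e6_inv (lits d) ! i)"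
    using d j assms(4) by (auto simp: mem_flip lits_flip e6_moves nth_list_update)
qed

lemma lit_agree:
  assumes "finite c" "finite c'" "c - H = c' - H"
  shows "(lit c b = e6_dot (nbrs b) (e6_inv (lits c))) = (lit c' b = e6_dot (nbrs b) (e6_inv (lits c')))"
  by (rule flip_invariant_agree[OF finite_H assms, where P = "\<lambda>c. lit c b = e6_dot (nbrs b) (e6_inv (lits c))"])
    (auto simp: H_def lits_flip lit_flip e6_moves lits_nth e6_dot_update)

lemma lits_unique:
  assumes "finite c" "finite c'" "c - H = c' - H" "lits c = lits c'"
  shows "c = c'"
proof -
  have "x \<in> c \<longleftrightarrow> x \<in> c'" for x
  proof (cases "x \<in> H")
    case True
    then obtain i where "x = h i" "i < 6" by (auto simp: H_def)
    then show ?thesis using member_agree[OF assms(1-3), of i] assms(4) by auto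
  qed (use assms(3) in blast)
  then show ?thesis by blast
qed

text \<open>
  Invertibility of the adjacency matrix lets every lit vector be reached by changing the state on the copy.
\<close>

lemma lits_attained:
  assumes "finite c" "length v = 6"
  obtains c' where "finite c'" "c' - H = c - H" "lits c' = v"
proof -
  define c' where "c' = (c - H) \<union> h ` {i. i < 6 \<and> (h i \<in> c) \<noteq> (e6_inv (lits c) ! i \<noteq> e6_inv v ! i)}"
  have fin: "finite c'" using assms(1) by (simp add: c'_def)
  have off: "c' - H = c - H" by (auto simp: c'_def H_def)
  have "e6_inv (lits c') ! i = e6_inv v ! i" if i: "i < 6" for i
  proof -
    have "h i \<in> c' \<longleftrightarrow> (h i \<in> c) \<noteq> (e6_inv (lits c) ! i \<noteq> e6_inv v ! i)"
      using i inj_h h_in_H[OF i] by (auto simp: c'_def inj_on_def)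
    then show ?thesis using member_agree[OF fin assms(1) off i] by auto
  qed
  then have "e6_inv (lits c') = e6_inv v" by (intro nth_equalityI) auto
  then have "lits c' = v" using assms(2) e6_inv_inject[OF length_lits(1)] by blast
  then show ?thesis using that fin off by blast
qed

lemma e6_run_reach:
  assumes "finite c" "\<forall>i\<in>set w. i < 6" "e6_run (lits c) w \<noteq> []"
  obtains c' where "reach H c c'" "lits c' = e6_run (lits c) w"
proof -
  have "\<exists>c'. reach H c c' \<and> lits c' = e6_run (lits c) w"
    using assms
  proof (induction w arbitrary: c)
    case (Cons i w)
    then have i: "i < 6" "lits c ! i" by (auto split: if_splits)
    have "step H c (flip (h i) c)" using i h_in_H by (auto simp: step_def lits_nth)
    moreover have "\<exists>c'. reach H (flip (h i) c) c' \<and> lits c' = e6_run (lits (flip (h i) c)) w"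
      using Cons i by (intro Cons.IH) (auto simp: lits_flip)
    ultimately show ?case
      using i Cons.prems(1) by (auto simp: lits_flip intro: converse_rtranclp_into_rtranclp)
  qed auto
  then show ?thesis using that by blast
qed

text \<open>
  Each active state is moved along its certificate to the representative with its quadratic form; the
  lit vector then determines the state.
\<close>

lemma arf_transitive_H: "arf_transitive H"
  unfolding arf_transitive_def
proof (intro allI impI)
  fix c c' assume fin: "finite c" "finite c'" and off: "c - H = c' - H"
    and act: "active H c" "active H c'" and arf: "arf c = arf c'"
  define q where "q = e6_arf (lits c)"
  have q': "e6_arf (lits c') = q" using arf_agree[OF fin off] arf by (auto simp: q_def)
  obtain d where d: "finite d" "d - H = c - H" "lits d = e6_root q"
    using lits_attained[OF fin(1), of "e6_root q"] by auto
  have *: "reach H e d" if e: "finite e" "e - H = c - H" "e6_arf (lits e) = q" "active H e" for e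
  proof -
    obtain w where w: "e6_run (lits e) w = e6_root q" "\<forall>i\<in>set w. i < 6"
      using e6_transitive[of "lits e"] e by (auto simp: active_lits)
    moreover have "e6_root q \<noteq> []" by (simp add: e6_root_def)
    ultimately obtain e' where e': "reach H e e'" "lits e' = e6_root q"
      using e6_run_reach[OF e(1) w(2)] by metis
    have "e' - H = d - H" using reach_invariants(2)[OF e'(1) e(1)] d(2) e(2) by simp
    then have "e' = d"
      using lits_unique[OF reach_invariants(1)[OF e'(1) e(1)] d(1)] e'(2) d(3) by simp
    with e' show ?thesis by simp
  qed
  have "reach H c d" "reach H c' d" using * fin off act q' by (auto simp: q_def)
  then show "reach H c c'" using reach_sym[OF _ fin(2)] by (meson rtranclp_trans)
qed

lemma arf_attained:
  assumes "finite c" "H \<subseteq> F"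
  obtains c' where "finite c'" "c' - F = c - F" "active F c'" "arf c' = q"
proof -
  define p where "p \<longleftrightarrow> q = (arf c = e6_arf (lits c))"
  obtain d where d: "finite d" "d - H = c - H" "lits d = e6_root p"
    using lits_attained[OF assms(1), of "e6_root p"] by auto
  have "arf d = q" using arf_agree[OF d(1) assms(1) d(2)] d(3) by (auto simp: p_def)
  moreover have "active F d"
    using active_lits[of d] d(3) assms(2) by (auto simp: active_def)
  moreover have "d - F = c - F" using d(2) assms(2) by blast
  ultimately show ?thesis using that d(1) by blast
qed

text \<open>
  The state at which the two halves of the induction step meet: \<open>b\<close> can be flipped, and the game on
  \<open>B\<close> is active before and after. If \<open>b\<close> sees the copy of E6, a point of a hyperplane is chosen there.
  If it does not, \<open>b\<close> is first lit through its neighbour \<open>a\<close>; then the copy is free to fix the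
  quadratic form, because changes on it do not affect \<open>b\<close>.
\<close>

lemma bridge_state:
  assumes "finite c" "finite B" "H \<subseteq> B" "b \<notin> B" "a \<in> B" "adj b a"
  obtains d where "finite d" "d - B = c - B" "active B d" "active B (flip b d)" "lit d b" "arf d = q"
proof (cases "nbrs b = zero6")
  case True
  have nadj: "\<not> adj b v" if v: "v \<in> H" for v
  proof -
    obtain i where i: "v = h i" "i < 6" using v by (auto simp: H_def)
    show ?thesis using lits_nth(2)[OF i(2), of b] zero6_nth[OF i(2)] True i(1) by metis
  qed
  define c1 where "c1 = (if lit c b then c else flip a c)"
  have c1: "finite c1" "c1 - B = c - B" "lit c1 b"
    using assms by (auto simp: c1_def flip_Diff lit_flip)
  define p where "p \<longleftrightarrow> q = (arf c1 = e6_arf (lits c1))"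
  obtain d where d: "finite d" "d - H = c1 - H" "lits d = e6_root p"
    using lits_attained[OF c1(1), of "e6_root p"] by auto
  have "lit d b = lit c1 b"
    by (rule flip_invariant_agree[OF finite_H d(1) c1(1) d(2), where P = "\<lambda>c. lit c b"])
      (use nadj in \<open>auto simp: lit_flip\<close>)
  moreover have "arf d = q" using arf_agree[OF d(1) c1(1) d(2)] d(3) by (auto simp: p_def)
  moreover have act: "active H d" using active_lits[of d] d(3) by auto
  moreover have "active H (flip b d)"
    using act nadj d(1) by (auto simp: active_def lit_flip adj_commute[of _ b])
  moreover have "d - B = c - B" using d(2) c1(2) assms(3) by blast
  ultimately show ?thesis using that[of d] d(1) c1(3) assms(3) by (auto simp: active_def)
next
  case False
  define \<beta> where "\<beta> \<longleftrightarrow> (lit c b = e6_dot (nbrs b) (e6_inv (lits c)))"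
  define p where "p \<longleftrightarrow> q = (arf c = e6_arf (lits c))"
  obtain v where v: "length v = 6" "v \<noteq> zero6" "v \<noteq> nbrs b"
      "e6_dot (nbrs b) (e6_inv v) = \<beta>" "e6_arf v = p"
    using e6_hyperplane[OF _ False] length_lits by metis
  obtain d where d: "finite d" "d - H = c - H" "lits d = v"
    using lits_attained[OF assms(1) v(1)] by auto
  have "lit d b" using lit_agree[OF d(1) assms(1) d(2), of b] d(3) v(4) by (auto simp: \<beta>_def)
  moreover have "arf d = q" using arf_agree[OF d(1) assms(1) d(2)] d(3) v(5) by (auto simp: p_def)
  moreover have "active H d" using active_lits[of d] d(3) v(2) by auto
  moreover have "active H (flip b d)"
  proof -
    obtain i where i: "i < 6" "v ! i \<noteq> nbrs b ! i"
      using v(1,3) nth_equalityI[of v "nbrs b"] by auto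
    have "lit d (h i) \<noteq> adj b (h i)"
      using i(2) lits_nth(1)[OF i(1), of d] lits_nth(2)[OF i(1), of b] d(3) by simp
    then have "lit (flip b d) (h i)"
      using lit_flip[OF d(1), of b "h i"] adj_commute[of b "h i"] by blast
    then show ?thesis using h_in_H[OF i(1)] by (auto simp: active_def)
  qed
  moreover have "d - B = c - B" using d(2) assms(3) by blast
  ultimately show ?thesis using that[of d] d(1) assms(3) by (auto simp: active_def)
qed

text \<open>
  States for \<open>insert b B\<close> split according to membership of \<open>b\<close>. Inside each half the hypothesis on \<open>B\<close>
  applies, and one flip of \<open>b\<close> at a bridge state joins the halves. A state on which \<open>B\<close> is inactive
  becomes active by flipping \<open>b\<close>, which lights its neighbour \<open>a\<close>.
\<close>

lemma arf_transitive_insert: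
  assumes B: "finite B" "H \<subseteq> B" "arf_transitive B" and b: "b \<notin> B" "a \<in> B" "adj b a"
  shows "arf_transitive (insert b B)"
proof -
  let ?B = "insert b B"
  have activate: "\<exists>d. reach ?B c d \<and> active B d" if c: "finite c" "active ?B c" for c
  proof (cases "active B c")
    case False
    then have "lit c b" "\<not> lit c a" using c(2) b(2) by (auto simp: active_def)
    then have "step ?B c (flip b c)" "lit (flip b c) a"
      using c(1) b(3) by (auto simp: step_def lit_flip adj_commute)
    then show ?thesis using b(2) by (auto simp: active_def)
  qed blast
  have bridge: "reach ?B c c'"
    if c: "finite c" "finite c'" "c - ?B = c' - ?B" "active B c" "active B c'" "arf c = arf c'"
      "b \<notin> c" "b \<in> c'" for c c'
  proof -
    obtain d where d: "finite d" "d - B = c - B" "active B d" "active B (flip b d)" "lit d b" "arf d = arf c"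
      using bridge_state[OF c(1) B(1,2) b] by metis
    have "reach B c d" using B(3) c d unfolding arf_transitive_def by metis
    moreover have "step ?B d (flip b d)" using d(5) by (auto simp: step_def)
    moreover have "reach B (flip b d) c'"
    proof -
      have "flip b d - B = c' - B"
        using d(2) c(3,7,8) b(1) by (fastforce simp: mem_flip set_eq_iff)
      moreover have "arf (flip b d) = arf c'" using d(1,5,6) c(6) by (simp add: arf_flip)
      ultimately show ?thesis using B(3) c d unfolding arf_transitive_def by (metis finite_flip)
    qed
    ultimately show ?thesis
      using reach_mono[of B _ _ ?B] by (meson rtranclp.rtrancl_into_rtrancl rtranclp_trans subset_insertI)
  qed
  have main: "reach ?B c c'"
    if c: "finite c" "finite c'" "c - ?B = c' - ?B" "active B c" "active B c'" "arf c = arf c'" for c c'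
  proof (cases "b \<in> c \<longleftrightarrow> b \<in> c'")
    case True
    then have "c - B = c' - B" using c(3) by blast
    then have "reach B c c'" using B(3) c unfolding arf_transitive_def by blast
    then show ?thesis by (rule reach_mono) blast
  next
    case False
    then show ?thesis using bridge[of c c'] bridge[of c' c] c reach_sym by metis
  qed
  show ?thesis unfolding arf_transitive_def
  proof (intro allI impI)
    fix c c' assume c: "finite c" "finite c'" "c - ?B = c' - ?B" "active ?B c" "active ?B c'" "arf c = arf c'"
    obtain d where d: "reach ?B c d" "active B d" using activate c by blast
    obtain d' where d': "reach ?B c' d'" "active B d'" using activate c by blast
    have "reach ?B d d'"
      using reach_invariants[OF d(1) c(1)] reach_invariants[OF d'(1) c(2)] c d d' by (intro main) auto
    moreover have "reach ?B d' c'" using reach_sym[OF d'(1) c(2)] .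
    ultimately show "reach ?B c c'" using d(1) by (meson rtranclp_trans)
  qed
qed

lemma arf_transitive_connected:
  assumes F: "finite F" "H \<subseteq> F"
    and conn: "\<And>B. H \<subseteq> B \<Longrightarrow> B \<subset> F \<Longrightarrow> \<exists>b\<in>F - B. \<exists>a\<in>B. adj b a"
  shows "arf_transitive F"
proof -
  have "arf_transitive F" if "H \<subseteq> B" "B \<subseteq> F" "arf_transitive B" for B
    using that
  proof (induction "card (F - B)" arbitrary: B rule: less_induct)
    case less
    show ?case
    proof (cases "B = F")
      case False
      then obtain b a where ba: "b \<in> F - B" "a \<in> B" "adj b a" using conn[of B] less.prems by blast
      have "arf_transitive (insert b B)"
        using less.prems ba F(1) by (intro arf_transitive_insert) (auto intro: finite_subset)
      moreover have "card (F - insert b B) < card (F - B)"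
        using ba(1) F(1) by (intro psubset_card_mono) auto
      ultimately show ?thesis using less.hyps[of "insert b B"] less.prems ba(1) by auto
    qed (use less.prems in simp)
  qed
  then show ?thesis using arf_transitive_H F(2) by blast
qed

end

section \<open>The triangular grid\<close>

text \<open>
  The triangular lattice in the coordinates of the minors: \<open>(a, k)\<close> stands for the minor in the first \<open>k\<close>
  rows and the \<open>k\<close> columns starting with \<open>a\<close>. The six neighbours are the six minors occurring in the
  exchange relation of that minor.
\<close>

definition tri_adj :: "nat \<times> nat \<Rightarrow> nat \<times> nat \<Rightarrow> bool" where
  "tri_adj u v \<longleftrightarrow> (case u of (a, k) \<Rightarrow> case v of (a', k') \<Rightarrow>
     a = a' \<and> (k' = k + 1 \<or> k = k' + 1) \<or> k = k' \<and> (a' = a + 1 \<or> a = a' + 1) \<or>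
     a' = a + 1 \<and> k = k' + 1 \<or> a = a' + 1 \<and> k' = k + 1)"

text \<open>
  Minors starting at column 0 equal 1, as does the empty minor, so \<open>a\<close> and \<open>k\<close> start at 1. Positions with
  \<open>a + k = n + 1\<close> are the minors \<open>D\<^sub>k\<close>, which cannot vanish; the remaining ones form \<open>mutable n\<close>.
\<close>

definition tri :: "nat \<Rightarrow> (nat \<times> nat) set" where
  "tri n = {(a, k). 1 \<le> a \<and> 1 \<le> k \<and> a + k \<le> n + 1}"

definition mutable :: "nat \<Rightarrow> (nat \<times> nat) set" where
  "mutable n = {(a, k). 1 \<le> a \<and> 1 \<le> k \<and> a + k \<le> n}"

text \<open>
  A copy of E6 centred at \<open>(2, 2)\<close>. It fits into \<open>mutable n\<close> precisely when \<open>n\<close> is at least 5.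
\<close>

definition e6_vertex :: "nat \<Rightarrow> nat \<times> nat" where
  "e6_vertex i = [(1, 4), (2, 3), (2, 2), (3, 1), (4, 1), (1, 2)] ! i"

lemma e6_vertex_simps [simp]:
  "e6_vertex 0 = (1, 4)" "e6_vertex (Suc 0) = (2, 3)" "e6_vertex 2 = (2, 2)" "e6_vertex 3 = (3, 1)"
  "e6_vertex 4 = (4, 1)" "e6_vertex 5 = (1, 2)"
  by (simp_all add: e6_vertex_def)

definition e6_vertex_ok :: "nat \<Rightarrow> nat \<Rightarrow> bool" where
  "e6_vertex_ok i j \<longleftrightarrow> tri_adj (e6_vertex i) (e6_vertex j) = e6 i j"

definition e6_vertices_ok :: "nat \<Rightarrow> bool" where
  "e6_vertices_ok i \<longleftrightarrow> list_all (e6_vertex_ok i) [0, 1, 2, 3, 4, 5]"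

lemma e6_check_vertices: "list_all e6_vertices_ok [0, 1, 2, 3, 4, 5]"
  by code_simp

interpretation tri: e6_flip_game tri_adj e6_vertex
proof
  show "tri_adj u v \<Longrightarrow> tri_adj v u" "\<not> tri_adj v v" for u v
    by (auto simp: tri_adj_def split: prod.splits)
  have cases6: "i = 0 \<or> i = 1 \<or> i = 2 \<or> i = 3 \<or> i = 4 \<or> i = 5" if "i < 6" for i :: nat
    using that by linarith
  show "inj_on e6_vertex {..<6}"
  proof (rule inj_onI)
    fix i j assume "i \<in> {..<6}" "j \<in> {..<6}" and eq: "e6_vertex i = e6_vertex j"
    then have "i < 6" "j < 6" by simp_all
    with eq show "i = j" using cases6[OF \<open>i < 6\<close>] cases6[OF \<open>j < 6\<close>] by auto
  qed
  show "tri_adj (e6_vertex i) (e6_vertex j) \<longleftrightarrow> e6 i j" if "i < 6" "j < 6" for i j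
  proof -
    have "e6_vertices_ok i"
      using e6_check_vertices less_6_mem[OF \<open>i < 6\<close>] by (simp only: list_all_iff)
    then have "e6_vertex_ok i j"
      using less_6_mem[OF \<open>j < 6\<close>] unfolding e6_vertices_ok_def by (simp only: list_all_iff)
    then show ?thesis by (simp only: e6_vertex_ok_def)
  qed
qed

lemma finite_tri [simp]: "finite (tri n)"
  by (rule finite_subset[of _ "{..n} \<times> {..n}"]) (auto simp: tri_def)

lemma mutable_subset_tri: "mutable n \<subseteq> tri n"
  by (auto simp: mutable_def tri_def)

lemma finite_mutable [simp]: "finite (mutable n)"
  by (rule finite_subset[OF mutable_subset_tri finite_tri])

text \<open>
  The grid is connected, so every proper subset containing the copy of E6 has an outside neighbour.
\<close>

lemma mutable_transitive:
  assumes "n \<ge> 5"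
  shows "tri.H \<subseteq> mutable n" "tri.arf_transitive (mutable n)"
proof -
  have "tri.H = {(1, 4), (2, 3), (2, 2), (3, 1), (4, 1), (1, 2)}"
  proof -
    have "{..<6} = {0, 1, 2, 3, 4, 5 :: nat}" by auto
    then show ?thesis by (simp add: tri.H_def)
  qed
  then have H: "(2, 2) \<in> tri.H" "tri.H \<subseteq> mutable n" using assms by (auto simp: mutable_def)
  show "tri.H \<subseteq> mutable n" by fact
  show "tri.arf_transitive (mutable n)"
  proof (rule tri.arf_transitive_connected)
    fix B assume B: "tri.H \<subseteq> B" "B \<subset> mutable n"
    show "\<exists>b\<in>mutable n - B. \<exists>a\<in>B. tri_adj b a"
    proof (rule ccontr)
      assume "\<not> ?thesis"
      then have *: "u \<in> B \<longleftrightarrow> v \<in> B" if "tri_adj u v" "u \<in> mutable n" "v \<in> mutable n" for u v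
        using that tri.adj_sym by blast
      have conn: "(a, k) \<in> B \<longleftrightarrow> (1, 1) \<in> B" if "(a, k) \<in> mutable n" for a k
        using that
      proof (induction "a + k" arbitrary: a k rule: less_induct)
        case less
        consider "a = 1" "k = 1" | "a > 1" | "a = 1" "k > 1"
          using less.prems by (force simp: mutable_def)
        then show ?case
        proof cases
          case 2
          then have "(a - 1, k) \<in> mutable n" "tri_adj (a, k) (a - 1, k)"
            using less.prems by (auto simp: mutable_def tri_adj_def)
          then show ?thesis using less.hyps[of "a - 1" k] * less.prems 2 by auto
        next
          case 3
          then have "(a, k - 1) \<in> mutable n" "tri_adj (a, k) (a, k - 1)"
            using less.prems by (auto simp: mutable_def tri_adj_def)
          then show ?thesis using less.hyps[of a "k - 1"] * less.prems 3 by auto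
        qed simp
      qed
      have "(2, 2) \<in> B" using H B by blast
      then have "mutable n \<subseteq> B" using conn H B by (metis subrelI subsetD)
      then show False using B(2) by blast
    qed
  qed (use H in auto)
qed

lemma of_bool_odd_card_insert:
  assumes "x \<notin> S" "finite S"
  shows "(of_bool (odd (card (c \<inter> insert x S))) :: bit) = of_bool (x \<in> c) + of_bool (odd (card (c \<inter> S)))"
proof -
  have "c \<inter> insert x S = (if x \<in> c then insert x (c \<inter> S) else c \<inter> S)" by auto
  then show ?thesis using assms by auto
qed

lemma tri_lit:
  "(of_bool (tri.lit c (Suc a, Suc k)) :: bit) =
     of_bool ((Suc a, Suc (Suc k)) \<in> c) + of_bool ((Suc a, k) \<in> c) + of_bool ((a, Suc k) \<in> c)
     + of_bool ((Suc (Suc a), Suc k) \<in> c) + of_bool ((Suc (Suc a), k) \<in> c)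
     + of_bool ((a, Suc (Suc k)) \<in> c)"
proof -
  have "{u \<in> c. tri_adj (Suc a, Suc k) u} = c \<inter> {(Suc a, Suc (Suc k)), (Suc a, k), (a, Suc k),
      (Suc (Suc a), Suc k), (Suc (Suc a), k), (a, Suc (Suc k))}"
    by (auto simp: tri_adj_def)
  then show ?thesis
    unfolding tri.lit_def
    by (simp add: of_bool_odd_card_insert del: Int_insert_right Int_insert_right_if0 Int_insert_right_if1)
      argo?
qed

definition cls :: "nat \<Rightarrow> (nat \<times> nat) set \<Rightarrow> (nat \<times> nat) set set" where
  "cls n c = {c'. tri.reach (mutable n) c c'}"

lemma cls_eq_iff:
  assumes "finite c"
  shows "cls n c = cls n c' \<longleftrightarrow> tri.reach (mutable n) c c'"
proof
  assume "cls n c = cls n c'"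
  then show "tri.reach (mutable n) c c'" by (auto simp: cls_def)
next
  assume r: "tri.reach (mutable n) c c'"
  then have "tri.reach (mutable n) c' c" using tri.reach_sym assms by blast
  with r show "cls n c = cls n c'" by (auto simp: cls_def intro: rtranclp_trans)
qed

lemma cls_self: "c \<in> cls n c"
  by (simp add: cls_def)

lemma cls_subset_states: "c \<subseteq> tri n \<Longrightarrow> cls n c \<subseteq> Pow (tri n)"
  using tri.reach_invariants(2)[of "mutable n" c] finite_subset[OF _ finite_tri, of c n] mutable_subset_tri[of n]
  unfolding cls_def by blast

section \<open>The first action as a flip game\<close>

text \<open>
  Entry \<open>(i, i + d)\<close> is the sign of the parameter
  \<open>minor d (i + 1) * minor (d + 2) i / (minor (d + 1) i * minor (d + 1) (i + 1))\<close> in the factorization of a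
  unipotent matrix into bidiagonal ones. Every vertex enters at most four entries, and these form the
  \<open>2 \<times> 2\<close> square on which a generator of the group acts.
\<close>

definition tmat :: "nat \<Rightarrow> (nat \<times> nat) set \<Rightarrow> bit mat" where
  "tmat n c = mat n n (\<lambda>(i, j). if i \<le> j then
     of_bool ((j - i, Suc i) \<in> c) + of_bool ((Suc (Suc (j - i)), i) \<in> c)
     + of_bool ((Suc (j - i), i) \<in> c) + of_bool ((Suc (j - i), Suc i) \<in> c) else 0)"

lemma tmat_dim [simp]: "dim_row (tmat n c) = n" "dim_col (tmat n c) = n"
  by (simp_all add: tmat_def)

lemma tmat_in_T [simp]: "tmat n c \<in> T_mats n"
  by (auto simp: tmat_def T_mats_def)

lemma tmat_index:
  assumes "i + d < n"
  shows "tmat n c $$ (i, i + d) = of_bool ((d, Suc i) \<in> c) + of_bool ((Suc (Suc d), i) \<in> c)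
     + of_bool ((Suc d, i) \<in> c) + of_bool ((Suc d, Suc i) \<in> c)"
  using assms by (simp add: tmat_def)

lemma bit_add_cancel: "x + (x + y) = y" "x + x = 0" for x y :: bit
  by (cases x; cases y; simp)+

text \<open>
  The vertex \<open>(d + 1, i + 1)\<close> occurs in both entries and cancels; its six neighbours remain.
\<close>

lemma tmat_diagonal_sum:
  assumes "i + d + 1 < n"
  shows "tmat n c $$ (i, i + d) + tmat n c $$ (i + 1, i + d + 1) = of_bool (tri.lit c (Suc d, Suc i))"
proof -
  have eq: "tmat n c $$ (i + 1, i + d + 1) = tmat n c $$ (Suc i, Suc i + d)" by simp
  have rearrange: "(x1 + x2 + x3 + v) + (y1 + y2 + v + y3) = y3 + x3 + x1 + y2 + x2 + y1"
    for x1 x2 x3 y1 y2 y3 v :: bit by (simp only: ac_simps bit_add_cancel)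
  have "i + d < n" "Suc i + d < n" using assms by simp_all
  then show ?thesis unfolding eq by (simp only: tmat_index tri_lit rearrange)
qed

lemma tmat_flip:
  assumes "i + d + 1 < n" "a + e < n"
  shows "tmat n (tri.flip (Suc d, Suc i) c) $$ (a, a + e) = tmat n c $$ (a, a + e) +
    (if (a, a + e) \<in> {(i, i + d), (i, i + d + 1), (i + 1, i + d), (i + 1, i + d + 1)} then 1 else 0)"
proof -
  have flip: "(of_bool (u \<in> tri.flip v c) :: bit) = of_bool (u \<in> c) + of_bool (u = v)" for u v
    by (auto simp: tri.mem_flip)
  have rearrange: "(x1 + y1) + (x2 + y2) + (x3 + y3) + (x4 + y4) = (x1 + x2 + x3 + x4) + (y1 + y2 + y3 + y4)"
    for x1 x2 x3 x4 y1 y2 y3 y4 :: bit by (simp only: ac_simps)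
  have "of_bool ((e, Suc a) = (Suc d, Suc i)) + of_bool ((Suc (Suc e), a) = (Suc d, Suc i))
      + of_bool ((Suc e, a) = (Suc d, Suc i)) + of_bool ((Suc e, Suc a) = (Suc d, Suc i)) =
    (if (a, a + e) \<in> {(i, i + d), (i, i + d + 1), (i + 1, i + d), (i + 1, i + d + 1)} then 1 else 0 :: bit)"
    by (cases "a = i"; cases "a = Suc i"; cases "e = d"; cases "e = Suc d"; cases "Suc e = d") simp_all
  then show ?thesis
    unfolding tmat_index[OF assms(2)] flip rearrange by simp
qed

lemma g_map_tmat:
  assumes "i + d + 1 < n"
  shows "g_map n i (i + d) (tmat n c) =
    tmat n (if tri.lit c (Suc d, Suc i) then tri.flip (Suc d, Suc i) c else c)" (is "?L = tmat n ?c")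
proof (rule eq_matI)
  fix a b assume "a < dim_row (tmat n ?c)" "b < dim_col (tmat n ?c)"
  then have ab: "a < n" "b < n" by simp_all
  show "?L $$ (a, b) = tmat n ?c $$ (a, b)"
  proof (cases "a \<le> b")
    case True
    then obtain e where b: "b = a + e" using le_Suc_ex by blast
    show ?thesis
      unfolding g_map_index[OF tmat_in_T ab] tmat_diagonal_sum[OF assms]
      using True tmat_flip[OF assms, of a e c] ab unfolding b by simp
  next
    case False
    then show ?thesis
      unfolding g_map_index[OF tmat_in_T ab] using ab by (auto simp: tmat_def)
  qed
qed (simp_all add: g_map_dim)

text \<open>
  The entry in row \<open>k\<close> determines vertex \<open>(a + 1, k + 1)\<close> from vertices with a smaller second coordinate or with
  the same second and a smaller first coordinate.
\<close>

lemma tmat_inj: "inj_on (tmat n) (Pow (tri n))"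
proof (rule inj_onI)
  fix c c' assume c: "c \<in> Pow (tri n)" "c' \<in> Pow (tri n)" and eq: "tmat n c = tmat n c'"
  have zero: "(a, 0) \<notin> c" "(0, a) \<notin> c" "(a, 0) \<notin> c'" "(0, a) \<notin> c'" for a
    using c by (auto simp: tri_def)
  have "(a, k) \<in> c \<longleftrightarrow> (a, k) \<in> c'" if "a + k \<le> n + 1" for a k
    using that
  proof (induction k arbitrary: a)
    case (Suc k)
    note inner = Suc.IH
    show ?case using Suc.prems
    proof (induction a)
      case (Suc a)
      have ak: "k + a < n" using Suc.prems by simp
      have "tmat n c $$ (k, k + a) = tmat n c' $$ (k, k + a)" by (simp only: eq)
      moreover have "(a, Suc k) \<in> c \<longleftrightarrow> (a, Suc k) \<in> c'" using Suc by simp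
      moreover have "(Suc a, k) \<in> c \<longleftrightarrow> (Suc a, k) \<in> c'" "(Suc (Suc a), k) \<in> c \<longleftrightarrow> (Suc (Suc a), k) \<in> c'"
        using inner Suc.prems by simp_all
      ultimately have "(of_bool ((Suc a, Suc k) \<in> c) :: bit) = of_bool ((Suc a, Suc k) \<in> c')"
        unfolding tmat_index[OF ak] by (simp only: add_left_cancel)
      then show ?case by (simp only: of_bool_eq_iff)
    qed (use zero in simp)
  qed (use zero in simp)
  then show "c = c'" using c by (fastforce simp: tri_def)
qed

text \<open>
  Reading entries as vertices gives an injection in the opposite direction, so the two finite sets have
  the same cardinality.
\<close>

lemma tmat_image: "tmat n ` Pow (tri n) = T_mats n"
proof -
  define \<rho> where "\<rho> M = {(a, k) \<in> tri n. M $$ (k - 1, a + k - 2) = (1 :: bit)}" for M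
  have inj: "inj_on \<rho> (T_mats n)"
  proof (rule inj_onI)
    fix M M' assume M: "M \<in> T_mats n" "M' \<in> T_mats n" "\<rho> M = \<rho> M'"
    show "M = M'"
    proof (rule eq_matI)
      fix i j assume "i < dim_row M'" "j < dim_col M'"
      then have ij: "i < n" "j < n" using M(2) by (simp_all add: T_mats_dim)
      show "M $$ (i, j) = M' $$ (i, j)"
      proof (cases "i \<le> j")
        case True
        then have "(Suc (j - i), Suc i) \<in> tri n" using ij by (auto simp: tri_def)
        moreover have "Suc (j - i) + Suc i - 2 = j" using True by simp
        moreover have "(Suc (j - i), Suc i) \<in> \<rho> M \<longleftrightarrow> (Suc (j - i), Suc i) \<in> \<rho> M'"
          by (simp only: M(3))
        ultimately have "M $$ (i, j) = 1 \<longleftrightarrow> M' $$ (i, j) = 1"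
          unfolding \<rho>_def by (simp add: True)
        then show ?thesis by (metis bit.exhaust)
      qed (use M ij in \<open>auto simp: T_mats_def upper_triangular_def\<close>)
    qed (use M in \<open>simp_all add: T_mats_dim\<close>)
  qed
  have sub: "\<rho> ` T_mats n \<subseteq> Pow (tri n)" by (auto simp: \<rho>_def)
  have fin: "finite (T_mats n)" using inj sub by (meson finite_Pow_iff finite_imageD finite_subset finite_tri)
  have "card (T_mats n) \<le> card (Pow (tri n))" using inj sub by (meson card_inj_on_le finite_Pow_iff finite_tri)
  also have "\<dots> = card (tmat n ` Pow (tri n))" by (rule card_image[OF tmat_inj, symmetric])
  finally show ?thesis using fin by (intro card_seteq) auto
qed

lemma orbit_tmat:
  assumes c: "c \<subseteq> tri n"
  shows "orbit (G_group n) (\<lambda>g. g) (tmat n c) = tmat n ` cls n c"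
proof -
  let ?S = "{g_map n i j | i j. i \<le> j \<and> j + 1 < n}"
  interpret GL: group "GL_T n" by (rule group_GL_T)
  have mult: "monoid.mult (GL_T n) = monoid.mult (BijGroup (T_mats n))" by (simp add: GL_T_def)
  have unit: "\<one>\<^bsub>GL_T n\<^esub> = (\<lambda>M\<in>T_mats n. M)" by (simp add: GL_T_def BijGroup_def)
  have comp: "(f \<otimes>\<^bsub>GL_T n\<^esub> g) M = f (g M)"
    if "f \<in> carrier (GL_T n)" "g \<in> carrier (GL_T n)" "M \<in> T_mats n" for f g M
    using that unfolding mult by (auto simp: GL_T_def BijGroup_def compose_eq)
  have gen: "carrier (GL_T n) \<inter> ?S = ?S" using g_map_in_GL by blast
  have carrier: "carrier (G_group n) = generate (GL_T n) ?S"
    by (simp only: G_group_def carrier_subgroup_generated gen)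
  have gen_sub: "generate (GL_T n) ?S \<subseteq> carrier (GL_T n)"
    using gen by (intro GL.generate_incl) blast
  have step: "g (tmat n d) \<in> tmat n ` cls n d" if g: "g \<in> ?S" for g d
  proof -
    obtain i j where ij: "g = g_map n i j" "i \<le> j" "j + 1 < n" using g by blast
    then obtain e where e: "j = i + e" using le_Suc_ex by blast
    have "(Suc e, Suc i) \<in> mutable n" using ij e by (auto simp: mutable_def)
    then have "(if tri.lit d (Suc e, Suc i) then tri.flip (Suc e, Suc i) d else d) \<in> cls n d"
      unfolding cls_def tri.step_def by (auto intro!: r_into_rtranclp)
    then show ?thesis using ij e g_map_tmat[of i e n d] by auto
  qed
  have "g (tmat n d) \<in> tmat n ` cls n d" if "g \<in> generate (GL_T n) ?S" for g d
    using that
  proof (induction g arbitrary: d rule: generate.induct)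
    case one
    have "\<one>\<^bsub>GL_T n\<^esub> (tmat n d) = tmat n d" by (simp add: unit)
    then show ?case using cls_self by (metis imageI)
  next
    case (incl h)
    then show ?case by (rule step)
  next
    case (inv h)
    then obtain i j where ij: "h = g_map n i j" "i \<le> j" "j + 1 < n" by blast
    then have h: "h \<in> carrier (GL_T n)" using g_map_in_GL by blast
    have "h \<otimes>\<^bsub>GL_T n\<^esub> h = \<one>\<^bsub>GL_T n\<^esub>"
    proof
      fix M show "(h \<otimes>\<^bsub>GL_T n\<^esub> h) M = \<one>\<^bsub>GL_T n\<^esub> M"
      proof (cases "M \<in> T_mats n")
        case True
        then show ?thesis using comp[OF h h] ij g_map_involution by (simp add: unit)
      next
        case False
        then show ?thesis using h unfolding mult unit by (auto simp: GL_T_def BijGroup_def compose_def)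
      qed
    qed
    then have "inv\<^bsub>GL_T n\<^esub> h = h" using h by (intro GL.inv_equality)
    then show ?case using step[OF inv] by simp
  next
    case (eng h1 h2)
    have "h1 \<in> carrier (GL_T n)" "h2 \<in> carrier (GL_T n)" using eng gen_sub by auto
    then have "(h1 \<otimes>\<^bsub>GL_T n\<^esub> h2) (tmat n d) = h1 (h2 (tmat n d))" by (simp add: comp)
    moreover obtain d' where d': "h2 (tmat n d) = tmat n d'" "d' \<in> cls n d" using eng.IH(2)[of d] by blast
    moreover obtain d'' where "h1 (tmat n d') = tmat n d''" "d'' \<in> cls n d'" using eng.IH(1)[of d'] by blast
    ultimately show ?case by (auto simp: cls_def intro!: imageI intro: rtranclp_trans)
  qed
  then have sub: "orbit (G_group n) (\<lambda>g. g) (tmat n c) \<subseteq> tmat n ` cls n c"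
    by (auto simp: orbit_def carrier)
  have "\<exists>g\<in>generate (GL_T n) ?S. g (tmat n c) = tmat n c'" if "tri.reach (mutable n) c c'" for c'
    using that
  proof (induction rule: rtranclp_induct)
    case base
    have "\<one>\<^bsub>GL_T n\<^esub> (tmat n c) = tmat n c" by (simp add: unit)
    then show ?case using generate.one by blast
  next
    case (step y z)
    obtain g where g: "g \<in> generate (GL_T n) ?S" "g (tmat n c) = tmat n y" using step.IH by blast
    obtain v where v: "v \<in> mutable n" "tri.lit y v" "z = tri.flip v y" using step.hyps(2) by (auto simp: tri.step_def)
    obtain e i where ei: "v = (Suc e, Suc i)" "i + e + 1 < n"
      using v(1) by (cases v; cases "fst v"; cases "snd v") (auto simp: mutable_def)
    have "i \<le> i + e \<and> (i + e) + 1 < n" using ei(2) by simp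
    then have h: "g_map n i (i + e) \<in> ?S" by blast
    have "g_map n i (i + e) (tmat n y) = tmat n z" using g_map_tmat[OF ei(2)] v ei(1) by simp
    then have "(g_map n i (i + e) \<otimes>\<^bsub>GL_T n\<^esub> g) (tmat n c) = tmat n z"
    proof -
      have "g_map n i (i + e) \<in> carrier (GL_T n)" using g_map_in_GL ei(2) by simp
      moreover have "g \<in> carrier (GL_T n)" using g(1) gen_sub by blast
      ultimately show ?thesis
        using comp[of "g_map n i (i + e)" g "tmat n c"] g(2)
          \<open>g_map n i (i + e) (tmat n y) = tmat n z\<close> by simp
    qed
    moreover have "g_map n i (i + e) \<otimes>\<^bsub>GL_T n\<^esub> g \<in> generate (GL_T n) ?S"
      using g(1) generate.incl[OF h] by (intro generate.eng)
    ultimately show ?case by blast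
  qed
  note reached = this
  have "tmat n ` cls n c \<subseteq> orbit (G_group n) (\<lambda>g. g) (tmat n c)"
  proof
    fix M assume "M \<in> tmat n ` cls n c"
    then obtain c' where "tri.reach (mutable n) c c'" "M = tmat n c'" by (auto simp: cls_def)
    then have "\<exists>g\<in>generate (GL_T n) ?S. g (tmat n c) = M" using reached[of c'] by simp
    then obtain g where "g \<in> generate (GL_T n) ?S" "M = g (tmat n c)" by (elim bexE) simp
    then show "M \<in> orbit (G_group n) (\<lambda>g. g) (tmat n c)"
      unfolding orbit_def carrier by (intro CollectI exI[of _ g] conjI)
  qed
  with sub show ?thesis by blast
qed

lemma card_orbits_eq_card_cls:
  "card (orbits (G_group n) (T_mats n) (\<lambda>g. g)) = card (cls n ` Pow (tri n))"
proof -
  have "orbits (G_group n) (T_mats n) (\<lambda>g. g) = orbit (G_group n) (\<lambda>g. g) ` tmat n ` Pow (tri n)"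
    unfolding tmat_image orbits_def by (simp add: Setcompr_eq_image)
  also have "\<dots> = (\<lambda>C. tmat n ` C) ` cls n ` Pow (tri n)"
    unfolding image_image by (intro image_cong refl orbit_tmat) auto
  finally have "card (orbits (G_group n) (T_mats n) (\<lambda>g. g)) = card ((\<lambda>C. tmat n ` C) ` cls n ` Pow (tri n))"
    by simp
  also have "\<dots> = card (cls n ` Pow (tri n))"
  proof (rule card_image, rule inj_onI)
    fix C C' assume "C \<in> cls n ` Pow (tri n)" "C' \<in> cls n ` Pow (tri n)" "tmat n ` C = tmat n ` C'"
    then show "C = C'"
      using inj_on_image_eq_iff[OF tmat_inj[of n], of C C'] cls_subset_states by blast
  qed
  finally show ?thesis .
qed

section \<open>Counting the classes\<close>

text \<open>
  Under \<open>tmat\<close> the inactive states become the matrices that are constant along diagonals, and these are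
  given by their first row.
\<close>

lemma card_inactive_states:
  "card {c \<in> Pow (tri n). \<not> tri.active (mutable n) c} = 2 ^ n"
proof -
  let ?Fix = "{c \<in> Pow (tri n). \<not> tri.active (mutable n) c}"
  define \<phi> where "\<phi> M = {d. d < n \<and> M $$ (0, d) = (1 :: bit)}" for M
  define K where "K = {M \<in> T_mats n. \<forall>i d. i + d + 1 < n \<longrightarrow> M $$ (i, i + d) = M $$ (i + 1, i + d + 1)}"
  have active: "tri.active (mutable n) c \<longleftrightarrow>
      (\<exists>i d. i + d + 1 < n \<and> tmat n c $$ (i, i + d) \<noteq> tmat n c $$ (i + 1, i + d + 1))" for c
  proof -
    have ne: "x \<noteq> y \<longleftrightarrow> x + y = 1" for x y :: bit by (cases x; cases y; simp)
    have "tri.active (mutable n) c \<longleftrightarrow> (\<exists>i d. i + d + 1 < n \<and> tri.lit c (Suc d, Suc i))"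
    proof
      assume "tri.active (mutable n) c"
      then obtain a k where "(a, k) \<in> mutable n" "tri.lit c (a, k)" by (auto simp: tri.active_def)
      then show "\<exists>i d. i + d + 1 < n \<and> tri.lit c (Suc d, Suc i)"
        by (intro exI[of _ "k - 1"] exI[of _ "a - 1"]) (auto simp: mutable_def)
    next
      assume "\<exists>i d. i + d + 1 < n \<and> tri.lit c (Suc d, Suc i)"
      then obtain i d where id: "i + d + 1 < n" "tri.lit c (Suc d, Suc i)" by blast
      then have "(Suc d, Suc i) \<in> mutable n" by (simp add: mutable_def)
      with id(2) show "tri.active (mutable n) c" unfolding tri.active_def by blast
    qed
    moreover have "tri.lit c (Suc d, Suc i) \<longleftrightarrow> tmat n c $$ (i, i + d) \<noteq> tmat n c $$ (i + 1, i + d + 1)"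
      if "i + d + 1 < n" for i d
      unfolding ne tmat_diagonal_sum[OF that] by (simp only: of_bool_eq_1_iff)
    ultimately show ?thesis by blast
  qed
  have "tmat n ` ?Fix = K"
  proof -
    have "tmat n c \<in> K \<longleftrightarrow> \<not> tri.active (mutable n) c" for c
      unfolding active K_def by auto
    moreover have "K \<subseteq> tmat n ` Pow (tri n)" unfolding tmat_image by (auto simp: K_def)
    ultimately show ?thesis by blast
  qed
  moreover have "card (tmat n ` ?Fix) = card ?Fix"
    by (rule card_image[OF inj_on_subset[OF tmat_inj[of n]]]) blast
  ultimately have "card ?Fix = card K" by (simp only:)
  also have "\<dots> = card (Pow {..<n})"
  proof (rule bij_betw_same_card[of \<phi>], unfold bij_betw_def, intro conjI)
    show "inj_on \<phi> K"
    proof (rule inj_onI)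
      fix M M' assume M: "M \<in> K" "M' \<in> K" "\<phi> M = \<phi> M'"
      have MT: "M \<in> T_mats n" "M' \<in> T_mats n" using M by (simp_all add: K_def)
      have row: "N $$ (i, i + d) = N $$ (0, d)" if "N \<in> K" "i + d < n" for N i d
        using that(2)
      proof (induction i)
        case (Suc i)
        then have "N $$ (i, i + d) = N $$ (i + 1, i + d + 1)" using that(1) by (simp add: K_def)
        with Suc show ?case by simp
      qed simp
      have first: "M $$ (0, d) = M' $$ (0, d)" if "d < n" for d
      proof -
        have "M $$ (0, d) = 1 \<longleftrightarrow> M' $$ (0, d) = 1" using M(3) that by (auto simp: \<phi>_def set_eq_iff)
        then show ?thesis by (metis bit.exhaust)
      qed
      show "M = M'"
      proof (rule eq_matI)
        fix i j assume "i < dim_row M'" "j < dim_col M'"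
        moreover have "M' \<in> T_mats n" using M(2) by (simp add: K_def)
        ultimately have ij: "i < n" "j < n" by (simp_all add: T_mats_dim)
        show "M $$ (i, j) = M' $$ (i, j)"
        proof (cases "i \<le> j")
          case True
          then obtain d where "j = i + d" using le_Suc_ex by blast
          then show ?thesis using row[OF M(1), of i d] row[OF M(2), of i d] first[of d] ij by simp
        qed (use M ij in \<open>auto simp: K_def T_mats_def upper_triangular_def\<close>)
      qed (use MT in \<open>simp_all add: T_mats_dim\<close>)
    qed
    show "\<phi> ` K = Pow {..<n}"
    proof (rule antisym)
      show "Pow {..<n} \<subseteq> \<phi> ` K"
      proof
        fix D assume D: "D \<in> Pow {..<n}"
        define M where "M = mat n n (\<lambda>(i, j). if i \<le> j then of_bool (j - i \<in> D) else (0 :: bit))"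
        have "M \<in> K" by (auto simp: K_def M_def T_mats_def)
        moreover have "\<phi> M = D" using D by (auto simp: \<phi>_def M_def)
        ultimately show "D \<in> \<phi> ` K" by blast
      qed
    qed (auto simp: \<phi>_def)
  qed
  finally show ?thesis by (simp add: card_Pow)
qed

lemma card_image_eqI:
  assumes "\<And>x y. x \<in> A \<Longrightarrow> y \<in> A \<Longrightarrow> f x = f y \<longleftrightarrow> g x = g y"
  shows "card (f ` A) = card (g ` A)"
proof (rule bij_betw_same_card)
  show "bij_betw (\<lambda>z. g (SOME x. x \<in> A \<and> f x = z)) (f ` A) (g ` A)"
  proof -
    have *: "g (SOME x. x \<in> A \<and> f x = f y) = g y" if "y \<in> A" for y
    proof -
      have "(SOME x. x \<in> A \<and> f x = f y) \<in> A \<and> f (SOME x. x \<in> A \<and> f x = f y) = f y"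
        by (rule someI[of _ y]) (use that in simp)
      then show ?thesis using assms that by blast
    qed
    show ?thesis unfolding bij_betw_def
      using assms * by (auto simp: inj_on_def image_image)
  qed
qed

text \<open>
  Inactive states form singleton classes. The other classes are labelled by the signs at the \<open>n\<close> positions
  outside \<open>mutable n\<close> and by the quadratic form, and all \<open>2 ^ n * 2\<close> labels occur.
\<close>

theorem card_cls:
  assumes "n \<ge> 5"
  shows "card (cls n ` Pow (tri n)) = 3 * 2 ^ n"
proof -
  define I where "I = {c \<in> Pow (tri n). \<not> tri.active (mutable n) c}"
  define A where "A = {c \<in> Pow (tri n). tri.active (mutable n) c}"
  have fin: "finite c" if "c \<in> I \<union> A" for c
    using that finite_subset[OF _ finite_tri] by (auto simp: I_def A_def)
  have "card (cls n ` I) = card I"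
  proof (rule card_image, rule inj_onI)
    fix c c' assume "c \<in> I" "c' \<in> I" "cls n c = cls n c'"
    then show "c = c'"
      using tri.reach_invariants(4)[of "mutable n" c c'] fin cls_eq_iff by (auto simp: I_def)
  qed
  then have I: "card (cls n ` I) = 2 ^ n" using card_inactive_states[of n] by (simp add: I_def)
  define key where "key c = (c - mutable n, tri.arf c)" for c
  have "card (cls n ` A) = card (key ` A)"
  proof (rule card_image_eqI)
    fix c c' assume c: "c \<in> A" "c' \<in> A"
    then have f: "finite c" "finite c'" using fin by auto
    have "cls n c = cls n c' \<longleftrightarrow> tri.reach (mutable n) c c'" by (rule cls_eq_iff[OF f(1)])
    also have "\<dots> \<longleftrightarrow> key c = key c'"
    proof
      assume "tri.reach (mutable n) c c'"
      then show "key c = key c'"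
        using tri.reach_invariants(2,3)[of "mutable n" c c'] f by (simp add: key_def)
    next
      assume "key c = key c'"
      then have "c - mutable n = c' - mutable n" "tri.arf c = tri.arf c'" by (simp_all add: key_def)
      moreover have "tri.active (mutable n) c" "tri.active (mutable n) c'" using c by (simp_all add: A_def)
      ultimately show "tri.reach (mutable n) c c'"
        using mutable_transitive(2)[OF assms] f unfolding tri.arf_transitive_def by blast
    qed
    finally show "cls n c = cls n c' \<longleftrightarrow> key c = key c'" .
  qed
  also have "key ` A = Pow (tri n - mutable n) \<times> UNIV"
  proof (rule antisym)
    show "Pow (tri n - mutable n) \<times> UNIV \<subseteq> key ` A"
    proof clarify
      fix D q assume D: "D \<subseteq> tri n - mutable n"
      then have fD: "finite D" by (meson finite_Diff finite_subset finite_tri)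
      obtain c where c: "finite c" "c - mutable n = D - mutable n" "tri.active (mutable n) c" "tri.arf c = q"
        using tri.arf_attained[OF fD mutable_transitive(1)[OF assms]] by blast
      have "c - mutable n = D" "c \<subseteq> tri n" using c(2) D mutable_subset_tri[of n] by blast+
      then show "(D, q) \<in> key ` A" using c by (auto simp: A_def key_def intro!: image_eqI[of _ _ c])
    qed
  qed (auto simp: key_def A_def)
  also have "card \<dots> = 2 ^ n * 2"
  proof -
    have "tri n - mutable n = (\<lambda>a. (a, n + 1 - a)) ` {1..n}"
      by (auto simp: tri_def mutable_def image_iff)
    moreover have "inj_on (\<lambda>a. (a, n + 1 - a)) {1..n}" by (auto simp: inj_on_def)
    ultimately have "card (tri n - mutable n) = n" by (simp add: card_image)
    then show ?thesis by (simp add: card_cartesian_product card_Pow)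
  qed
  finally have A: "card (cls n ` A) = 2 ^ n * 2" .
  have "cls n ` I \<inter> cls n ` A = {}"
  proof -
    have False if "c \<in> I" "c' \<in> A" "cls n c = cls n c'" for c c'
      using tri.reach_invariants(4)[of "mutable n" c c'] cls_eq_iff[of c n c'] that fin
      by (auto simp: I_def A_def)
    then show ?thesis by blast
  qed
  moreover have "finite (cls n ` I)" "finite (cls n ` A)" by (auto simp: I_def A_def)
  moreover have "cls n ` Pow (tri n) = cls n ` I \<union> cls n ` A" by (auto simp: I_def A_def)
  ultimately show ?thesis using I A by (simp add: card_Un_disjoint)
qed

section \<open>Determinants of column families\<close>

text \<open>
  Minors are written as determinants of families of column vectors, \<open>w j r\<close> being entry \<open>r\<close> of column \<open>j\<close>, so
  that columns can be replaced and reindexed without changing matrix types.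
\<close>

definition cdet :: "nat \<Rightarrow> (nat \<Rightarrow> nat \<Rightarrow> real) \<Rightarrow> real" where
  "cdet k w = Determinant.det (mat k k (\<lambda>(r, j). w j r))"

lemma cdet_cong: "(\<And>j r. j < k \<Longrightarrow> r < k \<Longrightarrow> w j r = w' j r) \<Longrightarrow> cdet k w = cdet k w'"
  unfolding cdet_def by (intro arg_cong[of _ _ Determinant.det] eq_matI) auto

lemma cdet_0 [simp]: "cdet 0 w = 1"
  by (simp add: cdet_def)

lemma cdet_permutations:
  "cdet k w = (\<Sum>p | p permutes {0..<k}. signof p * (\<Prod>i = 0..<k. w (p i) i))"
proof -
  have "cdet k w = (\<Sum>p | p permutes {0..<k}. signof p *
      (\<Prod>i = 0..<k. mat k k (\<lambda>(r, j). w j r) $$ (i, p i)))"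
    unfolding cdet_def by (rule det_def'[where n = k]) simp
  also have "\<dots> = (\<Sum>p | p permutes {0..<k}. signof p * (\<Prod>i = 0..<k. w (p i) i))"
  proof (intro sum.cong refl arg_cong2[of _ _ _ _ "(*)"] prod.cong)
    fix p i assume "p \<in> {p. p permutes {0..<k}}" "i \<in> {0..<k}"
    then have "p i < k" "i < k" using permutes_in_image[of p "{0..<k}" i] by auto
    then show "mat k k (\<lambda>(r, j). w j r) $$ (i, p i) = w (p i) i" by simp
  qed
  finally show ?thesis .
qed

lemma cdet_update:
  assumes "p < k"
  shows "cdet k (w(p := x)) = (\<Sum>r<k. x r * cofactor (mat k k (\<lambda>(r, j). w j r)) r p)"
proof -
  let ?A = "mat k k (\<lambda>(r, j). (w(p := x)) j r)"
  have "cdet k (w(p := x)) = (\<Sum>r<k. ?A $$ (r, p) * cofactor ?A r p)"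
    unfolding cdet_def by (rule laplace_expansion_column) (use assms in auto)
  also have "\<dots> = (\<Sum>r<k. x r * cofactor (mat k k (\<lambda>(r, j). w j r)) r p)"
  proof (intro sum.cong refl arg_cong2[of _ _ _ _ "(*)"])
    fix r assume r: "r \<in> {..<k}"
    show "?A $$ (r, p) = x r" using r assms by simp
    have "mat_delete ?A r p = mat_delete (mat k k (\<lambda>(r, j). w j r)) r p"
      using r assms by (intro eq_matI) (auto simp: mat_delete_def)
    then show "cofactor ?A r p = cofactor (mat k k (\<lambda>(r, j). w j r)) r p"
      by (simp add: cofactor_def)
  qed
  finally show ?thesis .
qed

lemma cdet_linear:
  assumes "p < k"
  shows "cdet k (w(p := \<lambda>r. x r + s * y r)) = cdet k (w(p := x)) + s * cdet k (w(p := y))"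
  unfolding cdet_update[OF assms] by (simp add: distrib_right sum.distrib sum_distrib_left mult.assoc)

lemma cdet_identical:
  assumes "i < k" "j < k" "i \<noteq> j" "w i = w j"
  shows "cdet k w = 0"
  unfolding cdet_def by (rule det_identical_columns[where i = i and j = j and n = k]) (use assms in auto)

lemma cdet_last_unit:
  "cdet (Suc k) (w(k := \<lambda>r. if r = k then 1 else 0)) = cdet k w"
proof -
  let ?A = "mat (Suc k) (Suc k) (\<lambda>(r, j). w j r)"
  have "cdet (Suc k) (w(k := \<lambda>r. if r = k then 1 else 0))
      = (\<Sum>r<Suc k. (if r = k then 1 else 0) * cofactor ?A r k)"
    by (rule cdet_update) simp
  also have "\<dots> = cofactor ?A k k" by simp
  also have "mat_delete ?A k k = mat k k (\<lambda>(r, j). w j r)"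
    by (intro eq_matI) (auto simp: mat_delete_def)
  then have "cofactor ?A k k = cdet k w" by (simp add: cofactor_def cdet_def flip: power_mult_distrib mult_2)
  finally show ?thesis .
qed

lemma cdet_first_last:
  "cdet (Suc k) (\<lambda>j. if j = 0 then z else S (j - 1)) = (-1) ^ k * cdet (Suc k) (S(k := z))"
proof -
  let ?A = "mat (Suc k) (Suc k) (\<lambda>(r, j). (if j = 0 then z else S (j - 1)) r)"
  let ?B = "mat (Suc k) (Suc k) (\<lambda>(r, j). S j r)"
  have "cdet (Suc k) (\<lambda>j. if j = 0 then z else S (j - 1)) = (\<Sum>r<Suc k. ?A $$ (r, 0) * cofactor ?A r 0)"
    unfolding cdet_def by (rule laplace_expansion_column) auto
  also have "\<dots> = (\<Sum>r<Suc k. (-1) ^ k * (z r * cofactor ?B r k))"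
  proof (intro sum.cong refl)
    fix r assume r: "r \<in> {..<Suc k}"
    have "mat_delete ?A r 0 = mat_delete ?B r k"
      using r by (intro eq_matI) (auto simp: mat_delete_def)
    moreover have "(-1 :: real) ^ k * (-1) ^ (r + k) = (-1) ^ r"
      by (simp add: power_add mult.left_commute flip: power_mult_distrib)
    ultimately have "(-1) ^ k * cofactor ?B r k = cofactor ?A r 0"
      by (simp add: cofactor_def flip: mult.assoc)
    then show "?A $$ (r, 0) * cofactor ?A r 0 = (-1) ^ k * (z r * cofactor ?B r k)"
      using r by (simp add: mult.left_commute)
  qed
  also have "\<dots> = (-1) ^ k * cdet (Suc k) (S(k := z))"
    unfolding cdet_update[OF lessI] by (simp only: sum_distrib_left)
  finally show ?thesis .
qed

text \<open>
  Expansion, along its first row, of a determinant in which that row is repeated.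
\<close>

lemma cdet_cramer:
  assumes "r < k"
  shows "(\<Sum>j<Suc k. (-1) ^ j * u j r * cdet k (\<lambda>l. u (if l < j then l else Suc l))) = 0"
proof -
  let ?B = "mat (Suc k) (Suc k) (\<lambda>(i, j). if i = 0 then u j r else u j (i - 1))"
  have "Determinant.det ?B = 0"
    by (rule det_identical_rows[where n = "Suc k" and i = 0 and j = "Suc r"]) (use assms in auto)
  moreover have "Determinant.det ?B = (\<Sum>j<Suc k. ?B $$ (0, j) * cofactor ?B 0 j)"
    by (rule laplace_expansion_row) auto
  moreover have eq: "?B $$ (0, j) * cofactor ?B 0 j = (-1) ^ j * u j r * cdet k (\<lambda>l. u (if l < j then l else Suc l))"
    if "j \<in> {..<Suc k}" for j
  proof -
    have "mat_delete ?B 0 j = mat k k (\<lambda>(r, l). u (if l < j then l else Suc l) r)"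
      using that by (intro eq_matI) (auto simp: mat_delete_def)
    then show ?thesis using that by (simp add: cofactor_def cdet_def)
  qed
  moreover have "(\<Sum>j<Suc k. ?B $$ (0, j) * cofactor ?B 0 j)
      = (\<Sum>j<Suc k. (-1) ^ j * u j r * cdet k (\<lambda>l. u (if l < j then l else Suc l)))"
    by (rule sum.cong[OF refl eq])
  ultimately show ?thesis by (simp only:)
qed

text \<open>
  The relation between \<open>k + 1\<close> vectors just obtained, fed into a functional linear in column \<open>p\<close>.
\<close>

lemma cdet_exchange:
  assumes "p < k"
  shows "(\<Sum>j<Suc k. (-1) ^ j * cdet k (\<lambda>l. u (if l < j then l else Suc l)) * cdet k (w(p := u j))) = 0"
proof -
  let ?C = "\<lambda>r. cofactor (mat k k (\<lambda>(r, j). w j r)) r p"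
  let ?D = "\<lambda>j. cdet k (\<lambda>l. u (if l < j then l else Suc l))"
  have "(\<Sum>j<Suc k. (-1) ^ j * ?D j * cdet k (w(p := u j)))
      = (\<Sum>j<Suc k. \<Sum>r<k. ?C r * ((-1) ^ j * u j r * ?D j))"
    unfolding cdet_update[OF assms] sum_distrib_left by (intro sum.cong refl) (simp add: mult_ac)
  also have "\<dots> = (\<Sum>r<k. \<Sum>j<Suc k. ?C r * ((-1) ^ j * u j r * ?D j))" by (rule sum.swap)
  also have "\<dots> = (\<Sum>r<k. ?C r * (\<Sum>j<Suc k. (-1) ^ j * u j r * ?D j))"
    by (simp only: sum_distrib_left)
  also have "\<dots> = 0" by (intro sum.neutral ballI) (simp only: cdet_cramer lessThan_iff mult_zero_right)
  finally show ?thesis .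
qed

definition skip :: "(nat \<Rightarrow> nat \<Rightarrow> real) \<Rightarrow> nat \<Rightarrow> nat \<Rightarrow> real" where
  "skip c j = (if j = 0 then c 0 else c (Suc j))"

text \<open>
  A three-term Pluecker relation for the columns \<open>c 0, \<dots>, c (m + 2)\<close>. In the exchange relation all terms
  but three vanish because a column is repeated; minors with one row less appear because the last
  column of the functional is a unit vector.
\<close>

lemma cdet_pluecker:
  "cdet (Suc m) (\<lambda>j. c (Suc j)) * cdet (Suc (Suc m)) (skip c)
     - cdet (Suc (Suc m)) (\<lambda>j. c (Suc j)) * cdet (Suc m) (skip c)
   = cdet (Suc (Suc m)) c * cdet (Suc m) (\<lambda>j. c (Suc (Suc j)))"
proof -
  let ?k = "Suc (Suc m)"
  let ?e = "\<lambda>r. if r = Suc m then 1 else (0 :: real)"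
  let ?D = "\<lambda>j. cdet ?k (\<lambda>l. c (if l < j then l else Suc l))"
  \<comment> \<open>the functional \<open>\<psi>\<close> puts its argument in front of the columns \<open>c 2, \<dots>, c (Suc m)\<close>\<close>
  define \<psi> where "\<psi> v = cdet ?k (((\<lambda>j. c (Suc j))(Suc m := ?e))(0 := v))" for v
  have \<psi>: "\<psi> v = cdet (Suc m) (\<lambda>j. if j = 0 then v else c (Suc j))" for v
  proof -
    have "\<psi> v = cdet ?k ((\<lambda>j. if j = 0 then v else c (Suc j))(Suc m := ?e))"
      unfolding \<psi>_def by (intro cdet_cong) auto
    then show ?thesis by (simp only: cdet_last_unit)
  qed
  have zero: "\<psi> (c (Suc (Suc l))) = 0" if "l < m" for l
    unfolding \<psi> by (rule cdet_identical[where i = 0 and j = "Suc l"]) (use that in auto)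
  have "0 = (\<Sum>j<Suc ?k. (-1) ^ j * ?D j * \<psi> (c j))"
    unfolding \<psi>_def by (rule cdet_exchange[symmetric]) simp
  also have "\<dots> = ?D 0 * \<psi> (c 0) + (\<Sum>j<Suc (Suc m). (-1) ^ Suc j * ?D (Suc j) * \<psi> (c (Suc j)))"
    by (simp add: sum.lessThan_Suc_shift del: sum.lessThan_Suc)
  also have "(\<Sum>j<Suc (Suc m). (-1) ^ Suc j * ?D (Suc j) * \<psi> (c (Suc j)))
      = - ?D 1 * \<psi> (c 1) + (\<Sum>j<Suc m. (-1) ^ j * ?D (Suc (Suc j)) * \<psi> (c (Suc (Suc j))))"
    by (simp add: sum.lessThan_Suc_shift[of _ "Suc m"] del: sum.lessThan_Suc)
  also have "(\<Sum>j<Suc m. (-1) ^ j * ?D (Suc (Suc j)) * \<psi> (c (Suc (Suc j))))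
      = (-1) ^ m * ?D ?k * \<psi> (c ?k)"
    using zero by simp
  finally have *: "?D 0 * \<psi> (c 0) - ?D 1 * \<psi> (c 1) + (-1) ^ m * ?D ?k * \<psi> (c ?k) = 0" by simp
  have d0: "?D 0 = cdet ?k (\<lambda>j. c (Suc j))" by simp
  have d1: "?D 1 = cdet ?k (skip c)" by (intro cdet_cong) (auto simp: skip_def)
  have dk: "?D ?k = cdet ?k c" by (intro cdet_cong) auto
  have p0: "\<psi> (c 0) = cdet (Suc m) (skip c)" unfolding \<psi> by (intro cdet_cong) (auto simp: skip_def)
  have p1: "\<psi> (c 1) = cdet (Suc m) (\<lambda>j. c (Suc j))" unfolding \<psi> by (intro cdet_cong) auto
  have pk: "(-1) ^ m * \<psi> (c ?k) = cdet (Suc m) (\<lambda>j. c (Suc (Suc j)))"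
  proof -
    have "\<psi> (c ?k) = cdet (Suc m) (\<lambda>j. if j = 0 then c ?k else (\<lambda>j. c (Suc (Suc j))) (j - 1))"
      unfolding \<psi> by (intro cdet_cong) auto
    also have "\<dots> = (-1) ^ m * cdet (Suc m) ((\<lambda>j. c (Suc (Suc j)))(m := c ?k))"
      by (rule cdet_first_last)
    also have "(\<lambda>j. c (Suc (Suc j)))(m := c ?k) = (\<lambda>j. c (Suc (Suc j)))" by auto
    finally show ?thesis by (simp flip: mult.assoc power_mult_distrib)
  qed
  have "?D 0 * \<psi> (c 0) - ?D 1 * \<psi> (c 1) + ?D ?k * ((-1) ^ m * \<psi> (c ?k)) = 0"
    using * by (simp only: mult.assoc mult.left_commute)
  then show ?thesis unfolding d0 d1 dk p0 p1 pk by (simp add: mult.commute)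
qed

section \<open>Initial minors and column operations\<close>

text \<open>
  Only the coordinates \<open>(r, c)\<close> with \<open>r < c\<close> enter; they are the free entries of a unipotent matrix. Working in
  one function space for all sizes avoids a topology on a type depending on the size.
\<close>

type_synonym coords = "nat \<times> nat \<Rightarrow> real"

definition ent :: "coords \<Rightarrow> nat \<Rightarrow> nat \<Rightarrow> real" where
  "ent x r c = (if r < c then x (r, c) else if r = c then 1 else 0)"

definition colv :: "coords \<Rightarrow> nat \<Rightarrow> nat \<Rightarrow> real" where
  "colv x c r = ent x r c"

definition minor :: "coords \<Rightarrow> nat \<Rightarrow> nat \<Rightarrow> real" where
  "minor x a k = cdet k (\<lambda>j. colv x (a + j))"

text \<open>
  The coefficient of \<open>s\<close> in the minor starting at column \<open>i + 1\<close> after \<open>s\<close> times column \<open>i\<close> has been added to column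
  \<open>i + 1\<close>. The empty minor does not change, hence the value 0.
\<close>

definition gap_minor :: "coords \<Rightarrow> nat \<Rightarrow> nat \<Rightarrow> real" where
  "gap_minor x i k = (if k = 0 then 0 else cdet k (skip (\<lambda>j. colv x (i + j))))"

text \<open>
  Right multiplication by an elementary matrix: \<open>s\<close> times column \<open>i\<close> is added to column \<open>j\<close>.
\<close>

definition flow :: "nat \<Rightarrow> nat \<Rightarrow> real \<Rightarrow> coords \<Rightarrow> coords" where
  "flow i j s x = (\<lambda>(r, c). if c = j then x (r, c) + s * ent x r i else x (r, c))"

lemma minor_0 [simp]: "minor x a 0 = 1"
  by (simp add: minor_def)

lemma minor_first [simp]: "minor x 0 k = 1"
proof -
  let ?A = "mat k k (\<lambda>(r, j). colv x (0 + j) r)"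
  have "Determinant.det ?A = prod_list (diag_mat ?A)"
    by (rule det_upper_triangular[where n = k]) (auto simp: colv_def ent_def)
  also have "diag_mat ?A = replicate k 1"
    by (rule nth_equalityI) (auto simp: diag_mat_def colv_def ent_def)
  finally show ?thesis by (simp add: minor_def cdet_def)
qed

lemma minor_pluecker:
  "minor x (Suc i) k * gap_minor x i (Suc k) - minor x (Suc i) (Suc k) * gap_minor x i k
   = minor x i (Suc k) * minor x (Suc (Suc i)) k"
proof (cases k)
  case 0
  have "cdet (Suc 0) (skip (\<lambda>j. colv x (i + j))) = cdet (Suc 0) (\<lambda>j. colv x (i + j))"
    by (rule cdet_cong) (simp add: skip_def)
  with 0 show ?thesis by (simp add: gap_minor_def minor_def)
next
  case (Suc m)
  show ?thesis using cdet_pluecker[of m "\<lambda>j. colv x (i + j)"] Suc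
    by (simp add: gap_minor_def minor_def)
qed

lemma colv_flow:
  assumes "i < j"
  shows "colv (flow i j s x) c = (if c = j then \<lambda>r. colv x j r + s * colv x i r else colv x c)"
  using assms by (auto simp: colv_def flow_def ent_def fun_eq_iff)

lemma minor_flow_same: "minor (flow i (Suc i) s x) (Suc i) k = minor x (Suc i) k + s * gap_minor x i k"
proof (cases k)
  case (Suc m)
  let ?w = "\<lambda>j. colv x (Suc i + j)"
  have "minor (flow i (Suc i) s x) (Suc i) k = cdet k (?w(0 := \<lambda>r. colv x (Suc i) r + s * colv x i r))"
    unfolding minor_def by (intro cdet_cong) (auto simp: colv_flow)
  also have "\<dots> = cdet k (?w(0 := colv x (Suc i))) + s * cdet k (?w(0 := colv x i))"
    using Suc by (intro cdet_linear) simp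
  also have "cdet k (?w(0 := colv x (Suc i))) = minor x (Suc i) k"
    unfolding minor_def by (intro cdet_cong) auto
  also have "cdet k (?w(0 := colv x i)) = gap_minor x i k"
    using Suc by (auto simp: gap_minor_def skip_def intro!: cdet_cong)
  finally show ?thesis .
qed (simp add: gap_minor_def)

text \<open>
  Either the changed column does not occur in the minor, or column \<open>i\<close> occurs along with it.
\<close>

lemma minor_flow_other:
  assumes "a \<noteq> Suc i"
  shows "minor (flow i (Suc i) s x) a k = minor x a k"
proof (cases "a \<le> i \<and> i < a + k - 1")
  case False
  then show ?thesis unfolding minor_def using assms by (intro cdet_cong) (auto simp: colv_flow)
next
  case True
  let ?w = "\<lambda>j. colv x (a + j)" and ?p = "Suc i - a"
  have p: "?p < k" "a + ?p = Suc i" using True by auto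
  have "minor (flow i (Suc i) s x) a k = cdet k (?w(?p := \<lambda>r. colv x (Suc i) r + s * colv x i r))"
    unfolding minor_def using p by (intro cdet_cong) (auto simp: colv_flow)
  also have "\<dots> = cdet k (?w(?p := colv x (Suc i))) + s * cdet k (?w(?p := colv x i))"
    using p by (intro cdet_linear) simp
  also have "cdet k (?w(?p := colv x (Suc i))) = minor x a k"
    unfolding minor_def using p by (intro cdet_cong) auto
  also have "cdet k (?w(?p := colv x i)) = 0"
    by (rule cdet_identical[where i = "i - a" and j = ?p]) (use True in auto)
  finally show ?thesis by simp
qed

lemma minor_upd_other:
  assumes "k \<le> r \<or> c < a \<or> a + k \<le> c"
  shows "minor (x((r, c) := v)) a k = minor x a k"
  unfolding minor_def using assms by (intro cdet_cong) (auto simp: colv_def ent_def)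

text \<open>
  A minor is affine in its bottom right entry, with the next smaller minor as coefficient. Thus the minors
  form a triangular coordinate system wherever they do not vanish.
\<close>

lemma minor_upd_corner:
  assumes "1 \<le> a"
  shows "minor (x((k, a + k) := v)) a (Suc k) = minor x a (Suc k) + (v - x (k, a + k)) * minor x a k"
proof -
  let ?w = "\<lambda>j. colv x (a + j)" and ?e = "\<lambda>r. if r = k then 1 else (0 :: real)"
  have "minor (x((k, a + k) := v)) a (Suc k)
      = cdet (Suc k) (?w(k := \<lambda>r. colv x (a + k) r + (v - x (k, a + k)) * ?e r))"
    unfolding minor_def using assms by (intro cdet_cong) (auto simp: colv_def ent_def)
  also have "\<dots> = cdet (Suc k) (?w(k := colv x (a + k))) + (v - x (k, a + k)) * cdet (Suc k) (?w(k := ?e))"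
    by (intro cdet_linear) simp
  also have "cdet (Suc k) (?w(k := colv x (a + k))) = minor x a (Suc k)"
    unfolding minor_def by (intro cdet_cong) auto
  also have "cdet (Suc k) (?w(k := ?e)) = minor x a k" by (simp add: cdet_last_unit minor_def)
  finally show ?thesis .
qed

lemma minor_upd_irrelevant:
  assumes "\<And>r c. r < c \<Longrightarrow> c < a + k \<Longrightarrow> x (r, c) = y (r, c)"
  shows "minor x a k = minor y a k"
  unfolding minor_def using assms by (intro cdet_cong) (auto simp: colv_def ent_def)

section \<open>Continuity and density\<close>

lemma continuous_coord: "continuous_on S (\<lambda>x :: coords. x p)"
  by (rule continuous_on_subset[OF continuous_on_product_coordinates subset_UNIV])

lemma continuous_ent: "continuous_on S (\<lambda>x. ent x r c)"
  unfolding ent_def using continuous_coord by (cases "r < c") (auto intro: continuous_on_const)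

lemma continuous_cdet:
  assumes "\<And>j r. continuous_on S (\<lambda>x. w x j r)"
  shows "continuous_on S (\<lambda>x. cdet k (w x))"
  unfolding cdet_permutations
  by (intro continuous_on_sum continuous_on_mult continuous_on_const continuous_on_prod assms)

lemma continuous_minor: "continuous_on S (\<lambda>x. minor x a k)"
  unfolding minor_def colv_def by (intro continuous_cdet continuous_ent)

lemma continuous_gap_minor: "continuous_on S (\<lambda>x. gap_minor x i k)"
proof (cases "k = 0")
  case False
  have "continuous_on S (\<lambda>x. skip (\<lambda>j. colv x (i + j)) j r)" for j r
    unfolding skip_def colv_def by (cases "j = 0") (auto intro: continuous_ent)
  then show ?thesis using False unfolding gap_minor_def by (auto intro: continuous_cdet)
qed (simp add: gap_minor_def)

definition line :: "coords \<Rightarrow> coords \<Rightarrow> real \<Rightarrow> coords" where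
  "line x y s = (\<lambda>p. x p + s * (y p - x p))"

text \<open>
  A substitute for polynomial functions in the coordinates: being polynomial along every line suffices
  for the zero set to have empty interior, unless it is the whole space.
\<close>

definition linepoly :: "(coords \<Rightarrow> real) \<Rightarrow> bool" where
  "linepoly G \<longleftrightarrow> (\<forall>x y. \<exists>p. \<forall>s. G (line x y s) = poly p s)"

lemma linepolyI: "(\<And>x y. \<exists>p. \<forall>s. G (line x y s) = poly p s) \<Longrightarrow> linepoly G"
  by (simp add: linepoly_def)

lemma linepolyE:
  assumes "linepoly G" obtains p where "\<And>s. G (line x y s) = poly p s"
  using assms unfolding linepoly_def by blast

lemma linepoly_const: "linepoly (\<lambda>x. c)"
  by (rule linepolyI, rule exI[of _ "[:c:]"]) simp

lemma linepoly_coord: "linepoly (\<lambda>x. x p)"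
proof (rule linepolyI)
  fix x y :: coords
  show "\<exists>q. \<forall>s. line x y s p = poly q s"
    by (rule exI[of _ "[:x p, y p - x p:]"]) (simp add: line_def)
qed

lemma linepoly_add:
  assumes "linepoly G" "linepoly G'" shows "linepoly (\<lambda>x. G x + G' x)"
proof (rule linepolyI)
  fix x y
  obtain p p' where "\<And>s. G (line x y s) = poly p s" "\<And>s. G' (line x y s) = poly p' s"
    using linepolyE[OF assms(1)] linepolyE[OF assms(2)] by metis
  then show "\<exists>q. \<forall>s. G (line x y s) + G' (line x y s) = poly q s" by (intro exI[of _ "p + p'"]) simp
qed

lemma linepoly_mult:
  assumes "linepoly G" "linepoly G'" shows "linepoly (\<lambda>x. G x * G' x)"
proof (rule linepolyI)
  fix x y
  obtain p p' where "\<And>s. G (line x y s) = poly p s" "\<And>s. G' (line x y s) = poly p' s"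
    using linepolyE[OF assms(1)] linepolyE[OF assms(2)] by metis
  then show "\<exists>q. \<forall>s. G (line x y s) * G' (line x y s) = poly q s" by (intro exI[of _ "p * p'"]) simp
qed

lemma linepoly_diff:
  assumes "linepoly G" "linepoly G'" shows "linepoly (\<lambda>x. G x - G' x)"
  using linepoly_add[OF assms(1) linepoly_mult[OF linepoly_const[of "-1"] assms(2)]] by simp

lemma linepoly_sum: "(\<And>i. i \<in> A \<Longrightarrow> linepoly (G i)) \<Longrightarrow> linepoly (\<lambda>x. \<Sum>i\<in>A. G i x)"
  by (induction A rule: infinite_finite_induct) (auto intro: linepoly_const linepoly_add)

lemma linepoly_prod: "(\<And>i. i \<in> A \<Longrightarrow> linepoly (G i)) \<Longrightarrow> linepoly (\<lambda>x. \<Prod>i\<in>A. G i x)"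
  by (induction A rule: infinite_finite_induct) (auto intro: linepoly_const linepoly_mult)

lemma linepoly_ent: "linepoly (\<lambda>x. ent x r c)"
  unfolding ent_def using linepoly_coord linepoly_const by (cases "r < c"; cases "r = c") simp_all

lemma linepoly_cdet:
  assumes "\<And>j r. linepoly (\<lambda>x. w x j r)"
  shows "linepoly (\<lambda>x. cdet k (w x))"
  unfolding cdet_permutations
  by (intro linepoly_sum linepoly_mult linepoly_const linepoly_prod assms)

lemma linepoly_minor: "linepoly (\<lambda>x. minor x a k)"
  unfolding minor_def colv_def by (intro linepoly_cdet linepoly_ent)

lemma linepoly_gap_minor: "linepoly (\<lambda>x. gap_minor x i k)"
proof (cases "k = 0")
  case False
  have "linepoly (\<lambda>x. skip (\<lambda>j. colv x (i + j)) j r)" for j r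
    unfolding skip_def colv_def by (cases "j = 0") (auto intro: linepoly_ent)
  then show ?thesis using False unfolding gap_minor_def by (auto intro: linepoly_cdet)
qed (simp add: gap_minor_def linepoly_const)

lemma linepoly_dense:
  assumes G: "linepoly G" "G y \<noteq> 0" and T: "open T" "x \<in> T"
  shows "\<exists>z\<in>T. G z \<noteq> 0"
proof -
  obtain p where p: "\<And>s. G (line x y s) = poly p s" using linepolyE[OF G(1)] by blast
  have "line x y 1 = y" "line x y 0 = x" by (auto simp: line_def)
  then have "p \<noteq> 0" using p[of 1] G(2) by auto
  then have fin: "finite {s. poly p s = 0}" by (rule poly_roots_finite)
  have "continuous_on UNIV (line x y)"
    unfolding line_def by (intro continuous_on_coordinatewise_then_product continuous_intros)
  then have "open (line x y -` T)" by (rule open_vimage[OF T(1)])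
  moreover have "0 \<in> line x y -` T" using T(2) \<open>line x y 0 = x\<close> by simp
  ultimately obtain e where e: "e > 0" "ball 0 e \<subseteq> line x y -` T" using open_contains_ball by blast
  have "infinite (ball (0 :: real) e)" using e(1) by (simp add: ball_eq_greaterThanLessThan)
  then obtain s where "s \<in> ball 0 e" "poly p s \<noteq> 0" using fin by (metis (mono_tags, lifting) mem_Collect_eq rev_finite_subset subsetI)
  then show ?thesis using e(2) p by (intro bexI[of _ "line x y s"]) auto
qed

section \<open>Signs of the initial minors\<close>

text \<open>
  The locus where all initial minors are nonzero; the minors identify it with an algebraic torus.
\<close>

definition torus :: "nat \<Rightarrow> coords set" where
  "torus n = {x. \<forall>(a, k)\<in>tri n. minor x a k \<noteq> 0}"

definition Ucoords :: "nat \<Rightarrow> coords set" where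
  "Ucoords n = {x. \<forall>k\<in>{1..n}. minor x (n + 1 - k) k \<noteq> 0}"

definition signs :: "nat \<Rightarrow> coords \<Rightarrow> (nat \<times> nat) set" where
  "signs n x = {(a, k) \<in> tri n. minor x a k < 0}"

lemma signs_subset: "signs n x \<subseteq> tri n"
  by (auto simp: signs_def)

lemma finite_signs [simp]: "finite (signs n x)"
  by (rule finite_subset[OF signs_subset finite_tri])

lemma torus_subset_U: "torus n \<subseteq> Ucoords n"
proof
  fix x assume x: "x \<in> torus n"
  show "x \<in> Ucoords n" unfolding Ucoords_def
  proof (intro CollectI ballI)
    fix k assume "k \<in> {1..n}"
    then have "(n + 1 - k, k) \<in> tri n" by (auto simp: tri_def)
    then show "minor x (n + 1 - k) k \<noteq> 0" using x by (auto simp: torus_def)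
  qed
qed

lemma mem_signs: "a + k \<le> n + 1 \<Longrightarrow> (a, k) \<in> signs n x \<longleftrightarrow> minor x a k < 0"
  by (cases "a = 0 \<or> k = 0") (auto simp: signs_def tri_def)

lemma torus_nonzero:
  assumes "x \<in> torus n" "a + k \<le> n + 1" shows "minor x a k \<noteq> 0"
proof (cases "a = 0 \<or> k = 0")
  case False
  then have "(a, k) \<in> tri n" using assms(2) by (auto simp: tri_def)
  then show ?thesis using assms(1) by (auto simp: torus_def)
qed auto

lemma of_bool_mult_neg:
  fixes x y :: real
  assumes "x \<noteq> 0" "y \<noteq> 0"
  shows "(of_bool (x * y < 0) :: bit) = of_bool (x < 0) + of_bool (y < 0)"
  using assms by (auto simp: mult_less_0_iff)

text \<open>
  The product of the two neighbouring minors that a column operation from \<open>i\<close> to \<open>i + 1\<close> leaves unchanged. It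
  is the right-hand side of the Pluecker relation.
\<close>

definition rim :: "coords \<Rightarrow> nat \<Rightarrow> nat \<Rightarrow> real" where
  "rim x i k = minor x i (Suc k) * minor x (Suc (Suc i)) k"

text \<open>
  A vertex is lit when the product of its six neighbouring minors is negative.
\<close>

lemma lit_signs:
  assumes x: "x \<in> torus n" and ik: "i + k + 2 \<le> n"
  shows "tri.lit (signs n x) (Suc i, Suc k) \<longleftrightarrow>
    minor x (Suc i) (Suc (Suc k)) * minor x (Suc i) k * (rim x i (Suc k) * rim x i k) < 0"
proof -
  let ?p1 = "minor x (Suc i) (Suc (Suc k))" and ?p2 = "minor x (Suc i) k" and ?p3 = "minor x i (Suc k)"
    and ?p4 = "minor x (Suc (Suc i)) (Suc k)" and ?p5 = "minor x (Suc (Suc i)) k"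
    and ?p6 = "minor x i (Suc (Suc k))"
  have nz: "?p1 \<noteq> 0" "?p2 \<noteq> 0" "?p3 \<noteq> 0" "?p4 \<noteq> 0" "?p5 \<noteq> 0" "?p6 \<noteq> 0"
    using ik by (auto intro!: torus_nonzero[OF x])
  have "(of_bool (tri.lit (signs n x) (Suc i, Suc k)) :: bit) = of_bool (?p1 < 0) + of_bool (?p2 < 0)
      + of_bool (?p3 < 0) + of_bool (?p4 < 0) + of_bool (?p5 < 0) + of_bool (?p6 < 0)"
    unfolding tri_lit using ik by (simp only: mem_signs)
  also have "\<dots> = of_bool (?p1 * ?p2 * ?p3 * ?p4 * ?p5 * ?p6 < 0)"
    using nz by (simp only: of_bool_mult_neg mult_eq_0_iff simp_thms)
  finally have "tri.lit (signs n x) (Suc i, Suc k) \<longleftrightarrow> ?p1 * ?p2 * ?p3 * ?p4 * ?p5 * ?p6 < 0"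
    by (simp only: of_bool_eq_iff)
  moreover have "?p1 * ?p2 * ?p3 * ?p4 * ?p5 * ?p6 = ?p1 * ?p2 * (rim x i (Suc k) * rim x i k)"
    by (simp add: rim_def mult_ac)
  ultimately show ?thesis by simp
qed

text \<open>
  Along a column operation the minor starting at \<open>i + 1\<close> is \<open>1 + s * slope x i k\<close> times its initial value, so
  it vanishes at \<open>s = - 1 / slope x i k\<close>. By the Pluecker relation consecutive slopes differ by the
  bidiagonal factorization parameters of row \<open>i\<close>.
\<close>

definition slope :: "coords \<Rightarrow> nat \<Rightarrow> nat \<Rightarrow> real" where
  "slope x i k = gap_minor x i k / minor x (Suc i) k"

lemma slope_0 [simp]: "slope x i 0 = 0"
  by (simp add: slope_def gap_minor_def)

lemma slope_step:
  assumes "minor x (Suc i) k \<noteq> 0" "minor x (Suc i) (Suc k) \<noteq> 0"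
  shows "rim x i k = minor x (Suc i) k * minor x (Suc i) (Suc k) * (slope x i (Suc k) - slope x i k)"
  using minor_pluecker[of x i k] assms by (simp add: slope_def rim_def field_simps)

lemma minor_flow_slope:
  assumes "minor x (Suc i) k \<noteq> 0"
  shows "minor (flow i (Suc i) s x) (Suc i) k = minor x (Suc i) k * (1 + s * slope x i k)"
  using assms by (simp add: minor_flow_same slope_def field_simps)

lemma rim_flow [simp]: "rim (flow i (Suc i) s x) i k = rim x i k"
  by (simp add: rim_def minor_flow_other)

section \<open>Crossing walls along a column operation\<close>

text \<open>
  When only the minor at \<open>(i + 1, k)\<close> changes sign between two parameters, that vertex is lit just before.
  Close to the wall the factor \<open>1 + u * s * slope x i j\<close> has the sign of
  \<open>s * slope x i j - s * slope x i k\<close> for the two neighbours \<open>j = k - 1\<close> and \<open>j = k + 1\<close>, while by the Pluecker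
  relation the unchanged minors contribute \<open>slope x i (k + 1) - slope x i k\<close> and
  \<open>slope x i k - slope x i (k - 1)\<close>. The product of all four is negative.
\<close>

lemma crossing_step:
  assumes x: "x \<in> torus n" and i: "i < n"
    and k: "1 \<le> k" "k < n - i"
    and s: "1 + s * slope x i k < 0" "\<And>j. j \<in> {1..n - i} \<Longrightarrow> 1 + s * slope x i j \<noteq> 0"
    and s': "1 + u * s * slope x i k > 0"
    and others: "\<And>j. j \<in> {1..n - i} \<Longrightarrow> j \<noteq> k \<Longrightarrow> (1 + u * s * slope x i j) * (1 + s * slope x i j) > 0"
    and sep: "\<And>j. j \<le> n - i \<Longrightarrow> j \<noteq> k \<Longrightarrow> (1 + u * s * slope x i j) * (s * slope x i j - s * slope x i k) > 0"
  shows "tri.step (mutable n) (signs n (flow i (Suc i) (u * s) x)) (signs n (flow i (Suc i) s x))"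
proof -
  let ?y = "flow i (Suc i) (u * s) x" and ?z = "flow i (Suc i) s x"
  let ?\<alpha> = "\<lambda>j. minor x (Suc i) j" and ?\<rho> = "slope x i"
  have nz: "?\<alpha> j \<noteq> 0" if "j \<le> n - i" for j using that i by (intro torus_nonzero[OF x]) simp
  have my: "minor ?y (Suc i) j = ?\<alpha> j * (1 + u * s * ?\<rho> j)" if "j \<le> n - i" for j
    using minor_flow_slope[OF nz[OF that]] .
  have mz: "minor ?z (Suc i) j = ?\<alpha> j * (1 + s * ?\<rho> j)" if "j \<le> n - i" for j
    using minor_flow_slope[OF nz[OF that]] .
  have y: "?y \<in> torus n" unfolding torus_def
  proof (intro CollectI ballI, clarify)
    fix a j assume aj: "(a, j) \<in> tri n" "minor ?y a j = 0"
    show False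
    proof (cases "a = Suc i")
      case True
      then have j: "j \<in> {1..n - i}" using aj by (auto simp: tri_def)
      then have "1 + u * s * ?\<rho> j \<noteq> 0" using s' others[of j] by (cases "j = k") auto
      then show False using aj True my[of j] nz[of j] j by simp
    next
      case False
      then show False using aj x by (auto simp: minor_flow_other torus_def)
    qed
  qed
  obtain k' where k': "k = Suc k'" using k(1) by (cases k) auto
  have "tri.lit (signs n ?y) (Suc i, Suc k')"
  proof -
    have "minor ?y (Suc i) (Suc (Suc k')) * minor ?y (Suc i) k' * (rim ?y i (Suc k') * rim ?y i k')
        = (?\<alpha> (Suc (Suc k')))\<^sup>2 * (?\<alpha> k')\<^sup>2 * (?\<alpha> k)\<^sup>2
          * ((1 + u * s * ?\<rho> (Suc (Suc k'))) * (?\<rho> (Suc (Suc k')) - ?\<rho> k))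
          * ((1 + u * s * ?\<rho> k') * (?\<rho> k - ?\<rho> k'))"
      using k k' nz by (simp add: my slope_step power2_eq_square)
    moreover have "\<dots> < 0"
    proof -
      have "s \<noteq> 0" using s(1) by auto
      have A: "(1 + u * s * ?\<rho> (Suc (Suc k'))) * (?\<rho> (Suc (Suc k')) - ?\<rho> k) * s > 0"
        using sep[of "Suc (Suc k')"] k k' by (simp add: algebra_simps)
      have B: "(1 + u * s * ?\<rho> k') * (?\<rho> k - ?\<rho> k') * s < 0"
        using sep[of "k'"] k k' by (simp add: algebra_simps)
      have "((1 + u * s * ?\<rho> (Suc (Suc k'))) * (?\<rho> (Suc (Suc k')) - ?\<rho> k))
          * ((1 + u * s * ?\<rho> k') * (?\<rho> k - ?\<rho> k')) < 0"
        using A B by (auto simp: mult_less_0_iff zero_less_mult_iff)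
      moreover have "(?\<alpha> (Suc (Suc k')))\<^sup>2 * (?\<alpha> k')\<^sup>2 * (?\<alpha> k)\<^sup>2 > 0"
        using nz k k' by simp
      ultimately show ?thesis by (simp only: mult.assoc mult_less_0_iff) auto
    qed
    ultimately show ?thesis using lit_signs[OF y, of i k'] k k' i by simp
  qed
  moreover have "signs n ?z = tri.flip (Suc i, k) (signs n ?y)"
  proof -
    have "(a, j) \<in> signs n ?z \<longleftrightarrow> (a, j) \<in> tri.flip (Suc i, k) (signs n ?y)" if aj: "(a, j) \<in> tri n" for a j
    proof (cases "a = Suc i")
      case True
      then have j: "j \<in> {1..n - i}" using aj by (auto simp: tri_def)
      show ?thesis
      proof (cases "j = k")
        case True
        then show ?thesis using \<open>a = Suc i\<close> aj j s(1) s' my[of k] mz[of k] nz[of k]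
          by (auto simp: tri.mem_flip signs_def mult_less_0_iff)
      next
        case False
        then show ?thesis using \<open>a = Suc i\<close> aj j others[of j] my[of j] mz[of j] nz[of j]
          by (auto simp: tri.mem_flip signs_def mult_less_0_iff zero_less_mult_iff)
      qed
    next
      case False
      then show ?thesis by (auto simp: tri.mem_flip signs_def minor_flow_other)
    qed
    moreover have "tri.flip (Suc i, k) (signs n ?y) \<subseteq> tri n"
      using signs_subset[of n ?y] k i by (auto simp: tri.mem_flip tri_def)
    ultimately show ?thesis using signs_subset[of n ?z] by auto
  qed
  moreover have "(Suc i, k) \<in> mutable n" using k i by (auto simp: mutable_def)
  ultimately show ?thesis unfolding tri.step_def k' by blast
qed

text \<open>
  Distinct slopes make the walls lie at distinct parameters, so they are crossed one at a time. The
  induction removes the last wall before \<open>s\<close>. The hypothesis at \<open>n - i\<close> keeps the path inside the space: that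
  minor is one of the \<open>D\<^sub>k\<close>.
\<close>

lemma crossing:
  assumes x: "x \<in> torus n" and i: "i < n"
    and distinct: "\<And>j k. j \<in> {1..<n - i} \<Longrightarrow> k \<in> {1..<n - i} \<Longrightarrow> j \<noteq> k \<Longrightarrow> slope x i j \<noteq> slope x i k"
    and s: "\<And>j. j \<in> {1..n - i} \<Longrightarrow> 1 + s * slope x i j \<noteq> 0" "1 + s * slope x i (n - i) > 0"
  shows "tri.reach (mutable n) (signs n x) (signs n (flow i (Suc i) s x))"
  using s
proof (induction "card {j \<in> {1..<n - i}. 1 + s * slope x i j < 0}" arbitrary: s rule: less_induct)
  case less
  let ?\<rho> = "slope x i"
  define K where "K = {j \<in> {1..<n - i}. 1 + s * ?\<rho> j < 0}"
  have fK: "finite K" by (simp add: K_def)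
  have nz: "minor x (Suc i) j \<noteq> 0" if "j \<le> n - i" for j
    using that i by (intro torus_nonzero[OF x]) simp
  have notK: "1 + s * ?\<rho> j > 0" if "j \<le> n - i" "j \<notin> K" for j
  proof (cases "j = 0 \<or> j = n - i")
    case False
    then have "j \<in> {1..<n - i}" "j \<in> {1..n - i}" using that by auto
    then show ?thesis using less.prems(1)[of j] that(2) by (auto simp: K_def)
  qed (use less.prems(2) in auto)
  show ?case
  proof (cases "K = {}")
    case True
    have "signs n (flow i (Suc i) s x) = signs n x"
    proof -
      have "minor (flow i (Suc i) s x) a j < 0 \<longleftrightarrow> minor x a j < 0" if "(a, j) \<in> tri n" for a j
      proof (cases "a = Suc i")
        case a: True
        then have j: "j \<le> n - i" using that by (auto simp: tri_def)
        show ?thesis using notK[OF j] True nz[OF j] a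
          by (auto simp: minor_flow_slope mult_less_0_iff)
      qed (simp add: minor_flow_other)
      then show ?thesis by (auto simp: signs_def)
    qed
    then show ?thesis by simp
  next
    case False
    define e where "e j = - (s * ?\<rho> j)" for j
    have "Min (e ` K) \<in> e ` K" using fK False by (intro Min_in) auto
    then obtain k where "k \<in> K" "e k = Min (e ` K)" by force
    then have k: "k \<in> K" "\<And>j. j \<in> K \<Longrightarrow> e k \<le> e j" using fK by auto
    have eK: "e j > 1" if "j \<in> K" for j using that by (simp add: K_def e_def)
    have enK: "e j < 1" if "j \<le> n - i" "j \<notin> K" for j using notK[OF that] by (simp add: e_def)
    have s0: "s \<noteq> 0" using eK[OF k(1)] by (auto simp: e_def)
    have less_e: "e k < e j" if "j \<in> K" "j \<noteq> k" for j
    proof -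
      have "?\<rho> j \<noteq> ?\<rho> k" using distinct[of j k] that k(1) by (auto simp: K_def)
      then have "e j \<noteq> e k" using s0 by (simp add: e_def)
      then show ?thesis using k(2)[OF that(1)] by simp
    qed
    \<comment> \<open>the wall of \<open>k\<close> is the last one; the parameter \<open>1 / w\<close> lies between it and the wall before\<close>
    define m where "m = Min (insert (e k + 1) (e ` (K - {k})))"
    have m: "e k < m" "\<And>j. j \<in> K \<Longrightarrow> j \<noteq> k \<Longrightarrow> m \<le> e j"
      unfolding m_def using fK less_e by auto
    define w where "w = (e k + m) / 2"
    have w: "e k < w" "w < m" "w > 1" using m(1) eK[OF k(1)] by (auto simp: w_def)
    define u where "u = 1 / w"
    have u: "0 < u" "u < 1" "u * w = 1" using w by (auto simp: u_def)
    have us: "1 + u * s * ?\<rho> j = u * (w - e j)" for j using u by (simp add: e_def algebra_simps)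
    have pos: "w - e j > 0" if "j \<le> n - i" "j \<notin> K - {k}" for j
    proof (cases "j = k")
      case False
      then show ?thesis using enK[of j] that w by auto
    qed (use w in simp)
    have neg: "w - e j < 0" if "j \<in> K" "j \<noteq> k" for j using m(2)[OF that] w by simp
    have kr: "1 \<le> k" "k < n - i" using k(1) by (auto simp: K_def)
    have K': "{j \<in> {1..<n - i}. 1 + u * s * ?\<rho> j < 0} = K - {k}"
    proof (intro equalityI subsetI)
      fix j assume "j \<in> {j \<in> {1..<n - i}. 1 + u * s * ?\<rho> j < 0}"
      then have "j \<le> n - i" "u * (w - e j) < 0" by (simp_all add: us)
      then show "j \<in> K - {k}" using pos[of j] u(1) by (auto simp: mult_less_0_iff)
    next
      fix j assume "j \<in> K - {k}"
      then have "u * (w - e j) < 0" "j \<in> {1..<n - i}"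
        using neg[of j] u(1) by (auto simp: mult_less_0_iff K_def)
      then show "j \<in> {j \<in> {1..<n - i}. 1 + u * s * ?\<rho> j < 0}" by (simp add: us)
    qed
    have "card {j \<in> {1..<n - i}. 1 + u * s * ?\<rho> j < 0} < card {j \<in> {1..<n - i}. 1 + s * ?\<rho> j < 0}"
      unfolding K' K_def[symmetric] using fK k(1) by (rule card_Diff1_less)
    moreover have "1 + u * s * ?\<rho> j \<noteq> 0" if "j \<in> {1..n - i}" for j
      using pos[of j] neg[of j] u that unfolding us by (cases "j \<in> K - {k}") auto
    moreover have "1 + u * s * ?\<rho> (n - i) > 0"
      using pos[of "n - i"] u unfolding us by (auto simp: K_def)
    ultimately have "tri.reach (mutable n) (signs n x) (signs n (flow i (Suc i) (u * s) x))"
      by (intro less.hyps)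
    moreover have "tri.step (mutable n) (signs n (flow i (Suc i) (u * s) x)) (signs n (flow i (Suc i) s x))"
    proof (rule crossing_step[OF x i kr])
      show "1 + s * ?\<rho> k < 0" using k(1) by (simp add: K_def)
      show "1 + u * s * ?\<rho> k > 0" using w u by (simp add: us)
      show "(1 + u * s * ?\<rho> j) * (1 + s * ?\<rho> j) > 0" if "j \<in> {1..n - i}" "j \<noteq> k" for j
      proof (cases "j \<in> K")
        case True
        then show ?thesis using neg[of j] that eK[of j] u(1)
          by (auto simp: us e_def K_def zero_less_mult_iff mult_less_0_iff)
      next
        case False
        then show ?thesis using pos[of j] notK[of j] that u(1)
          by (auto simp: us zero_less_mult_iff)
      qed
      show "(1 + u * s * ?\<rho> j) * (s * ?\<rho> j - s * ?\<rho> k) > 0" if "j \<le> n - i" "j \<noteq> k" for j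
      proof -
        have eq: "s * ?\<rho> j - s * ?\<rho> k = e k - e j" by (simp add: e_def)
        show ?thesis
        proof (cases "j \<in> K")
          case True
          then have "u * (w - e j) < 0" "e k - e j < 0"
            using neg[of j] that less_e[of j] u(1) by (auto simp: mult_less_0_iff)
          then show ?thesis unfolding us eq by (rule mult_neg_neg)
        next
          case False
          then have "u * (w - e j) > 0" "e k - e j > 0"
            using pos[of j] that enK[of j] eK[OF k(1)] u(1) by auto
          then show ?thesis unfolding us eq by (rule mult_pos_pos)
        qed
      qed
    qed (use less.prems in auto)
    ultimately show ?thesis by (rule rtranclp.rtrancl_into_rtrancl)
  qed
qed

section \<open>Cells of prescribed signs\<close>

text \<open>
  The order in which minors are prescribed: by size, then by first column. Changing the corner entry of
  a minor does not disturb any minor that precedes it.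
\<close>

lemma key_order:
  assumes "l * (n + 2) + b < Suc k * (n + 2) + a" "a \<le> n + 1"
  shows "l \<le> k \<or> b + l \<le> a + k"
proof (rule ccontr)
  assume *: "\<not> ?thesis"
  show False
  proof (cases "l = Suc k")
    case True
    then show False using assms(1) * by simp
  next
    case False
    then have "Suc (Suc k) \<le> l" using * by simp
    then have "Suc (Suc k) * (n + 2) \<le> l * (n + 2)" by (rule mult_le_mono1)
    then show False using assms by simp
  qed
qed

lemma key_inj:
  assumes "l * (n + 2) + b = k * (n + 2) + a" "a \<le> n + 1" "b \<le> n + 1"
  shows "l = k" "b = (a :: nat)"
proof -
  have *: "\<not> l' < k'" if "l' * (n + 2) + b' = k' * (n + 2) + a'" "b' \<le> n + 1" for l' k' a' b' :: nat
  proof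
    assume "l' < k'"
    then have "Suc l' * (n + 2) \<le> k' * (n + 2)" by (intro mult_le_mono1) simp
    then show False using that by simp
  qed
  show "l = k" using *[OF assms(1,3)] *[OF assms(1)[symmetric] assms(2)] by simp
  then show "b = a" using assms(1) by simp
qed

lemma tri_le: "(a, k) \<in> tri n \<Longrightarrow> a \<le> n + 1 \<and> k \<le> n \<and> 1 \<le> a \<and> 1 \<le> k"
  by (auto simp: tri_def)

text \<open>
  Minors are prescribed one after the other through their corner entries.
\<close>

lemma interpolation:
  assumes F: "\<And>p. F p \<noteq> 0"
  obtains x where "\<And>a k. (a, k) \<in> tri n \<Longrightarrow> minor x a k = F (a, k)"
proof -
  have "\<exists>x. \<forall>(a, k)\<in>tri n. k * (n + 2) + a < N \<longrightarrow> minor x a k = F (a, k)" for N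
  proof (induction N)
    case (Suc N)
    then obtain x where x: "\<And>a k. (a, k) \<in> tri n \<Longrightarrow> k * (n + 2) + a < N \<Longrightarrow> minor x a k = F (a, k)"
      by blast
    show ?case
    proof (cases "\<exists>(a, k)\<in>tri n. k * (n + 2) + a = N")
      case False
      then show ?thesis using x by (intro exI[of _ x]) (auto simp: less_Suc_eq)
    next
      case True
      then obtain a l where al: "(a, l) \<in> tri n" "l * (n + 2) + a = N" by blast
      then obtain k where "l = Suc k" using tri_le by (cases l) fastforce+
      with al have ak: "(a, Suc k) \<in> tri n" "Suc k * (n + 2) + a = N" by simp_all
      have a1: "1 \<le> a" "a \<le> n + 1" using tri_le[OF ak(1)] by auto
      have nz: "minor x a k \<noteq> 0"
      proof (cases "k = 0")
        case False
        then have "(a, k) \<in> tri n" using ak(1) by (auto simp: tri_def)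
        then show ?thesis using x[of a k] ak(2) F by simp
      qed simp
      define v where "v = x (k, a + k) + (F (a, Suc k) - minor x a (Suc k)) / minor x a k"
      let ?x = "x((k, a + k) := v)"
      have "minor ?x a (Suc k) = F (a, Suc k)"
        using nz by (simp add: minor_upd_corner[OF a1(1)] v_def)
      moreover have "minor ?x b l = F (b, l)" if "(b, l) \<in> tri n" "l * (n + 2) + b < N" for b l
      proof -
        have "l \<le> k \<or> b + l \<le> a + k" using that ak(2) a1 by (intro key_order) auto
        then have "minor ?x b l = minor x b l" by (intro minor_upd_other) auto
        then show ?thesis using x that by simp
      qed
      moreover have "l = Suc k \<and> b = a" if "(b, l) \<in> tri n" "l * (n + 2) + b = N" for b l
        using key_inj[of l n b "Suc k" a] that ak tri_le[OF that(1)] a1 by auto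
      ultimately have "minor ?x b l = F (b, l)" if "(b, l) \<in> tri n" "l * (n + 2) + b < Suc N" for b l
        using that unfolding less_Suc_eq by blast
      then show ?thesis by blast
    qed
  qed auto
  then obtain x where x: "\<And>a k. (a, k) \<in> tri n \<Longrightarrow> k * (n + 2) + a < (n + 1) * (n + 2) \<Longrightarrow> minor x a k = F (a, k)"
    by blast
  have "k * (n + 2) + a < (n + 1) * (n + 2)" if "(a, k) \<in> tri n" for a k
  proof -
    have "k \<le> n" "a < n + 2" using tri_le[OF that] by auto
    then have "k * (n + 2) \<le> n * (n + 2)" by (intro mult_le_mono1)
    then show ?thesis using \<open>a < n + 2\<close> by simp
  qed
  then show ?thesis using that x by blast
qed

definition sg :: "(nat \<times> nat) set \<Rightarrow> nat \<times> nat \<Rightarrow> real" where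
  "sg c p = (if p \<in> c then - 1 else 1)"

lemma sg_sq [simp]: "sg c p * sg c p = 1" "sg c p \<noteq> 0" "sg c p * (sg c p * y) = y"
  by (auto simp: sg_def)

definition cell :: "nat \<Rightarrow> (nat \<times> nat) set \<Rightarrow> coords set" where
  "cell n c = {x. \<forall>(a, k)\<in>tri n. sg c (a, k) * minor x a k > 0}"

lemma cell_iff:
  assumes "c \<subseteq> tri n"
  shows "x \<in> cell n c \<longleftrightarrow> x \<in> torus n \<and> signs n x = c"
proof
  assume x: "x \<in> cell n c"
  have "(a, k) \<in> tri n \<Longrightarrow> minor x a k \<noteq> 0 \<and> (minor x a k < 0 \<longleftrightarrow> (a, k) \<in> c)" for a k
    using x by (fastforce simp: cell_def sg_def split: if_splits)
  then show "x \<in> torus n \<and> signs n x = c" using assms by (auto simp: torus_def signs_def)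
next
  assume "x \<in> torus n \<and> signs n x = c"
  then show "x \<in> cell n c" by (force simp: torus_def signs_def cell_def sg_def)
qed

text \<open>
  One sign condition is imposed at a time. Solving for the corner entry parametrizes the smaller set by
  the larger one: the new minor becomes plus or minus the exponential of the old free entry.
\<close>

lemma connected_cell: "connected (cell n c)"
proof -
  define W where "W N = {x. \<forall>(a, k)\<in>tri n. k * (n + 2) + a < N \<longrightarrow> sg c (a, k) * minor x a k > 0}" for N
  have "connected (W N)" for N
  proof (induction N)
    case 0
    have "W 0 = UNIV" by (auto simp: W_def)
    moreover have "connected (UNIV :: coords set)"
    proof -
      have "connected_component UNIV x y" for x y :: coords
        unfolding connected_component_def
      proof (intro exI[of _ "line x y ` UNIV"] conjI)
        have "continuous_on UNIV (line x y)"
          unfolding line_def by (intro continuous_on_coordinatewise_then_product continuous_intros)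
        then show "connected (line x y ` UNIV)" by (rule connected_continuous_image[OF _ connected_UNIV])
        show "x \<in> line x y ` UNIV" by (rule image_eqI[of _ _ 0]) (simp_all add: line_def)
        show "y \<in> line x y ` UNIV" by (rule image_eqI[of _ _ 1]) (simp_all add: line_def)
      qed (rule subset_UNIV)
      then show ?thesis unfolding connected_iff_connected_component by blast
    qed
    ultimately show ?case by simp
  next
    case (Suc N)
    show ?case
    proof (cases "\<exists>(a, k)\<in>tri n. k * (n + 2) + a = N")
      case False
      then have "W (Suc N) = W N" by (auto simp: W_def less_Suc_eq)
      then show ?thesis using Suc by simp
    next
      case True
      then obtain a l where al: "(a, l) \<in> tri n" "l * (n + 2) + a = N" by blast
      then obtain k where "l = Suc k" using tri_le by (cases l) fastforce+
      with al have ak: "(a, Suc k) \<in> tri n" "Suc k * (n + 2) + a = N" by simp_all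
      have a1: "1 \<le> a" "a \<le> n + 1" using tri_le[OF ak(1)] by auto
      let ?p = "(k, a + k)" and ?\<sigma> = "sg c (a, Suc k)"
      have nz: "minor x a k \<noteq> 0" if "x \<in> W N" for x
      proof (cases "k = 0")
        case False
        then have "(a, k) \<in> tri n" using ak(1) by (auto simp: tri_def)
        moreover have "k * (n + 2) + a < N" using ak(2) by simp
        ultimately have "sg c (a, k) * minor x a k > 0" using that unfolding W_def by blast
        then show ?thesis by auto
      qed simp
      have other: "minor (x(?p := v)) b l = minor x b l" if "(b, l) \<in> tri n" "l * (n + 2) + b < N" for x v b l
      proof -
        have "l \<le> k \<or> b + l \<le> a + k" using that ak(2) a1 by (intro key_order) auto
        then show ?thesis by (intro minor_upd_other) auto
      qed
      have low: "minor (x(?p := v)) a k = minor x a k" for x v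
        by (intro minor_upd_other) auto
      have W_upd: "x(?p := v) \<in> W N \<longleftrightarrow> x \<in> W N" for x v
      proof -
        have "sg c (b, l) * minor (x(?p := v)) b l = sg c (b, l) * minor x b l"
          if "(b, l) \<in> tri n" "l * (n + 2) + b < N" for b l
          using other[OF that] by simp
        then show ?thesis unfolding W_def by (auto simp del: mult_Suc_right)
      qed
      have only: "l = Suc k \<and> b = a" if "(b, l) \<in> tri n" "l * (n + 2) + b = N" for b l
        using key_inj[of l n b "Suc k" a] that ak tri_le[OF that(1)] a1 by auto
      have W_Suc: "x \<in> W (Suc N) \<longleftrightarrow> x \<in> W N \<and> ?\<sigma> * minor x a (Suc k) > 0" for x
      proof
        assume x: "x \<in> W (Suc N)"
        have "x \<in> W N" using x unfolding W_def less_Suc_eq by blast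
        moreover have "?\<sigma> * minor x a (Suc k) > 0"
          using x ak unfolding W_def by (auto dest!: bspec[where x = "(a, Suc k)"])
        ultimately show "x \<in> W N \<and> ?\<sigma> * minor x a (Suc k) > 0" by blast
      next
        assume x: "x \<in> W N \<and> ?\<sigma> * minor x a (Suc k) > 0"
        have "sg c (b, l) * minor x b l > 0" if "(b, l) \<in> tri n" "l * (n + 2) + b < Suc N" for b l
        proof (cases "l * (n + 2) + b = N")
          case True
          then have "l = Suc k" "b = a" using only[OF that(1)] by auto
          then show ?thesis using x by simp
        next
          case False
          then have "l * (n + 2) + b < N" using that(2) by simp
          then show ?thesis using x that(1) unfolding W_def by blast
        qed
        then show "x \<in> W (Suc N)" unfolding W_def by blast
      qed
      define \<theta> where "\<theta> x = x(?p := x ?p + (?\<sigma> * exp (x ?p) - minor x a (Suc k)) / minor x a k)" for x :: coords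
      have \<theta>: "minor (\<theta> x) a (Suc k) = ?\<sigma> * exp (x ?p)" if "x \<in> W N" for x
        using nz[OF that] by (simp add: \<theta>_def minor_upd_corner[OF a1(1)])
      have "W (Suc N) = \<theta> ` W N"
      proof (intro equalityI subsetI)
        fix y assume "y \<in> \<theta> ` W N"
        then obtain x where x: "x \<in> W N" "y = \<theta> x" by blast
        then have "y \<in> W N" by (simp add: \<theta>_def W_upd)
        then show "y \<in> W (Suc N)" using \<theta>[OF x(1)] x(2) by (simp add: W_Suc)
      next
        fix y assume y: "y \<in> W (Suc N)"
        then have yN: "y \<in> W N" and pos: "?\<sigma> * minor y a (Suc k) > 0" by (simp_all add: W_Suc)
        define x where "x = y(?p := ln (?\<sigma> * minor y a (Suc k)))"
        have "x \<in> W N" using yN by (simp add: x_def W_upd)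
        moreover have "\<theta> x = y"
        proof -
          have "x ?p + (?\<sigma> * exp (x ?p) - minor x a (Suc k)) / minor x a k = y ?p"
            using nz[OF yN] pos unfolding x_def low minor_upd_corner[OF a1(1)]
            by (simp add: field_simps)
          then show ?thesis unfolding \<theta>_def by (simp add: x_def)
        qed
        ultimately show "y \<in> \<theta> ` W N" by blast
      qed
      moreover have "continuous_on (W N) \<theta>"
      proof (rule continuous_on_coordinatewise_then_product)
        fix p
        show "continuous_on (W N) (\<lambda>x. \<theta> x p)"
          unfolding \<theta>_def using nz
          by (cases "p = ?p")
            (auto intro!: continuous_on_add continuous_on_divide continuous_on_diff continuous_on_mult
              continuous_on_const continuous_on_exp continuous_coord continuous_minor)
      qed
      ultimately show ?thesis using Suc by (simp add: connected_continuous_image)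
    qed
  qed
  moreover have "cell n c = W ((n + 1) * (n + 2))"
  proof -
    have "k * (n + 2) + a < (n + 1) * (n + 2)" if "(a, k) \<in> tri n" for a k
    proof -
      have "k \<le> n" "a < n + 2" using tri_le[OF that] by auto
      then have "k * (n + 2) \<le> n * (n + 2)" by (intro mult_le_mono1)
      then show ?thesis using \<open>a < n + 2\<close> by simp
    qed
    then show ?thesis unfolding cell_def W_def by blast
  qed
  ultimately show ?thesis by simp
qed

section \<open>Adjacent cells\<close>

lemma abs_sg [simp]: "\<bar>sg c p\<bar> = 1"
  by (simp add: sg_def)

lemma flow_connected:
  assumes x: "x \<in> Ucoords n" and i: "i < n"
    and nz: "\<And>u. 0 \<le> u \<Longrightarrow> u \<le> 1 \<Longrightarrow> minor (flow i (Suc i) (u * s) x) (Suc i) (n - i) \<noteq> 0"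
  shows "connected_component (Ucoords n) x (flow i (Suc i) s x)"
  unfolding connected_component_def
proof (intro exI[of _ "(\<lambda>u. flow i (Suc i) (u * s) x) ` {0..1}"] conjI)
  have "continuous_on {0..1} (\<lambda>u. flow i (Suc i) (u * s) x)"
  proof (rule continuous_on_coordinatewise_then_product)
    fix p :: "nat \<times> nat"
    show "continuous_on {0..1} (\<lambda>u. flow i (Suc i) (u * s) x p)"
      unfolding flow_def by (cases p; cases "snd p = Suc i") (auto intro!: continuous_intros)
  qed
  then show "connected ((\<lambda>u. flow i (Suc i) (u * s) x) ` {0..1})"
    by (rule connected_continuous_image) simp
  show "(\<lambda>u. flow i (Suc i) (u * s) x) ` {0..1} \<subseteq> Ucoords n"
  proof (intro image_subsetI)
    fix u :: real assume u: "u \<in> {0..1}"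
    show "flow i (Suc i) (u * s) x \<in> Ucoords n" unfolding Ucoords_def
    proof (intro CollectI ballI)
      fix k assume k: "k \<in> {1..n}"
      show "minor (flow i (Suc i) (u * s) x) (n + 1 - k) k \<noteq> 0"
      proof (cases "n + 1 - k = Suc i")
        case True
        then have "k = n - i" using k by auto
        then show ?thesis using nz[of u] u True by simp
      next
        case False
        then show ?thesis using x k by (auto simp: minor_flow_other Ucoords_def)
      qed
    qed
  qed
  show "x \<in> (\<lambda>u. flow i (Suc i) (u * s) x) ` {0..1}"
    by (rule image_eqI[of _ _ 0]) (auto simp: flow_def fun_eq_iff)
  show "flow i (Suc i) s x \<in> (\<lambda>u. flow i (Suc i) (u * s) x) ` {0..1}"
    by (rule image_eqI[of _ _ 1]) auto
qed

lemma abs_slope_bound: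
  assumes "\<And>l. l < m \<Longrightarrow> \<bar>r (Suc l) - r l\<bar> \<le> (1 :: real)"
  shows "\<bar>r m - r 0\<bar> \<le> real m"
  using assms
proof (induction m)
  case (Suc m)
  have "\<bar>r m - r 0\<bar> \<le> real m" using Suc by simp
  moreover have "\<bar>r (Suc m) - r m\<bar> \<le> 1" using Suc.prems by simp
  ultimately show ?case by linarith
qed simp

text \<open>
  All minors are given absolute value 1 except the one to be flipped, which is small. The two factorization
  parameters containing it are then large and, the vertex being lit, opposite, so its slope is far larger
  than all others in absolute value. Hence a column operation reaches the wall of this minor long before
  any other wall, and passes it.
\<close>

lemma adjacent_cells:
  assumes c: "c \<subseteq> tri n" and ik: "i + k + 2 \<le> n" and lit: "tri.lit c (Suc i, Suc k)"
  obtains x y where "x \<in> cell n c" "y \<in> cell n (tri.flip (Suc i, Suc k) c)"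
    "connected_component (Ucoords n) x y"
proof -
  \<comment> \<open>large enough for a slope of size at least \<open>L - n\<close> to exceed twice every other slope\<close>
  define L where "L = 4 * (real n + 1)"
  have L: "L > 0" by (simp add: L_def)
  let ?v = "(Suc i, Suc k)"
  define F where "F p = sg c p * (if p = ?v then 1 / L else 1)" for p
  have "F p \<noteq> 0" for p using L by (simp add: F_def)
  then obtain x where x: "\<And>a l. (a, l) \<in> tri n \<Longrightarrow> minor x a l = F (a, l)"
    using interpolation by metis
  have xc: "x \<in> cell n c" using x L by (auto simp: cell_def F_def)
  have xt: "x \<in> torus n" "signs n x = c" using xc cell_iff[OF c] by auto
  have i: "i < n" and top: "Suc k < n - i" using ik by auto
  let ?\<alpha> = "minor x (Suc i)" and ?\<rho> = "slope x i"
  have nz: "?\<alpha> l \<noteq> 0" if "l \<le> n - i" for l using that i by (intro torus_nonzero[OF xt(1)]) simp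
  have one: "\<bar>minor x a l\<bar> = 1" if "a + l \<le> n + 1" "(a, l) \<noteq> ?v" for a l
  proof (cases "a = 0 \<or> l = 0")
    case False
    then have "(a, l) \<in> tri n" using that by (auto simp: tri_def)
    then show ?thesis using x that by (auto simp: F_def abs_mult)
  qed auto
  have small: "\<bar>?\<alpha> (Suc k)\<bar> = 1 / L"
  proof -
    have "(Suc i, Suc k) \<in> tri n" using ik by (auto simp: tri_def)
    then show ?thesis using x L by (simp add: F_def abs_mult)
  qed
  have rim1: "\<bar>rim x i l\<bar> = 1" if "l < n - i" for l
  proof -
    have "\<bar>minor x i (Suc l)\<bar> = 1" "\<bar>minor x (Suc (Suc i)) l\<bar> = 1"
      using that by (auto intro!: one)
    then show ?thesis by (simp add: rim_def abs_mult)
  qed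
  have diff: "?\<rho> (Suc l) - ?\<rho> l = rim x i l / (?\<alpha> l * ?\<alpha> (Suc l))" if "l < n - i" for l
    using slope_step[of x i l] nz[of l] nz[of "Suc l"] that by (simp add: field_simps)
  have d1: "\<bar>?\<rho> (Suc l) - ?\<rho> l\<bar> \<le> 1" if "l < n - i" "l \<noteq> k" "l \<noteq> Suc k" for l
    using diff[OF that(1)] rim1[OF that(1)] one[of "Suc i" l] one[of "Suc i" "Suc l"] that
    by (simp add: abs_mult)
  have dk: "\<bar>?\<rho> (Suc k) - ?\<rho> k\<bar> = L" "\<bar>?\<rho> (Suc (Suc k)) - ?\<rho> (Suc k)\<bar> = L"
    using diff[of k] diff[of "Suc k"] rim1[of k] rim1[of "Suc k"] small one[of "Suc i" k]
      one[of "Suc i" "Suc (Suc k)"] top ik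
    by (simp_all add: abs_mult)
  have "(?\<rho> (Suc k) - ?\<rho> k) * (?\<rho> (Suc (Suc k)) - ?\<rho> (Suc k)) < 0"
  proof -
    have "?\<alpha> (Suc (Suc k)) * ?\<alpha> k * (rim x i (Suc k) * rim x i k) < 0"
      using lit_signs[OF xt(1) ik] lit xt(2) by simp
    also have "?\<alpha> (Suc (Suc k)) * ?\<alpha> k * (rim x i (Suc k) * rim x i k)
        = (?\<alpha> (Suc (Suc k)))\<^sup>2 * (?\<alpha> (Suc k))\<^sup>2 * (?\<alpha> k)\<^sup>2
          * ((?\<rho> (Suc k) - ?\<rho> k) * (?\<rho> (Suc (Suc k)) - ?\<rho> (Suc k)))"
      using nz top by (simp add: slope_step power2_eq_square)
    finally have "(?\<alpha> (Suc (Suc k)))\<^sup>2 * (?\<alpha> (Suc k))\<^sup>2 * (?\<alpha> k)\<^sup>2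
          * ((?\<rho> (Suc k) - ?\<rho> k) * (?\<rho> (Suc (Suc k)) - ?\<rho> (Suc k))) < 0" .
    moreover have "(?\<alpha> (Suc (Suc k)))\<^sup>2 * (?\<alpha> (Suc k))\<^sup>2 * (?\<alpha> k)\<^sup>2 > 0"
      using nz top by simp
    ultimately show ?thesis by (simp only: mult_less_0_iff) auto
  qed
  then have slope_back: "?\<rho> (Suc (Suc k)) = ?\<rho> k" using dk by (auto simp: mult_less_0_iff)
  have low: "\<bar>?\<rho> l\<bar> \<le> real l" if "l \<le> k" for l
    using abs_slope_bound[of l ?\<rho>] d1 that top by simp
  have high: "\<bar>?\<rho> (Suc (Suc k) + l)\<bar> \<le> real k + real l" if "Suc (Suc k) + l \<le> n - i" for l
  proof -
    have "\<bar>?\<rho> (Suc (Suc k) + l) - ?\<rho> (Suc (Suc k) + 0)\<bar> \<le> real l"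
      using abs_slope_bound[of l "\<lambda>l. ?\<rho> (Suc (Suc k) + l)"] d1 that by simp
    then show ?thesis using low[of k] slope_back by simp
  qed
  have bound: "\<bar>?\<rho> l\<bar> \<le> real n" if "l \<le> n - i" "l \<noteq> Suc k" for l
  proof (cases "l \<le> k")
    case True
    then show ?thesis using low[of l] that by simp
  next
    case False
    then have "Suc (Suc k) \<le> l" using that(2) by simp
    then obtain l' where "l = Suc (Suc k) + l'" using le_Suc_ex by blast
    then show ?thesis using high[of l'] that by simp
  qed
  have big: "\<bar>?\<rho> (Suc k)\<bar> \<ge> 3 * (real n + 1)"
  proof -
    have "real k \<le> real n" using ik by simp
    moreover have "L \<le> \<bar>?\<rho> (Suc k)\<bar> + \<bar>?\<rho> k\<bar>"
      using dk(1) abs_triangle_ineq4[of "?\<rho> (Suc k)" "?\<rho> k"] by simp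
    moreover have "\<bar>?\<rho> k\<bar> \<le> real k" by (rule low) simp
    ultimately show ?thesis unfolding L_def distrib_left by simp
  qed
  then have r0: "?\<rho> (Suc k) \<noteq> 0" by auto
  \<comment> \<open>twice the parameter of the wall, which turns the small minor into its negative\<close>
  define s where "s = - 2 / ?\<rho> (Suc k)"
  have s: "1 + s * ?\<rho> (Suc k) = - 1" using r0 by (simp add: s_def)
  have pos: "1 + u * s * ?\<rho> l > 0" if "0 \<le> u" "u \<le> 1" "l \<le> n - i" "l \<noteq> Suc k" for u l
  proof -
    have "\<bar>s * ?\<rho> l\<bar> = 2 * \<bar>?\<rho> l\<bar> / \<bar>?\<rho> (Suc k)\<bar>" by (simp add: s_def abs_mult)
    also have "\<dots> < 1" using bound[OF that(3,4)] big by (simp add: divide_less_eq)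
    finally have "\<bar>s * ?\<rho> l\<bar> < 1" .
    moreover have "\<bar>u * (s * ?\<rho> l)\<bar> \<le> \<bar>s * ?\<rho> l\<bar>"
      using that(1,2) by (simp add: abs_mult mult_left_le_one_le)
    ultimately show ?thesis by (simp add: mult.assoc)
  qed
  let ?y = "flow i (Suc i) s x"
  have my: "minor ?y (Suc i) l = ?\<alpha> l * (1 + s * ?\<rho> l)" if "l \<le> n - i" for l
    using minor_flow_slope[OF nz[OF that]] .
  have "?y \<in> cell n (tri.flip ?v c)"
  proof -
    have "sg (tri.flip ?v c) (a, l) * minor ?y a l > 0" if al: "(a, l) \<in> tri n" for a l
    proof -
      have p: "sg c (a, l) * minor x a l > 0" using xc al by (auto simp: cell_def)
      show ?thesis
      proof (cases "a = Suc i")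
        case False
        then show ?thesis using p by (auto simp: minor_flow_other sg_def tri.mem_flip)
      next
        case True
        then have l: "l \<le> n - i" using al by (auto simp: tri_def)
        show ?thesis
        proof (cases "l = Suc k")
          case False
          have "sg (tri.flip ?v c) (a, l) = sg c (a, l)" using False by (auto simp: sg_def tri.mem_flip)
          then have "sg (tri.flip ?v c) (a, l) * minor ?y a l = (sg c (a, l) * minor x a l) * (1 + s * ?\<rho> l)"
            using my[OF l] True by simp
          then show ?thesis using p pos[of 1 l] l False by simp
        next
          case lk: True
          have "sg (tri.flip ?v c) (a, l) = - sg c (a, l)"
            using True lk by (auto simp: sg_def tri.mem_flip)
          then show ?thesis using my[OF l] p True lk s by simp
        qed
      qed
    qed
    then show ?thesis by (auto simp: cell_def)
  qed
  moreover have "connected_component (Ucoords n) x ?y"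
  proof (rule flow_connected[OF _ i])
    show "x \<in> Ucoords n" using xt(1) torus_subset_U by blast
    fix u :: real assume u: "0 \<le> u" "u \<le> 1"
    show "minor (flow i (Suc i) (u * s) x) (Suc i) (n - i) \<noteq> 0"
      using minor_flow_slope[OF nz[of "n - i"], of "u * s"] nz[of "n - i"] pos[OF u, of "n - i"] top
      by simp
  qed
  ultimately show ?thesis using that xc by blast
qed

lemma cell_nonempty: "\<exists>x. x \<in> cell n c"
proof -
  obtain x where "\<And>a l. (a, l) \<in> tri n \<Longrightarrow> minor x a l = sg c (a, l)"
    using interpolation[of "sg c" n] by auto
  then show ?thesis by (auto simp: cell_def intro!: exI[of _ x])
qed

lemma cell_subset_U: "cell n c \<subseteq> Ucoords n"
proof -
  have "cell n c \<subseteq> torus n" by (force simp: cell_def torus_def)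
  then show ?thesis using torus_subset_U by blast
qed

lemma reach_connected:
  assumes "tri.reach (mutable n) c c'" "c \<subseteq> tri n" "x \<in> cell n c" "y \<in> cell n c'"
  shows "connected_component (Ucoords n) x y"
  using assms(1,4)
proof (induction arbitrary: y rule: rtranclp_induct)
  case base
  then show ?case
    using connected_cell[of n c] cell_subset_U[of n c] assms(3) unfolding connected_component_def by blast
next
  case (step d e)
  have d: "d \<subseteq> tri n" using step.hyps(1) assms(2) cls_subset_states[of c n] by (auto simp: cls_def)
  obtain v where v: "v \<in> mutable n" "tri.lit d v" "e = tri.flip v d" using step.hyps(2) by (auto simp: tri.step_def)
  obtain i k where ik: "v = (Suc i, Suc k)" "i + k + 2 \<le> n"
    using v(1) by (cases v; cases "fst v"; cases "snd v") (auto simp: mutable_def)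
  obtain x' y' where xy: "x' \<in> cell n d" "y' \<in> cell n e" "connected_component (Ucoords n) x' y'"
    using adjacent_cells[OF d ik(2)] v(2,3) ik(1) by metis
  have "connected_component (Ucoords n) x x'" by (rule step.IH[OF xy(1)])
  moreover have "connected_component (Ucoords n) y' y"
    using connected_cell[of n e] cell_subset_U[of n e] xy(2) step.prems unfolding connected_component_def by blast
  ultimately show ?case using xy(3) connected_component_trans by metis
qed

section \<open>Local constancy of the class\<close>

text \<open>
  The points near which all points with nonvanishing minors have their signs in the class \<open>O'\<close>. Unlike the
  class itself this makes sense at points where several minors vanish.
\<close>

definition region :: "nat \<Rightarrow> (nat \<times> nat) set set \<Rightarrow> coords set" where
  "region n O' = {x. \<forall>\<^sub>F a in nhds x. a \<in> torus n \<longrightarrow> cls n (signs n a) = O'}"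

text \<open>
  The points of \<open>torus n\<close> with distinct slopes, written without division so that the condition is polynomial.
\<close>

definition generic :: "nat \<Rightarrow> nat \<Rightarrow> coords set" where
  "generic n i = {x \<in> torus n. \<forall>j\<in>{1..<n - i}. \<forall>k\<in>{1..<n - i}. j \<noteq> k \<longrightarrow>
     gap_minor x i j * minor x (Suc i) k - gap_minor x i k * minor x (Suc i) j \<noteq> 0}"

lemma generic_slope:
  assumes "x \<in> generic n i" "i < n" "j \<in> {1..<n - i}" "k \<in> {1..<n - i}" "j \<noteq> k"
  shows "slope x i j \<noteq> slope x i k"
proof -
  have "x \<in> torus n" "Suc i + j \<le> n + 1" "Suc i + k \<le> n + 1" using assms by (auto simp: generic_def)
  then have "minor x (Suc i) j \<noteq> 0" "minor x (Suc i) k \<noteq> 0"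
    using torus_nonzero by blast+
  then show ?thesis using assms by (auto simp: generic_def slope_def frac_eq_eq)
qed

text \<open>
  A single point suffices: where all minors equal 1, the slopes are 0, 1, 2 and so on.
\<close>

lemma generic_dense:
  assumes "open T" "x \<in> T" "i < n"
  shows "\<exists>z\<in>T. z \<in> generic n i"
proof -
  define I where "I = {(j, k). j \<in> {1..<n - i} \<and> k \<in> {1..<n - i} \<and> j \<noteq> k}"
  have fI: "finite I" by (rule finite_subset[of _ "{1..<n - i} \<times> {1..<n - i}"]) (auto simp: I_def)
  define G where "G z = (\<Prod>p\<in>tri n. minor z (fst p) (snd p)) * (\<Prod>p\<in>I.
     gap_minor z i (fst p) * minor z (Suc i) (snd p) - gap_minor z i (snd p) * minor z (Suc i) (fst p))" for z
  have G: "G z \<noteq> 0 \<longleftrightarrow> z \<in> generic n i" for z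
  proof -
    define X where "X j k = gap_minor z i j * minor z (Suc i) k - gap_minor z i k * minor z (Suc i) j" for j k
    have "G z \<noteq> 0 \<longleftrightarrow> (\<forall>p\<in>tri n. minor z (fst p) (snd p) \<noteq> 0) \<and> (\<forall>p\<in>I. X (fst p) (snd p) \<noteq> 0)"
      using fI by (simp add: G_def X_def prod_zero_iff)
    also have "(\<forall>p\<in>tri n. minor z (fst p) (snd p) \<noteq> 0) \<longleftrightarrow> z \<in> torus n"
      by (simp add: torus_def case_prod_beta)
    also have "(\<forall>p\<in>I. X (fst p) (snd p) \<noteq> 0) \<longleftrightarrow>
        (\<forall>j\<in>{1..<n - i}. \<forall>k\<in>{1..<n - i}. j \<noteq> k \<longrightarrow> X j k \<noteq> 0)"
      unfolding I_def by force
    finally show ?thesis by (simp add: generic_def X_def)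
  qed
  have "linepoly G"
    unfolding G_def by (intro linepoly_mult linepoly_prod linepoly_diff linepoly_minor linepoly_gap_minor)
  obtain y where y: "\<And>a k. (a, k) \<in> tri n \<Longrightarrow> minor y a k = 1"
    using interpolation[of "\<lambda>_. 1" n] by auto
  then have yt: "y \<in> torus n" by (auto simp: torus_def)
  have y1: "minor y a k = 1" if "a + k \<le> n + 1" for a k
    using y that by (cases "a = 0 \<or> k = 0") (auto simp: tri_def)
  have "slope y i k = real k" if "k \<le> n - i" for k
    using that
  proof (induction k)
    case (Suc k)
    have "rim y i k = 1" using Suc.prems assms(3) by (simp add: rim_def y1)
    then show ?case using slope_step[of y i k] Suc assms(3) by (simp add: y1)
  qed simp
  note slope = this
  have "gap_minor y i k = real k" if "k \<le> n - i" for k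
  proof -
    have "minor y (Suc i) k = 1" using that assms(3) by (intro y1) simp
    then show ?thesis using slope[OF that] by (simp add: slope_def)
  qed
  then have "y \<in> generic n i" using yt y1 assms(3) by (auto simp: generic_def)
  then show ?thesis using linepoly_dense[OF \<open>linepoly G\<close> _ assms(1,2), of y] G by blast
qed

lemma torus_dense: "open T \<Longrightarrow> x \<in> T \<Longrightarrow> \<exists>z\<in>T. z \<in> torus n"
proof (cases "n = 0")
  case True
  assume "x \<in> T"
  then show ?thesis using True by (auto simp: torus_def tri_def)
next
  case False
  assume "open T" "x \<in> T"
  then show ?thesis using generic_dense[of T x 0 n] False by (auto simp: generic_def)
qed

lemma open_cell: "open (cell n c)"
proof -
  have "cell n c = (\<Inter>p\<in>tri n. {x. 0 < sg c p * minor x (fst p) (snd p)})"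
    by (auto simp: cell_def case_prod_beta)
  then show ?thesis
    by (auto intro!: open_INT open_Collect_less continuous_on_mult continuous_on_const continuous_minor)
qed

lemma torus_in_region:
  assumes "a \<in> torus n" shows "a \<in> region n (cls n (signs n a))"
proof -
  have a: "a \<in> cell n (signs n a)" using cell_iff[OF signs_subset] assms by blast
  have "\<forall>\<^sub>F b in nhds a. b \<in> cell n (signs n a)"
    unfolding eventually_nhds using open_cell a by blast
  then show ?thesis unfolding region_def
    by (auto elim!: eventually_mono simp: cell_iff[OF signs_subset])
qed

lemma eventually_nhds_pull:
  fixes h :: "'a::topological_space \<Rightarrow> 'b::topological_space"
  assumes "\<forall>\<^sub>F z in nhds (h z0). P z" "continuous_on UNIV h"
  shows "\<forall>\<^sub>F p in nhds z0. P (h p)"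
proof -
  obtain T where T: "open T" "h z0 \<in> T" "\<forall>z\<in>T. P z" using assms(1) unfolding eventually_nhds by blast
  then show ?thesis unfolding eventually_nhds
    using open_vimage[OF T(1) assms(2)] by (intro exI[of _ "h -` T"]) auto
qed

lemma eventually_in_open: "open T \<Longrightarrow> x \<in> T \<Longrightarrow> \<forall>\<^sub>F y in nhds x. y \<in> T"
  unfolding eventually_nhds by blast

lemma open_region: "open (region n O')"
proof (subst open_subopen, intro ballI)
  fix x assume "x \<in> region n O'"
  then obtain S where S: "open S" "x \<in> S" "\<forall>a\<in>S. a \<in> torus n \<longrightarrow> cls n (signs n a) = O'"
    by (auto simp: region_def eventually_nhds)
  then have "S \<subseteq> region n O'" by (auto simp: region_def eventually_nhds intro!: exI[of _ S])
  with S(1,2) show "\<exists>T. open T \<and> x \<in> T \<and> T \<subseteq> region n O'" by blast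
qed

lemma continuous_flow:
  assumes "continuous_on UNIV f" "continuous_on UNIV g"
  shows "continuous_on UNIV (\<lambda>z. flow i j (f z) (g z))"
proof (rule continuous_on_coordinatewise_then_product)
  fix p :: "nat \<times> nat"
  obtain r c where p: "p = (r, c)" by force
  have g: "continuous_on UNIV (\<lambda>z. g z q)" for q
    using assms(2) by (rule continuous_on_product_then_coordinatewise)
  have "continuous_on UNIV (\<lambda>z. ent (g z) r i)"
    unfolding ent_def using g by (cases "r < i"; cases "r = i") (auto intro: continuous_on_const)
  then show "continuous_on UNIV (\<lambda>z. flow i j (f z) (g z) p)"
    unfolding flow_def p using g assms(1) by (cases "c = j") (auto intro!: continuous_intros)
qed

lemma ent_flow: "i < j \<Longrightarrow> ent (flow i j s x) r c = ent x r c + (if c = j then s * ent x r i else 0)"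
  by (auto simp: flow_def ent_def)

lemma flow_0 [simp]: "flow i j 0 x = x"
  by (auto simp: flow_def fun_eq_iff)

lemma flow_flow: "i < j \<Longrightarrow> flow i j s (flow i j t x) = flow i j (s + t) x"
  by (auto simp: flow_def fun_eq_iff ent_def algebra_simps)

text \<open>
  Elementary matrices for columns further apart are commutators, so column operations between
  neighbouring columns generate all of them.
\<close>

lemma flow_commutator:
  assumes "i < j" "j < k"
  shows "flow j k (- t) (flow i j (- r) (flow j k t (flow i j r x))) = flow i k (r * t) x"
proof
  fix p :: "nat \<times> nat"
  obtain a c where p: "p = (a, c)" by force
  have f: "flow i j s x (a, c) = x (a, c) + (if c = j then s * ent x a i else 0)" for i j s x
    by (simp add: flow_def)
  show "flow j k (- t) (flow i j (- r) (flow j k t (flow i j r x))) p = flow i k (r * t) x p"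
    unfolding p f using assms by (simp add: ent_flow f algebra_simps)
qed

text \<open>
  Small column operations from \<open>i\<close> to \<open>j\<close> near \<open>q\<close> do not leave any region. Quantifying over the class inside
  the filter makes the neighbourhood independent of the class.
\<close>

definition good :: "nat \<Rightarrow> coords \<Rightarrow> nat \<Rightarrow> nat \<Rightarrow> bool" where
  "good n q i j \<longleftrightarrow> (\<forall>\<^sub>F p in nhds (q, 0 :: real). \<forall>O'.
     fst p \<in> region n O' \<longrightarrow> flow i j (snd p) (fst p) \<in> region n O')"

lemma crossing_cls:
  assumes x: "x \<in> generic n i" and i: "i < n" and y: "flow i (Suc i) s x \<in> torus n"
    and D: "minor x (Suc i) (n - i) * minor (flow i (Suc i) s x) (Suc i) (n - i) > 0"
  shows "cls n (signs n x) = cls n (signs n (flow i (Suc i) s x))"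
proof -
  have xt: "x \<in> torus n" using x by (simp add: generic_def)
  have nz: "minor x (Suc i) j \<noteq> 0" if "j \<le> n - i" for j using that i by (intro torus_nonzero[OF xt]) simp
  have "tri.reach (mutable n) (signs n x) (signs n (flow i (Suc i) s x))"
  proof (rule crossing[OF xt i])
    show "slope x i j \<noteq> slope x i k" if "j \<in> {1..<n - i}" "k \<in> {1..<n - i}" "j \<noteq> k" for j k
      using generic_slope[OF x i that] .
    show "1 + s * slope x i j \<noteq> 0" if "j \<in> {1..n - i}" for j
    proof -
      have "minor (flow i (Suc i) s x) (Suc i) j \<noteq> 0"
        using that i by (intro torus_nonzero[OF y]) auto
      then show ?thesis using minor_flow_slope[OF nz[of j], of s] that by auto
    qed
    have "minor x (Suc i) (n - i) * (minor x (Suc i) (n - i) * (1 + s * slope x i (n - i))) > 0"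
      using D minor_flow_slope[OF nz[of "n - i"], of s] by simp
    then have "(minor x (Suc i) (n - i))\<^sup>2 * (1 + s * slope x i (n - i)) > 0"
      by (simp add: power2_eq_square mult.assoc)
    then show "1 + s * slope x i (n - i) > 0" by (simp add: zero_less_mult_iff)
  qed
  then show ?thesis by (simp add: cls_eq_iff)
qed

text \<open>
  The starting point may be deep inside several walls, and so may the end point. A generic point near
  the starting point is used instead; the density of such points transports the statement. The only
  \<open>D\<^sub>k\<close> that varies keeps its sign in a neighbourhood of \<open>q\<close>.
\<close>

lemma good_simple:
  assumes q: "q \<in> Ucoords n" and i: "i < n"
  shows "good n q i (Suc i)"
proof -
  let ?D = "\<lambda>a. minor a (Suc i) (n - i)"
  define S where "S = {a. 0 < ?D a * ?D q}"
  have "?D q \<noteq> 0"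
  proof -
    have "n - i \<in> {1..n}" "n + 1 - (n - i) = Suc i" using i by auto
    then show ?thesis using q unfolding Ucoords_def by (metis (mono_tags, lifting) mem_Collect_eq)
  qed
  then have S: "open S" "q \<in> S"
  proof -
    show "open S" unfolding S_def
      by (intro open_Collect_less continuous_on_mult continuous_on_const continuous_minor)
    show "q \<in> S" using \<open>?D q \<noteq> 0\<close> by (auto simp: S_def zero_less_mult_iff)
  qed
  have cf: "continuous_on UNIV (\<lambda>p. flow i (Suc i) (snd p) (fst p))"
    by (intro continuous_flow continuous_on_fst continuous_on_snd continuous_on_id)
  have "\<forall>\<^sub>F p in nhds (q, 0 :: real). fst p \<in> S"
    using eventually_nhds_pull[of "\<lambda>z. z \<in> S" fst "(q, 0)"] eventually_in_open[OF S]
    by (simp add: continuous_on_fst continuous_on_id)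
  moreover have "\<forall>\<^sub>F p in nhds (q, 0 :: real). flow i (Suc i) (snd p) (fst p) \<in> S"
    using eventually_nhds_pull[of "\<lambda>z. z \<in> S" "\<lambda>p. flow i (Suc i) (snd p) (fst p)" "(q, 0)"]
      eventually_in_open[OF S] cf by simp
  ultimately have "\<forall>\<^sub>F p in nhds (q, 0 :: real). fst p \<in> S \<and> flow i (Suc i) (snd p) (fst p) \<in> S"
    by (rule eventually_conj)
  then show ?thesis unfolding good_def
  proof (rule eventually_mono, intro allI impI)
    fix p O' assume p: "fst p \<in> S \<and> flow i (Suc i) (snd p) (fst p) \<in> S" "fst p \<in> region n O'"
    define a s where "a = fst p" and "s = snd p"
    have a: "a \<in> S" "flow i (Suc i) s a \<in> S" "a \<in> region n O'" using p by (simp_all add: a_def s_def)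
    have cs: "continuous_on UNIV (flow i (Suc i) t)" for t
      by (intro continuous_flow[where f = "\<lambda>_. t"] continuous_on_const continuous_on_id)
    obtain N where N: "open N" "a \<in> N" "\<And>c. c \<in> N \<Longrightarrow> c \<in> torus n \<Longrightarrow> cls n (signs n c) = O'"
      using a(3) unfolding region_def eventually_nhds by auto
    define T where "T = {b. flow i (Suc i) (- s) b \<in> N \<inter> S} \<inter> S"
    have T: "open T" "flow i (Suc i) s a \<in> T"
      using open_vimage[OF open_Int[OF N(1) S(1)] cs[of "- s"]] S(1) a N(2)
      by (auto simp: T_def flow_flow vimage_def)
    have "cls n (signs n b) = O'" if b: "b \<in> T" "b \<in> torus n" for b
    proof -
      let ?T = "T \<inter> cell n (signs n b)"
      have bT: "open ?T" "b \<in> ?T" using T(1) open_cell b cell_iff[OF signs_subset] by auto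
      have "open (flow i (Suc i) s -` ?T)" by (rule open_vimage[OF bT(1) cs])
      moreover have "flow i (Suc i) (- s) b \<in> flow i (Suc i) s -` ?T" using bT(2) by (simp add: flow_flow)
      ultimately obtain c where c: "c \<in> generic n i" "flow i (Suc i) s c \<in> ?T"
        using generic_dense[OF _ _ i] by (metis vimageD)
      have cb: "flow i (Suc i) s c \<in> torus n" "signs n (flow i (Suc i) s c) = signs n b"
        using c(2) cell_iff[OF signs_subset] by auto
      have "flow i (Suc i) (- s) (flow i (Suc i) s c) \<in> N \<inter> S" using c(2) by (simp add: T_def)
      then have cN: "c \<in> N" "c \<in> S" by (simp_all add: flow_flow)
      have "flow i (Suc i) s c \<in> S" using c(2) by (simp add: T_def)
      then have "?D c * ?D (flow i (Suc i) s c) > 0"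
        using cN(2) by (auto simp: S_def zero_less_mult_iff)
      then have "cls n (signs n c) = cls n (signs n b)"
        using crossing_cls[OF c(1) i cb(1)] cb(2) by simp
      then show ?thesis using N(3)[OF cN(1)] c(1) by (simp add: generic_def)
    qed
    then show "flow i (Suc i) (snd p) (fst p) \<in> region n O'"
      unfolding region_def eventually_nhds using T by (auto simp: a_def s_def)
  qed
qed

lemma good_pull:
  fixes h :: "'a::topological_space \<Rightarrow> coords \<times> real"
  assumes "good n q i j" "continuous_on UNIV h" "h z0 = (q, 0)"
  shows "\<forall>\<^sub>F z in nhds z0. \<forall>O'. fst (h z) \<in> region n O' \<longrightarrow> flow i j (snd (h z)) (fst (h z)) \<in> region n O'"
  by (rule eventually_nhds_pull[where h = h]) (use assms in \<open>simp_all add: good_def\<close>)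

text \<open>
  The parameter \<open>s\<close> of the commutator is distributed as \<open>sqrt \<bar>s\<bar> * sqrt s\<close>, a product of two continuous
  functions vanishing at 0 since the square root of a negative real is minus that of its absolute value.
\<close>

lemma good_trans:
  assumes ij: "i < j" "j < k" and good: "good n q i j" "good n q j k"
  shows "good n q i k"
proof -
  define r where "r p = sqrt \<bar>snd p\<bar>" for p :: "coords \<times> real"
  define t where "t p = sqrt (snd p)" for p :: "coords \<times> real"
  define a1 where "a1 p = flow i j (r p) (fst p)" for p
  define a2 where "a2 p = flow j k (t p) (a1 p)" for p
  define a3 where "a3 p = flow i j (- r p) (a2 p)" for p
  have c: "continuous_on UNIV r" "continuous_on UNIV t"
    unfolding r_def t_def by (auto intro!: continuous_intros)
  have c1: "continuous_on UNIV a1"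
    unfolding a1_def by (intro continuous_flow c continuous_on_fst continuous_on_id)
  have c2: "continuous_on UNIV a2" unfolding a2_def by (intro continuous_flow c c1)
  have c3: "continuous_on UNIV a3"
    unfolding a3_def by (intro continuous_flow continuous_on_minus c c2)
  have z: "r (q, 0) = 0" "t (q, 0) = 0" "a1 (q, 0) = q" "a2 (q, 0) = q" "a3 (q, 0) = q"
    by (simp_all add: r_def t_def a1_def a2_def a3_def)
  have 1: "\<forall>\<^sub>F p in nhds (q, 0). \<forall>O'. fst p \<in> region n O' \<longrightarrow> a1 p \<in> region n O'"
    using good_pull[OF good(1), of "\<lambda>p. (fst p, r p)" "(q, 0)"] z c
    by (simp add: a1_def continuous_on_Pair continuous_on_fst continuous_on_id)
  have 2: "\<forall>\<^sub>F p in nhds (q, 0). \<forall>O'. a1 p \<in> region n O' \<longrightarrow> a2 p \<in> region n O'"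
    using good_pull[OF good(2), of "\<lambda>p. (a1 p, t p)" "(q, 0)"] z c c1
    by (simp add: a2_def continuous_on_Pair)
  have 3: "\<forall>\<^sub>F p in nhds (q, 0). \<forall>O'. a2 p \<in> region n O' \<longrightarrow> a3 p \<in> region n O'"
    using good_pull[OF good(1), of "\<lambda>p. (a2 p, - r p)" "(q, 0)"] z c c2
    by (simp add: a3_def continuous_on_Pair continuous_on_minus)
  have 4: "\<forall>\<^sub>F p in nhds (q, 0). \<forall>O'. a3 p \<in> region n O' \<longrightarrow> flow j k (- t p) (a3 p) \<in> region n O'"
    using good_pull[OF good(2), of "\<lambda>p. (a3 p, - t p)" "(q, 0)"] z c c3
    by (simp add: continuous_on_Pair continuous_on_minus)
  have rt: "r p * t p = snd p" for p
    by (cases "snd p \<ge> 0") (auto simp: r_def t_def real_sqrt_minus)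
  have "flow j k (- t p) (a3 p) = flow i k (snd p) (fst p)" for p
    unfolding a3_def a2_def a1_def flow_commutator[OF ij] rt ..
  with 4 have "\<forall>\<^sub>F p in nhds (q, 0). \<forall>O'. a3 p \<in> region n O' \<longrightarrow> flow i k (snd p) (fst p) \<in> region n O'"
    by simp
  with 1 2 3 show ?thesis unfolding good_def by eventually_elim blast
qed

lemma good_all:
  assumes q: "q \<in> Ucoords n" and "i < j" "j \<le> n"
  shows "good n q i j"
  using assms(2,3)
proof (induction j)
  case (Suc j)
  show ?case
  proof (cases "i = j")
    case True
    then show ?thesis using good_simple[OF q] Suc.prems by simp
  next
    case False
    then have "good n q i j" "good n q j (Suc j)" "i < j"
      using Suc good_simple[OF q, of j] by auto
    then show ?thesis using good_trans[of i j "Suc j"] by simp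
  qed
qed simp

text \<open>
  Coordinates on or below the diagonal and beyond the matrix do not matter.
\<close>

lemma region_cong:
  assumes agree: "\<And>r c. r < c \<Longrightarrow> c \<le> n \<Longrightarrow> a (r, c) = b (r, c)" and a: "a \<in> region n O'"
  shows "b \<in> region n O'"
proof -
  define h where "h y = (\<lambda>(r, c). if r < c \<and> c \<le> n then y (r, c) else a (r, c))" for y :: coords
  have "h b = a" using agree by (auto simp: h_def fun_eq_iff)
  moreover have "continuous_on UNIV h"
  proof (rule continuous_on_coordinatewise_then_product)
    fix p :: "nat \<times> nat"
    show "continuous_on UNIV (\<lambda>y. h y p)"
      unfolding h_def by (cases p; cases "fst p < snd p \<and> snd p \<le> n")
        (auto intro: continuous_coord continuous_on_const)
  qed
  ultimately have ev: "\<forall>\<^sub>F y in nhds b. h y \<in> torus n \<longrightarrow> cls n (signs n (h y)) = O'"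
    using eventually_nhds_pull[of "\<lambda>z. z \<in> torus n \<longrightarrow> cls n (signs n z) = O'" h b] a
    by (simp add: region_def)
  have m: "minor (h y) d k = minor y d k" if "(d, k) \<in> tri n" for y d k
    using that by (intro minor_upd_irrelevant) (auto simp: h_def tri_def)
  have "h y \<in> torus n \<longleftrightarrow> y \<in> torus n" "signs n (h y) = signs n y" for y
    using m by (auto simp: torus_def signs_def)
  with ev show ?thesis by (simp add: region_def)
qed

text \<open>
  A point \<open>a\<close> close to \<open>q\<close> is turned into \<open>q\<close> by correcting one entry after another with small column
  operations, none of which leaves the region of \<open>a\<close>. The corrections run through the columns from the
  last to the first and upwards within a column, since an operation into column \<open>c\<close> with source \<open>r\<close> changes
  only entries of that column in rows up to \<open>r\<close>.
\<close>

lemma region_closed: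
  assumes q: "q \<in> Ucoords n"
  shows "\<forall>\<^sub>F a in nhds q. \<forall>O'. a \<in> region n O' \<longrightarrow> q \<in> region n O'"
proof -
  define agree where "agree N a \<longleftrightarrow> (\<forall>r c. r < c \<longrightarrow> c \<le> n \<longrightarrow> N \<le> c * (n + 2) + r \<longrightarrow> a (r, c) = q (r, c))"
    for N and a :: coords
  have "\<forall>\<^sub>F a in nhds q. \<forall>O'. a \<in> region n O' \<longrightarrow> agree N a \<longrightarrow> q \<in> region n O'" for N
  proof (induction N)
    case 0
    show ?case
      by (intro always_eventually allI impI) (rule region_cong, auto simp: agree_def)
  next
    case (Suc N)
    show ?case
    proof (cases "\<exists>r c. r < c \<and> c \<le> n \<and> c * (n + 2) + r = N")
      case False
      have "agree (Suc N) a \<Longrightarrow> agree N a" for a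
        using False unfolding agree_def by (metis le_neq_implies_less Suc_leI)
      then show ?thesis using Suc by (auto elim!: eventually_mono)
    next
      case True
      then obtain r c where rc: "r < c" "c \<le> n" "c * (n + 2) + r = N" by blast
      define adj where "adj a = flow r c (q (r, c) - a (r, c)) a" for a
      have cadj: "continuous_on UNIV (\<lambda>a :: coords. q (r, c) - a (r, c))"
        by (intro continuous_on_diff continuous_on_const continuous_coord)
      have "\<forall>\<^sub>F a in nhds q. \<forall>O'. a \<in> region n O' \<longrightarrow> adj a \<in> region n O'"
        using good_pull[OF good_all[OF q rc(1,2)], of "\<lambda>a. (a, q (r, c) - a (r, c))" q] cadj
        by (simp add: adj_def continuous_on_Pair continuous_on_id)
      note E1 = this
      have E2: "\<forall>\<^sub>F a in nhds q. \<forall>O'. adj a \<in> region n O' \<longrightarrow> agree N (adj a) \<longrightarrow> q \<in> region n O'"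
      proof (rule eventually_nhds_pull[where h = adj])
        show "continuous_on UNIV adj" unfolding adj_def by (intro continuous_flow cadj continuous_on_id)
        show "\<forall>\<^sub>F z in nhds (adj q). \<forall>O'. z \<in> region n O' \<longrightarrow> agree N z \<longrightarrow> q \<in> region n O'"
          using Suc by (simp add: adj_def)
      qed
      have adj: "agree N (adj a)" if "agree (Suc N) a" for a
        unfolding agree_def
      proof (intro allI impI)
        fix r' c' assume *: "r' < c'" "c' \<le> n" "N \<le> c' * (n + 2) + r'"
        show "adj a (r', c') = q (r', c')"
        proof (cases "c' * (n + 2) + r' = N")
          case True
          then have "c' = c" "r' = r" using key_inj[of c' n r' c r] rc * by auto
          then show ?thesis by (simp add: adj_def flow_def ent_def)
        next
          case False
          then have "a (r', c') = q (r', c')" using that * unfolding agree_def by simp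
          moreover have "ent a r' r = 0" if "c' = c"
            using False * rc that by (simp add: ent_def)
          ultimately show ?thesis by (auto simp: adj_def flow_def)
        qed
      qed
      from E1 E2 show ?thesis
      proof eventually_elim
        case (elim a)
        then show ?case using adj by blast
      qed
    qed
  qed
  note closed = this[of "(n + 1) * (n + 2)"]
  have all: "agree ((n + 1) * (n + 2)) a" for a
    unfolding agree_def
  proof (intro allI impI)
    fix r c assume *: "r < c" "c \<le> n" "(n + 1) * (n + 2) \<le> c * (n + 2) + r"
    have "c * (n + 2) \<le> n * (n + 2)" using *(2) by (rule mult_le_mono1)
    then show "a (r, c) = q (r, c)" using * by simp
  qed
  show ?thesis using closed by (simp only: all simp_thms)
qed

lemma region_cover:
  assumes "q \<in> Ucoords n"
  shows "\<exists>c. c \<subseteq> tri n \<and> q \<in> region n (cls n c)"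
proof -
  obtain T where T: "open T" "q \<in> T" "\<And>a O'. a \<in> T \<Longrightarrow> a \<in> region n O' \<Longrightarrow> q \<in> region n O'"
    using region_closed[OF assms] unfolding eventually_nhds by blast
  obtain a where a: "a \<in> T" "a \<in> torus n" using torus_dense[OF T(1,2)] by blast
  have "q \<in> region n (cls n (signs n a))" by (rule T(3)[OF a(1) torus_in_region[OF a(2)]])
  then show ?thesis using signs_subset[of n a] by (intro exI[of _ "signs n a"] conjI)
qed

lemma region_disjoint:
  assumes "q \<in> region n O1" "q \<in> region n O2" shows "O1 = O2"
proof -
  have "\<forall>\<^sub>F a in nhds q. a \<in> torus n \<longrightarrow> cls n (signs n a) = O1 \<and> cls n (signs n a) = O2"
    using assms unfolding region_def by (auto elim: eventually_elim2)
  then obtain T where T: "open T" "q \<in> T" "\<And>a. a \<in> T \<Longrightarrow> a \<in> torus n \<Longrightarrow> O1 = O2"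
    unfolding eventually_nhds by auto
  then show ?thesis using torus_dense by blast
qed

text \<open>
  The cells of one class lie in one component of the whole space, that component cannot leave the region
  because the regions are open and disjoint, and it is dense in the region.
\<close>

lemma region_connected:
  assumes c: "c \<subseteq> tri n"
  shows "connected (region n (cls n c) \<inter> Ucoords n)" "region n (cls n c) \<inter> Ucoords n \<noteq> {}"
proof -
  let ?R = "region n (cls n c)"
  obtain x where x: "x \<in> cell n c" using cell_nonempty by blast
  then have xt: "x \<in> torus n" "signs n x = c" using cell_iff[OF c] by auto
  then have xR: "x \<in> ?R" "x \<in> Ucoords n" using torus_in_region torus_subset_U by auto
  then show "?R \<inter> Ucoords n \<noteq> {}" by blast
  let ?C = "connected_component_set (Ucoords n) x"
  have C: "connected ?C" "?C \<subseteq> Ucoords n" "x \<in> ?C"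
    using xR(2) by (auto simp: connected_component_refl connected_component_subset)
  have "?C \<subseteq> ?R"
  proof -
    define Q where "Q = (\<Union>O'\<in>{O'. O' \<noteq> cls n c}. region n O')"
    have "open Q" unfolding Q_def using open_region by blast
    moreover have "?R \<inter> Q \<inter> ?C = {}"
    proof -
      have False if "z \<in> ?R" "z \<in> Q" for z
      proof -
        obtain O' where "O' \<noteq> cls n c" "z \<in> region n O'" using \<open>z \<in> Q\<close> by (auto simp: Q_def)
        then show False using region_disjoint[OF \<open>z \<in> ?R\<close>, of O'] by simp
      qed
      then show ?thesis by blast
    qed
    moreover have "?C \<subseteq> ?R \<union> Q"
    proof
      fix z assume "z \<in> ?C"
      then have "z \<in> Ucoords n" using C(2) by blast
      then have "\<exists>d. d \<subseteq> tri n \<and> z \<in> region n (cls n d)" by (rule region_cover)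
      then obtain d where "d \<subseteq> tri n \<and> z \<in> region n (cls n d)" ..
      then have d: "z \<in> region n (cls n d)" ..
      show "z \<in> ?R \<union> Q"
      proof (cases "cls n d = cls n c")
        case True
        then show ?thesis using d by simp
      next
        case False
        then have "z \<in> Q" using d unfolding Q_def by (intro UN_I[of "cls n d"]) simp_all
        then show ?thesis by simp
      qed
    qed
    ultimately have "?R \<inter> ?C = {} \<or> Q \<inter> ?C = {}" using connectedD[OF C(1) open_region] by blast
    then show ?thesis using xR(1) C(3) \<open>?C \<subseteq> ?R \<union> Q\<close> by blast
  qed
  moreover have "?R \<inter> Ucoords n \<subseteq> closure ?C"
  proof
    fix q assume q: "q \<in> ?R \<inter> Ucoords n"
    then obtain N where N: "open N" "q \<in> N" "\<And>a. a \<in> N \<Longrightarrow> a \<in> torus n \<Longrightarrow> cls n (signs n a) = cls n c"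
      unfolding region_def eventually_nhds by auto
    show "q \<in> closure ?C"
    proof (rule closure_iff_nhds_not_empty[THEN iffD2], intro allI impI)
      fix A V assume A: "V \<subseteq> A" "open V" "q \<in> V"
      then obtain a where a: "a \<in> N" "a \<in> V" "a \<in> torus n"
        using torus_dense[of "N \<inter> V" q n] N by auto
      have "tri.reach (mutable n) c (signs n a)"
        using N(3)[OF a(1,3)] cls_eq_iff[of c n "signs n a"] finite_subset[OF c finite_tri] by simp
      moreover have "a \<in> cell n (signs n a)" using cell_iff[OF signs_subset] a(3) by blast
      ultimately have "connected_component (Ucoords n) x a" using reach_connected[OF _ c x] by blast
      then show "?C \<inter> A \<noteq> {}" using a(2) A(1) by auto
    qed
  qed
  ultimately show "connected (?R \<inter> Ucoords n)"
    using C(2) by (intro connected_intermediate_closure[OF C(1)]) simp_all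
qed

section \<open>Components of the space of matrices\<close>

lemma connected_components_of_open_partition:
  assumes cover: "\<Union>\<C> = topspace X" and op: "\<And>C. C \<in> \<C> \<Longrightarrow> openin X C"
    and conn: "\<And>C. C \<in> \<C> \<Longrightarrow> connectedin X C" and ne: "{} \<notin> \<C>"
    and disj: "\<And>C D. C \<in> \<C> \<Longrightarrow> D \<in> \<C> \<Longrightarrow> C \<noteq> D \<Longrightarrow> C \<inter> D = {}"
  shows "connected_components_of X = \<C>"
proof -
  have comp: "connected_component_of_set X x = C" if "C \<in> \<C>" "x \<in> C" for C x
  proof
    have "topspace X - C = \<Union>(\<C> - {C})"
    proof (intro equalityI subsetI)
      fix z assume "z \<in> topspace X - C"
      then obtain D where "D \<in> \<C>" "z \<in> D" "z \<notin> C" unfolding cover[symmetric] by blast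
      then show "z \<in> \<Union>(\<C> - {C})" by blast
    next
      fix z assume "z \<in> \<Union>(\<C> - {C})"
      then obtain D where D: "D \<in> \<C>" "D \<noteq> C" "z \<in> D" by blast
      have "D \<inter> C = {}" by (rule disj[OF D(1) that(1) D(2)])
      then show "z \<in> topspace X - C" using D unfolding cover[symmetric] by blast
    qed
    moreover have "openin X (\<Union>(\<C> - {C}))" by (rule openin_Union) (simp add: op)
    moreover have "C \<subseteq> topspace X" using that(1) unfolding cover[symmetric] by blast
    ultimately have "closedin X C" by (simp add: closedin_def)
    then have "connected_component_of_set X x \<subseteq> C \<or> disjnt (connected_component_of_set X x) C"
      using op[OF that(1)] connectedin_connected_component_of[of X x]
      by (intro connectedin_clopen_cases)
    moreover have "x \<in> connected_component_of_set X x"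
      using that cover by (auto simp: connected_component_of_refl)
    ultimately show "connected_component_of_set X x \<subseteq> C" using that(2) by (auto simp: disjnt_iff)
    show "C \<subseteq> connected_component_of_set X x"
      by (rule connected_component_of_maximal[OF conn[OF that(1)] that(2)])
  qed
  show ?thesis
  proof (intro equalityI subsetI)
    fix D assume "D \<in> connected_components_of X"
    then obtain x where x: "x \<in> topspace X" "D = connected_component_of_set X x"
      by (auto simp: connected_components_of_def)
    then obtain C where "C \<in> \<C>" "x \<in> C" using cover by blast
    then show "D \<in> \<C>" using comp x(2) by simp
  next
    fix C assume C: "C \<in> \<C>"
    then have "C \<noteq> {}" using ne by auto
    then obtain x where "x \<in> C" by blast
    then have "connected_component_of_set X x = C" "x \<in> topspace X"
      using comp[OF C] C unfolding cover[symmetric] by auto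
    then show "C \<in> connected_components_of X" unfolding connected_components_of_def by blast
  qed
qed

definition to_mat :: "nat \<Rightarrow> coords \<Rightarrow> real mat" where
  "to_mat m x = mat m m (\<lambda>(r, c). ent x r c)"

definition of_mat :: "nat \<Rightarrow> real mat \<Rightarrow> coords" where
  "of_mat m A = (\<lambda>(r, c). if r < c \<and> c < m then A $$ (r, c) else 0)"

lemma to_mat_unipotent: "to_mat m x \<in> unipotent_mats m"
  by (auto simp: to_mat_def unipotent_mats_def ent_def)

lemma to_mat_of_mat: "A \<in> unipotent_mats m \<Longrightarrow> to_mat m (of_mat m A) = A"
  by (intro eq_matI) (auto simp: to_mat_def of_mat_def unipotent_mats_def ent_def upper_triangular_def not_less_iff_gr_or_eq)

lemma of_mat_to_mat: "r < c \<Longrightarrow> c < m \<Longrightarrow> of_mat m (to_mat m x) (r, c) = x (r, c)"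
  by (simp add: to_mat_def of_mat_def ent_def)

lemma corner_minor_to_mat:
  assumes "k \<le> m" shows "corner_minor m (to_mat m x) k = minor x (m - k) k"
proof -
  have "to_mat m x \<in> carrier_mat m m" by (simp add: to_mat_def)
  then have "corner_minor m (to_mat m x) k = Determinant.det (mat k k (\<lambda>(a, b). to_mat m x $$ (a, m - k + b)))"
    using assms by (rule corner_minor_eq)
  also have "mat k k (\<lambda>(a, b). to_mat m x $$ (a, m - k + b)) = mat k k (\<lambda>(r, j). colv x (m - k + j) r)"
    using assms by (intro eq_matI) (auto simp: to_mat_def colv_def)
  finally show ?thesis by (simp add: minor_def cdet_def)
qed

lemma to_mat_in_U: "to_mat (n + 1) x \<in> U_set (n + 1) \<longleftrightarrow> x \<in> Ucoords n"
  using to_mat_unipotent[of "n + 1" x] by (auto simp: U_set_def Ucoords_def corner_minor_to_mat)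

lemma continuous_map_to_mat:
  assumes "S \<subseteq> Ucoords n"
  shows "continuous_map (top_of_set S) (U_space (n + 1)) (to_mat (n + 1))"
proof -
  let ?I = "{..<n + 1} \<times> {..<n + 1}"
  have "continuous_map (top_of_set S) (mat_topology (n + 1)) (to_mat (n + 1))"
    unfolding mat_topology_def
  proof (rule continuous_map_pullback')
    show "continuous_map (top_of_set S) (product_topology (\<lambda>_. euclideanreal) ?I)
        ((\<lambda>A. \<lambda>p\<in>?I. A $$ p) \<circ> to_mat (n + 1))"
    proof (rule continuous_map_coordinatewise_then_product)
      fix p assume p: "p \<in> ?I"
      then have "(\<lambda>x. ((\<lambda>A. \<lambda>p\<in>?I. A $$ p) \<circ> to_mat (n + 1)) x p) = (\<lambda>x. ent x (fst p) (snd p))"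
        by (cases p) (auto simp: to_mat_def)
      then show "continuous_map (top_of_set S) euclideanreal (\<lambda>x. ((\<lambda>A. \<lambda>p\<in>?I. A $$ p) \<circ> to_mat (n + 1)) x p)"
        using continuous_ent by (simp add: continuous_map_iff_continuous)
    qed auto
    show "topspace (top_of_set S) \<subseteq> to_mat (n + 1) -` carrier_mat (n + 1) (n + 1)"
      by (auto simp: to_mat_def)
  qed
  then show ?thesis unfolding U_space_def
    using assms by (intro continuous_map_into_subtopology) (auto simp: to_mat_in_U[of n, simplified])
qed

lemma openin_of_mat:
  assumes "open T"
  shows "openin (U_space (n + 1)) {A \<in> U_set (n + 1). of_mat (n + 1) A \<in> T}"
proof -
  let ?I = "{..<n + 1} \<times> {..<n + 1}"
  have "continuous_map (U_space (n + 1)) (product_topology (\<lambda>_. euclideanreal) UNIV) (of_mat (n + 1))"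
  proof (rule continuous_map_coordinatewise_then_product)
    fix p :: "nat \<times> nat"
    obtain r c where p: "p = (r, c)" by force
    show "continuous_map (U_space (n + 1)) euclideanreal (\<lambda>A. of_mat (n + 1) A p)"
    proof (cases "r < c \<and> c < n + 1")
      case True
      then have pI: "p \<in> ?I" by (simp add: p)
      have "continuous_map (mat_topology (n + 1)) (product_topology (\<lambda>_. euclideanreal) ?I) (\<lambda>A. \<lambda>p\<in>?I. A $$ p)"
        unfolding mat_topology_def
        using continuous_map_pullback[OF continuous_map_id[of "product_topology (\<lambda>_. euclideanreal) ?I"],
            where A = "carrier_mat (n + 1) (n + 1)" and f = "\<lambda>A. \<lambda>p\<in>?I. A $$ p"]
        by (simp only: id_comp)
      then have "continuous_map (mat_topology (n + 1)) euclideanreal (\<lambda>A. (\<lambda>p\<in>?I. A $$ p) p)"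
        using pI by (rule continuous_map_product_then_coordinatewise)
      then have "continuous_map (mat_topology (n + 1)) euclideanreal (\<lambda>A. A $$ p)"
        using pI by simp
      then show ?thesis unfolding U_space_def using True
        by (simp add: of_mat_def p continuous_map_from_subtopology)
    qed (auto simp: of_mat_def p)
  qed auto
  then have "continuous_map (U_space (n + 1)) euclidean (of_mat (n + 1))"
    by (simp add: euclidean_product_topology)
  then have "openin (U_space (n + 1)) {A \<in> topspace (U_space (n + 1)). of_mat (n + 1) A \<in> T}"
    by (rule openin_continuous_map_preimage) (use assms in simp)
  then show ?thesis by (simp only: topspace_U_space)
qed

text \<open>
  The components are the images of the regions.
\<close>

theorem card_components:
  "card (connected_components_of (U_space (n + 1))) = card (cls n ` Pow (tri n))"
proof -
  define comp where "comp O' = to_mat (n + 1) ` (region n O' \<inter> Ucoords n)" for O'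
  have mem: "A \<in> comp O' \<longleftrightarrow> A \<in> U_set (n + 1) \<and> of_mat (n + 1) A \<in> region n O'" for A O'
  proof
    assume "A \<in> comp O'"
    then obtain x where x: "x \<in> region n O'" "x \<in> Ucoords n" "A = to_mat (n + 1) x" by (auto simp: comp_def)
    have "of_mat (n + 1) A \<in> region n O'"
      by (rule region_cong[OF _ x(1)]) (simp add: x(3) of_mat_to_mat del: add_Suc_right)
    then show "A \<in> U_set (n + 1) \<and> of_mat (n + 1) A \<in> region n O'"
      using x to_mat_in_U by simp
  next
    assume A: "A \<in> U_set (n + 1) \<and> of_mat (n + 1) A \<in> region n O'"
    then have "to_mat (n + 1) (of_mat (n + 1) A) = A" by (intro to_mat_of_mat) (auto simp: U_set_def)
    then show "A \<in> comp O'" using A to_mat_in_U[of n "of_mat (n + 1) A"]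
      unfolding comp_def by (intro image_eqI[of _ _ "of_mat (n + 1) A"]) auto
  qed
  have disj: "O1 = O2" if "comp O1 \<inter> comp O2 \<noteq> {}" for O1 O2
    using that mem region_disjoint by blast
  have ne: "comp (cls n c) \<noteq> {}" if "c \<subseteq> tri n" for c
    using region_connected(2)[OF that] by (simp add: comp_def)
  have "connected_components_of (U_space (n + 1)) = comp ` cls n ` Pow (tri n)"
  proof (rule connected_components_of_open_partition)
    show "\<Union> (comp ` cls n ` Pow (tri n)) = topspace (U_space (n + 1))"
    proof (intro equalityI subsetI)
      fix A assume "A \<in> topspace (U_space (n + 1))"
      then have A: "A \<in> U_set (n + 1)" by (simp only: topspace_U_space)
      then have "to_mat (n + 1) (of_mat (n + 1) A) = A" by (intro to_mat_of_mat) (auto simp: U_set_def)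
      then have "of_mat (n + 1) A \<in> Ucoords n" using A to_mat_in_U by metis
      then obtain c where "c \<subseteq> tri n" "of_mat (n + 1) A \<in> region n (cls n c)" using region_cover by blast
      then show "A \<in> \<Union> (comp ` cls n ` Pow (tri n))" using A mem by blast
    qed (auto simp: mem topspace_U_space simp del: add_Suc_right Suc_eq_plus1)
    show "openin (U_space (n + 1)) C" if C: "C \<in> comp ` cls n ` Pow (tri n)" for C
    proof -
      obtain O' where "C = comp O'" using C by blast
      then have "C = {A \<in> U_set (n + 1). of_mat (n + 1) A \<in> region n O'}" using mem by blast
      then show ?thesis using openin_of_mat[OF open_region] by simp
    qed
    show "connectedin (U_space (n + 1)) C" if C: "C \<in> comp ` cls n ` Pow (tri n)" for C
    proof -
      obtain c where c: "c \<subseteq> tri n" "C = comp (cls n c)" using C by blast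
      let ?S = "region n (cls n c) \<inter> Ucoords n"
      have "connectedin (top_of_set ?S) ?S"
        using region_connected(1)[OF c(1)] by (simp add: connectedin_subtopology)
      then show ?thesis
        using connectedin_continuous_map_image[OF continuous_map_to_mat[of ?S n]] c(2)
        by (simp add: comp_def)
    qed
    show "{} \<notin> comp ` cls n ` Pow (tri n)" using ne by blast
    show "C \<inter> D = {}" if CD: "C \<in> comp ` cls n ` Pow (tri n)" "D \<in> comp ` cls n ` Pow (tri n)" "C \<noteq> D" for C D
    proof -
      obtain O1 O2 where "C = comp O1" "D = comp O2" using CD(1,2) by (elim imageE)
      then show ?thesis using disj[of O1 O2] CD(3) by auto
    qed
  qed
  moreover have "inj_on comp (cls n ` Pow (tri n))"
  proof (rule inj_onI)
    fix O1 O2 assume "O1 \<in> cls n ` Pow (tri n)" "O2 \<in> cls n ` Pow (tri n)" "comp O1 = comp O2"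
    then show "O1 = O2" using disj[of O1 O2] ne by blast
  qed
  ultimately show ?thesis by (simp add: card_image)
qed

theorem mainTheorem1:
  fixes n :: nat
  assumes "n \<ge> 5"
  shows "card (connected_components_of (U_space (n + 1))) = 3 * 2 ^ n
       \<and> card (orbits (G_group n) (T_mats n) (\<lambda>g. g)) = 3 * 2 ^ n"
  unfolding card_components card_orbits_eq_card_cls card_cls[OF assms] by simp

end
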